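(* Let $a>0$, $\Omega>0$, $R>0$. The following statements describe all the profiles of the $\mathcal C^2$-solutions of $$\mathbf x\times\ddot{\mathbf x}-\Omega\,e_3\times\mathbf x+a\,\dot{\mathbf x}=0,\qquad \|\mathbf x\|\equiv R,$$ such that $|x_3|<R$. (For each solution, $C,E$ are its conserved quantities and $P$ the associated cubic polynomial, as in the context.) (a) (Constant-latitude solutions.) The non-polar constant-latitude solutions are precisely the curves $$\mathbf x(\xi)=\Big(\sqrt{R^2-e^2}\cos(\phi_0+\nu\xi),\ \sqrt{R^2-e^2}\sin(\phi_0+\nu\xi),\ e\Big),$$ where $e\in(-R,R)$, $\phi_0\in\mathbb R$ and $e\nu^2-a\nu+\Omega=0$. Moreover $\nu=\frac{C-ae}{R^2-e^2}$. In particular $\mathbf x$ parametrizes a horizontal circle on the sphere $\|\mathbf x\|=R$ at height $x_3\equiv e$, with constant angular velocity $\nu$. (b) (Periodic and quasi-periodic rotating solutions.) Assume that $P$ has three real roots $e_1<e_2<e_3$ such that $-R<e_1<e_2<R$. Then every solution with non-constant $x_3$-component is of the form $$\mathbf x(\xi)=\big(R\sqrt{1-z(\xi)^2}\cos\phi(\xi),\ R\sqrt{1-z(\xi)^2}\sin\phi(\xi),\ Rz(\xi)\big),\qquad(\ast)$$ where $$z(\xi)=\tfrac1R\big(e_1+(e_2-e_1)\,\mathrm{sn}^2(\omega(\xi-\xi_0)\,|\,k)\big),\quad \omega=\sqrt{\tfrac{\Omega}{2R^2}(e_3-e_1)},\quad k:=\tfrac{e_2-e_1}{e_3-e_1}\in(0,1),$$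 and $$\phi(\xi)=\phi_0+\frac{C-aR}{2R(R-e_1)\omega}\,\Pi\Big(\omega(\xi-\xi_0)\,\Big|\,\frac{e_2-e_1}{R-e_1},k\Big)+\frac{C+aR}{2R(R+e_1)\omega}\,\Pi\Big(\omega(\xi-\xi_0)\,\Big|\,-\frac{e_2-e_1}{R+e_1},k\Big),$$ for some $\xi_0,\phi_0\in\mathbb R$. Let $\mathcal T:=\frac{2K(k)}{\omega}$. Then $z$ (and hence $x_3=Rz$) has minimal period $\mathcal T$. (b)(i) The solution $(\ast)$ is periodic if and only if there exist $p,q\in\mathbb Z$, $q\ge1$, $\gcd(p,q)=1$, such that $$\frac{C-aR}{R(R-e_1)}\,\Pi\Big(\frac{e_2-e_1}{R-e_1}\,\Big|\,k\Big)+\frac{C+aR}{R(R+e_1)}\,\Pi\Big(-\frac{e_2-e_1}{R+e_1}\,\Big|\,k\Big)=2\pi\,\omega\,\frac pq.\qquad(\ast\ast)$$ In this case the minimal period of $\mathbf x$ is $q\,\mathcal T$. (b)(ii) If $(\ast\ast)$ does not hold for any $p,q\in\mathbb Z$, $q\ge1$, $\gcd(p,q)=1$, then the solution $(\ast)$ is quasi-periodic: $x_3$ is periodic of period $\mathcal T$, while the azimuthal angle $\phi$ winds on the circle with an incommensurable rotation number (i.e. $(\phi(\xi+\mathcal T)-\phi(\xi))/2\pi$ is irrational), and therefore $\mathbf x$ does not close up. (c) (Soliton-type solutions.) Assume that $P$ has two real roots $-R<e_1<e_2=R$, with $e_2$ of multiplicity $2$. Then necessarily $C=aR$, and every solution with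 non-constant $x_3$-component is of the form $(\ast)$ with $$z(\xi)=\tfrac1R\big(e_1+(R-e_1)\tanh^2(\omega(\xi-\xi_0))\big),\quad \omega=\sqrt{\tfrac{\Omega}{2R^2}(R-e_1)},\quad \delta=\sqrt{\tfrac{R-e_1}{R+e_1}},$$ $$\phi(\xi)=\phi_0+\frac a{2R}\Big(\xi-\xi_0+\frac{\delta}{\omega}\arctan\big(\delta\tanh(\omega(\xi-\xi_0))\big)\Big),$$ for some $\xi_0,\phi_0\in\mathbb R$. In particular $z(\xi)\to1$ and $\mathbf x(\xi)$ converges to the north pole $(0,0,R)$ as $|\xi|\to\infty$, and these solutions are not periodic.
   Context: $e_3$ in the equation denotes the vector $(0,0,1)$, while in items (b),(c) $e_1,e_2,e_3$ denote real roots of $P$. Dots are derivatives in the real variable $\xi$; solutions are $\mathcal C^2$ on an open interval, and periodicity and limits refer to the solution given for all $\xi\in\mathbb R$ by the stated formulas. "Describe all" means that every such solution with $|x_3|<R$ falls under (a), (b) or (c). "Non-polar" means $|x_3|<R$; "constant-latitude" means $x_3$ constant. Conserved quantities: for every solution, $C=x_1\dot x_2-x_2\dot x_1+ax_3$ and $E=\frac a2\|\dot{\mathbf x}\|^2+\Omega(x_2\dot x_1-x_1\dot x_2)$ are constant in $\xi$, and $u=x_3$ satisfies $\dot u^2=P(u)$ with $P(s)=a_3s^3-a_2s^2+a_1s+a_0$, $a_0=\frac{2ER^2-aC^2+2\Omega CR^2}{aR^2}$, $a_1=\frac{2aC-2\Omega R^2}{R^2}$, $a_2=\frac{2E+a^3+2\Omega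 C}{aR^2}$, $a_3=\frac{2\Omega}{R^2}$. Elliptic conventions (parameter $k\in(0,1)$, not squared): $K(k)=\int_0^{\pi/2}\frac{d\theta}{\sqrt{1-k\sin^2\theta}}$; $\mathrm{sn}(u\,|\,k)=\sin\varphi$ where $u=\int_0^\varphi\frac{d\theta}{\sqrt{1-k\sin^2\theta}}$; incomplete integral of the third kind in Jacobi form $\Pi(u\,|\,n,k)=\int_0^u\frac{d\tau}{1-n\,\mathrm{sn}^2(\tau|k)}$; complete integral of the third kind $\Pi(n\,|\,k)=\frac12\int_0^{2K(k)}\frac{d\tau}{1-n\,\mathrm{sn}^2(\tau|k)}$.
   Formalization: The claim that all solutions with |x_3|<R fall under (a), (b) or (c) is proved for solutions none of whose continuations to a larger open interval reaches a pole; as worded it fails for short arcs of solutions that pass through a pole with nonzero speed. *)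

theory Defs
  imports "HOL-Analysis.Analysis" "HOL-Library.Periodic_Fun"
begin

unbundle cross3_syntax

definition open_interval :: "real set \<Rightarrow> bool" where
  "open_interval I \<longleftrightarrow> open I \<and> is_interval I \<and> I \<noteq> {}"

definition vel :: "(real \<Rightarrow> real^3) \<Rightarrow> real \<Rightarrow> real^3" where
  "vel x \<xi> = vector_derivative x (at \<xi>)"

definition acc :: "(real \<Rightarrow> real^3) \<Rightarrow> real \<Rightarrow> real^3" where
  "acc x = vel (vel x)"

definition C2_on :: "(real \<Rightarrow> real^3) \<Rightarrow> real set \<Rightarrow> bool" where
  "C2_on x I \<longleftrightarrow> x C1_differentiable_on I \<and> vel x C1_differentiable_on I"

definition unit3 :: "real^3" where
  "unit3 = vector [0, 0, 1]"

text \<open>A curve is a total function on the reals; only its values on the open interval \<open>I\<close> matter.\<close>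

definition is_solution ::
    "real \<Rightarrow> real \<Rightarrow> real \<Rightarrow> real set \<Rightarrow> (real \<Rightarrow> real^3) \<Rightarrow> bool" where
  "is_solution a \<Omega> R I x \<longleftrightarrow> open_interval I \<and> C2_on x I \<and>
     (\<forall>\<xi>\<in>I. x \<xi> \<times> acc x \<xi> - \<Omega> *\<^sub>R (unit3 \<times> x \<xi>) + a *\<^sub>R vel x \<xi> = 0) \<and>
     (\<forall>\<xi>\<in>I. norm (x \<xi>) = R)"

definition nonpolar_solution ::
    "real \<Rightarrow> real \<Rightarrow> real \<Rightarrow> real set \<Rightarrow> (real \<Rightarrow> real^3) \<Rightarrow> bool" where
  "nonpolar_solution a \<Omega> R I x \<longleftrightarrow> is_solution a \<Omega> R I x \<and> (\<forall>\<xi>\<in>I. \<bar>x \<xi> $ 3\<bar> < R)"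

text \<open>
  Some solutions run through a pole with nonzero speed. Restricted to an interval free of such
  passages they satisfy \<open>\<bar>x\<^sub>3\<bar> < R\<close>, but they are not among the profiles being described. So, for the
  claim that the description is complete, the condition \<open>\<bar>x\<^sub>3\<bar> < R\<close> has to be imposed on the
  solution and on all its continuations (the case \<open>J = I\<close>, \<open>y = x\<close> is the condition on \<open>x\<close> itself).
\<close>

definition never_polar_solution ::
    "real \<Rightarrow> real \<Rightarrow> real \<Rightarrow> real set \<Rightarrow> (real \<Rightarrow> real^3) \<Rightarrow> bool" where
  "never_polar_solution a \<Omega> R I x \<longleftrightarrow> is_solution a \<Omega> R I x \<and>
     (\<forall>J y. I \<subseteq> J \<and> is_solution a \<Omega> R J y \<and> (\<forall>\<xi>\<in>I. y \<xi> = x \<xi>) \<longrightarrow> nonpolar_solution a \<Omega> R J y)"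

definition constant_latitude :: "real set \<Rightarrow> (real \<Rightarrow> real^3) \<Rightarrow> bool" where
  "constant_latitude I x \<longleftrightarrow> (\<lambda>\<xi>. x \<xi> $ 3) constant_on I"

definition conserved ::
    "real \<Rightarrow> real \<Rightarrow> real set \<Rightarrow> (real \<Rightarrow> real^3) \<Rightarrow> real \<Rightarrow> real \<Rightarrow> bool" where
  "conserved a \<Omega> I x C E \<longleftrightarrow> (\<forall>\<xi>\<in>I.
     C = x \<xi> $ 1 * vel x \<xi> $ 2 - x \<xi> $ 2 * vel x \<xi> $ 1 + a * x \<xi> $ 3 \<and>
     E = a / 2 * (norm (vel x \<xi>))\<^sup>2 + \<Omega> * (x \<xi> $ 2 * vel x \<xi> $ 1 - x \<xi> $ 1 * vel x \<xi> $ 2))"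

definition cubic :: "real \<Rightarrow> real \<Rightarrow> real \<Rightarrow> real \<Rightarrow> real \<Rightarrow> real poly" where
  "cubic a \<Omega> R C E =
     (let a0 = (2 * E * R\<^sup>2 - a * C\<^sup>2 + 2 * \<Omega> * C * R\<^sup>2) / (a * R\<^sup>2);
          a1 = (2 * a * C - 2 * \<Omega> * R\<^sup>2) / R\<^sup>2;
          a2 = (2 * E + a ^ 3 + 2 * \<Omega> * C) / (a * R\<^sup>2);
          a3 = 2 * \<Omega> / R\<^sup>2
      in [: a0, a1, - a2, a3 :])"

definition periodic_roots :: "real \<Rightarrow> real poly \<Rightarrow> real \<Rightarrow> real \<Rightarrow> real \<Rightarrow> bool" where
  "periodic_roots R P e1 e2 e3 \<longleftrightarrow> poly P e1 = 0 \<and> poly P e2 = 0 \<and> poly P e3 = 0 \<and>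
     - R < e1 \<and> e1 < e2 \<and> e2 < e3 \<and> e2 < R"

definition soliton_roots :: "real \<Rightarrow> real poly \<Rightarrow> real \<Rightarrow> bool" where
  "soliton_roots R P e1 \<longleftrightarrow> poly P e1 = 0 \<and> - R < e1 \<and> e1 < R \<and> order R P = 2"

text \<open>
  The last argument \<open>k\<close> is the parameter (not its square root), with \<open>0 < k < 1\<close>. Interval
  integrals are oriented, so all functions are defined for negative arguments as well.
\<close>

definition ellip_F :: "real \<Rightarrow> real \<Rightarrow> real" where
  "ellip_F \<phi> k = (LBINT \<theta>=ereal 0..ereal \<phi>. 1 / sqrt (1 - k * (sin \<theta>)\<^sup>2))"

definition ellip_K :: "real \<Rightarrow> real" where
  "ellip_K k = ellip_F (pi / 2) k"

definition jacobi_am :: "real \<Rightarrow> real \<Rightarrow> real" where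
  "jacobi_am u k = (THE \<phi>. u = ellip_F \<phi> k)"

definition jacobi_sn :: "real \<Rightarrow> real \<Rightarrow> real" where
  "jacobi_sn u k = sin (jacobi_am u k)"

definition ellip_Pi_inc :: "real \<Rightarrow> real \<Rightarrow> real \<Rightarrow> real" where
  "ellip_Pi_inc u n k = (LBINT \<tau>=ereal 0..ereal u. 1 / (1 - n * (jacobi_sn \<tau> k)\<^sup>2))"

definition ellip_Pi :: "real \<Rightarrow> real \<Rightarrow> real" where
  "ellip_Pi n k = 1 / 2 * (LBINT \<tau>=ereal 0..ereal (2 * ellip_K k). 1 / (1 - n * (jacobi_sn \<tau> k)\<^sup>2))"

definition latitude_circle :: "real \<Rightarrow> real \<Rightarrow> real \<Rightarrow> real \<Rightarrow> real \<Rightarrow> real^3" where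
  "latitude_circle R e \<phi>\<^sub>0 \<nu> \<xi> =
     vector [sqrt (R\<^sup>2 - e\<^sup>2) * cos (\<phi>\<^sub>0 + \<nu> * \<xi>), sqrt (R\<^sup>2 - e\<^sup>2) * sin (\<phi>\<^sub>0 + \<nu> * \<xi>), e]"

definition sphere_curve :: "real \<Rightarrow> (real \<Rightarrow> real) \<Rightarrow> (real \<Rightarrow> real) \<Rightarrow> real \<Rightarrow> real^3" where
  "sphere_curve R z \<phi> \<xi> =
     vector [R * sqrt (1 - (z \<xi>)\<^sup>2) * cos (\<phi> \<xi>), R * sqrt (1 - (z \<xi>)\<^sup>2) * sin (\<phi> \<xi>), R * z \<xi>]"

definition periodic :: "(real \<Rightarrow> 'b) \<Rightarrow> bool" where
  "periodic f \<longleftrightarrow> (\<exists>T>0. periodic_fun_simple f T)"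

definition minimal_period :: "(real \<Rightarrow> 'b) \<Rightarrow> real \<Rightarrow> bool" where
  "minimal_period f T \<longleftrightarrow> T > 0 \<and> periodic_fun_simple f T \<and>
     (\<forall>S. 0 < S \<and> S < T \<longrightarrow> \<not> periodic_fun_simple f S)"

end

theory Submission
  imports Defs "HOL-Real_Asymp.Real_Asymp"
begin

text \<open>
  The equation of motion is a second-order ODE on the sphere whose right-hand side is Lipschitz in
  position and velocity, since the speed is bounded along solutions. So a solution is determined by
  its position and velocity at one time. Off the poles these are determined by the azimuth, by
  \<open>x\<^sub>3\<close> and its derivative, and by \<open>C\<close>. A solution can therefore be identified with an explicit curve
  \<open>(r cos \<phi>, r sin \<phi>, u)\<close> once \<open>u\<close> solves \<open>u'\<^sup>2 = P(u)\<close> and \<open>u'' = P'(u)/2\<close>, \<open>r\<^sup>2 \<phi>' = C - a u\<close>, and \<open>u\<close>,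
  \<open>u'\<close> match at one time. Everything rests on the identity
  \<open>R\<^sup>2 P(s) = (R\<^sup>2 - s\<^sup>2) (V - 2 \<Omega> s) - (C - a s)\<^sup>2\<close> with \<open>V = 2 (E + \<Omega> C) / a\<close>. It gives \<open>P(\<plusminus>R) \<le> 0\<close>,
  with \<open>P(\<plusminus>R) = 0\<close> only for \<open>C = \<plusminus>aR\<close>, which restricts the position of the roots. The remaining
  configurations, with a simple root at a pole bounding the oscillation, belong to curves that
  cross that pole: there \<open>r\<close> is a smooth function changing sign, so the curve continues smoothly.
\<close>

section \<open>Solutions in coordinates\<close>

text \<open>The scalar equation \<open>u'\<^sup>2 = P(u)\<close> alone does not determine
  \<open>u\<close>: at a turning point the constant continuation satisfies it too. So a solution
  with varying latitude is matched at a time where \<open>x\<^sub>3\<close> has nonzero derivative,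
  including the sign of that derivative, and uniqueness is applied to the full second-order
  equation, which carries the match across turning points. The bound on the speed comes from
  \<open>E + \<Omega> * C\<close>, in which the angular momentum cancels: the squared speed is
  \<open>V - 2 * \<Omega> * x\<^sub>3\<close>, and this is where the constant \<open>V\<close>
  originates. The displayed identity is then Lagrange's identity for the horizontal parts of
  position and velocity. The two integrals of the third kind are the two partial fractions of
  \<open>(C - a * u) / (R\<^sup>2 - u\<^sup>2)\<close>, one for each pole of the sphere. If
  \<open>C = \<plusminus>aR\<close>, the fraction belonging to one pole disappears, so the azimuth
  stays smooth when the curve runs through that pole. Whether a curve closes up depends on one
  number, the azimuth gained during one period of the latitude.\<close>

lemma vec3_eq: "(vector [p, q, r] :: real^3) = p *\<^sub>R axis 1 1 + q *\<^sub>R axis 2 1 + r *\<^sub>R axis 3 1"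
  by (simp add: vec_eq_iff forall_3 axis_def)

lemma has_vector_derivative_vec3:
  fixes f g h :: "real \<Rightarrow> real"
  assumes "(f has_real_derivative f') (at t within S)" "(g has_real_derivative g') (at t within S)"
    "(h has_real_derivative h') (at t within S)"
  shows "((\<lambda>t. vector [f t, g t, h t] :: real^3) has_vector_derivative vector [f', g', h']) (at t within S)"
  unfolding vec3_eq by (auto intro!: derivative_eq_intros assms)

lemma has_real_derivative_nth:
  fixes x :: "real \<Rightarrow> real^'n"
  assumes "(x has_vector_derivative d) F"
  shows "((\<lambda>t. x t $ i) has_real_derivative d $ i) F"
  using bounded_linear.has_vector_derivative[OF bounded_linear_vec_nth assms]
  by (simp add: has_real_derivative_iff_has_vector_derivative)

lemma continuous_on_vec3:
  fixes f g h :: "real \<Rightarrow> real"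
  assumes "continuous_on S f" "continuous_on S g" "continuous_on S h"
  shows "continuous_on S (\<lambda>t. vector [f t, g t, h t] :: real^3)"
  unfolding vec3_eq by (intro continuous_intros assms)

lemma vel_eq: "(x has_vector_derivative d) (at t) \<Longrightarrow> vel x t = d"
  unfolding vel_def by (rule vector_derivative_at)

lemma vel_cong:
  assumes "open I" "t \<in> I" "\<And>s. s \<in> I \<Longrightarrow> x s = y s"
  shows "vel x t = vel y t"
proof -
  have "(x has_vector_derivative d) (at t) \<longleftrightarrow> (y has_vector_derivative d) (at t)" for d
    using assms by (metis has_vector_derivative_transform_within_open)
  then show ?thesis
    by (simp add: vel_def vector_derivative_def)
qed

lemma C2_on_D:
  assumes "C2_on x I" "t \<in> I"
  shows "(x has_vector_derivative vel x t) (at t)" "(vel x has_vector_derivative acc x t) (at t)"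
  using assms unfolding C2_on_def C1_differentiable_on_def acc_def by (metis vel_eq)+

lemma C2_onI:
  assumes "open I" "\<And>t. t \<in> I \<Longrightarrow> (x has_vector_derivative v t) (at t)"
    and "\<And>t. t \<in> I \<Longrightarrow> (v has_vector_derivative w t) (at t)" "continuous_on I w"
  shows "C2_on x I" "\<And>t. t \<in> I \<Longrightarrow> vel x t = v t" "\<And>t. t \<in> I \<Longrightarrow> acc x t = w t"
proof -
  show v: "vel x t = v t" if "t \<in> I" for t
    using that assms(2) by (simp add: vel_eq)
  have dv: "(vel x has_vector_derivative w t) (at t)" if "t \<in> I" for t
    using assms(3)[OF that] v has_vector_derivative_transform_within_open[OF _ assms(1) that]
    by metis
  show "acc x t = w t" if "t \<in> I" for t
    unfolding acc_def using dv[OF that] by (rule vel_eq)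
  have "continuous_on I v"
    using assms(3) by (meson continuous_at_imp_continuous_on has_vector_derivative_continuous)
  then show "C2_on x I"
    unfolding C2_on_def C1_differentiable_on_def using assms(2,4) dv by blast
qed

lemma is_solution_cong:
  assumes "\<And>t. t \<in> I \<Longrightarrow> x t = y t" "is_solution a \<Omega> R I x"
  shows "is_solution a \<Omega> R I y"
proof -
  have op: "open I" and C2: "C2_on x I"
    using assms(2) by (auto simp: is_solution_def open_interval_def)
  have 1: "(y has_vector_derivative vel x t) (at t)" if "t \<in> I" for t
    using C2_on_D(1)[OF C2 that] assms(1) has_vector_derivative_transform_within_open[OF _ op that]
    by metis
  have 2: "(vel x has_vector_derivative acc x t) (at t)" if "t \<in> I" for t
    by (rule C2_on_D(2)[OF C2 that])
  have "continuous_on I (acc x)"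
    using C2 vel_eq unfolding C2_on_def C1_differentiable_on_def acc_def
    by (metis (no_types, lifting) continuous_on_cong)
  from C2_onI[OF op 1 2 this] assms show ?thesis
    by (simp add: is_solution_def)
qed

lemma is_solution_subset:
  assumes "is_solution a \<Omega> R J x" "open_interval I" "I \<subseteq> J"
  shows "is_solution a \<Omega> R I x"
  using assms unfolding is_solution_def C2_on_def C1_differentiable_on_def
  by (meson continuous_on_subset subsetD)

lemma norm_vec3: "(norm (x :: real^3))\<^sup>2 = (x $ 1)\<^sup>2 + (x $ 2)\<^sup>2 + (x $ 3)\<^sup>2"
  by (simp only: power2_norm_eq_inner inner_vec_def sum_3) (simp add: power2_eq_square)

lemma norm_eq_iff_vec3:
  assumes "R > 0"
  shows "norm (x :: real^3) = R \<longleftrightarrow> (x $ 1)\<^sup>2 + (x $ 2)\<^sup>2 + (x $ 3)\<^sup>2 = R\<^sup>2"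
  using assms by (metis less_imp_le norm_ge_zero norm_vec3 power2_eq_iff_nonneg)

lemma DERIV_constant_on_open:
  fixes f :: "real \<Rightarrow> real"
  assumes "(f has_real_derivative d) (at t)" "open I" "t \<in> I" "\<And>s. s \<in> I \<Longrightarrow> f s = c"
  shows "d = 0"
proof -
  have "(f has_real_derivative 0) (at t)"
    by (rule has_field_derivative_transform_within_open[OF DERIV_const[of c] assms(2,3)])
      (simp add: assms(4))
  then show ?thesis
    using assms(1) by (rule DERIV_unique[symmetric])
qed

text \<open>The last three items are the sphere constraint and its first and second derivatives; the
  second derivative ties the radial acceleration to the squared speed.\<close>

lemma is_solution_components:
  assumes "is_solution a \<Omega> R I x" "t \<in> I"
  shows "((\<lambda>t. x t $ i) has_real_derivative vel x t $ i) (at t)"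
    and "((\<lambda>t. vel x t $ i) has_real_derivative acc x t $ i) (at t)"
    and "x t $ 2 * acc x t $ 3 - x t $ 3 * acc x t $ 2 + \<Omega> * x t $ 2 + a * vel x t $ 1 = 0"
    and "x t $ 3 * acc x t $ 1 - x t $ 1 * acc x t $ 3 - \<Omega> * x t $ 1 + a * vel x t $ 2 = 0"
    and "x t $ 1 * acc x t $ 2 - x t $ 2 * acc x t $ 1 + a * vel x t $ 3 = 0"
    and "(x t $ 1)\<^sup>2 + (x t $ 2)\<^sup>2 + (x t $ 3)\<^sup>2 = R\<^sup>2"
    and "x t $ 1 * vel x t $ 1 + x t $ 2 * vel x t $ 2 + x t $ 3 * vel x t $ 3 = 0"
    and "x t $ 1 * acc x t $ 1 + x t $ 2 * acc x t $ 2 + x t $ 3 * acc x t $ 3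
           = - (norm (vel x t))\<^sup>2"
proof -
  have C2: "C2_on x I" and op: "open I"
    using assms by (auto simp: is_solution_def open_interval_def)
  have d1: "((\<lambda>t. x t $ i) has_real_derivative vel x t $ i) (at t)" if "t \<in> I" for t i
    using C2 that by (intro has_real_derivative_nth C2_on_D)
  show d2: "((\<lambda>t. vel x t $ i) has_real_derivative acc x t $ i) (at t)" for i
    using C2 assms(2) by (intro has_real_derivative_nth C2_on_D)
  have "x t \<times> acc x t - \<Omega> *\<^sub>R (unit3 \<times> x t) + a *\<^sub>R vel x t = 0"
    using assms by (auto simp: is_solution_def)
  then show "x t $ 2 * acc x t $ 3 - x t $ 3 * acc x t $ 2 + \<Omega> * x t $ 2 + a * vel x t $ 1 = 0"
    "x t $ 3 * acc x t $ 1 - x t $ 1 * acc x t $ 3 - \<Omega> * x t $ 1 + a * vel x t $ 2 = 0"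
    "x t $ 1 * acc x t $ 2 - x t $ 2 * acc x t $ 1 + a * vel x t $ 3 = 0"
    by (simp_all add: vec_eq_iff forall_3 cross3_def unit3_def)
  have sph: "(x t $ 1)\<^sup>2 + (x t $ 2)\<^sup>2 + (x t $ 3)\<^sup>2 = R\<^sup>2" if "t \<in> I" for t
    using assms(1) that norm_vec3[of "x t"] by (auto simp: is_solution_def)
  have orth: "x t $ 1 * vel x t $ 1 + x t $ 2 * vel x t $ 2 + x t $ 3 * vel x t $ 3 = 0"
    if "t \<in> I" for t
  proof -
    have "((\<lambda>t. (x t $ 1)\<^sup>2 + (x t $ 2)\<^sup>2 + (x t $ 3)\<^sup>2) has_real_derivative
        2 * (x t $ 1 * vel x t $ 1 + x t $ 2 * vel x t $ 2 + x t $ 3 * vel x t $ 3)) (at t)"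
      by (rule derivative_eq_intros d1 that refl)+ simp
    from DERIV_constant_on_open[OF this op that sph] show ?thesis
      by simp
  qed
  have "((\<lambda>t. x t $ 1 * vel x t $ 1 + x t $ 2 * vel x t $ 2 + x t $ 3 * vel x t $ 3)
      has_real_derivative (x t $ 1 * acc x t $ 1 + x t $ 2 * acc x t $ 2 + x t $ 3 * acc x t $ 3)
        + (norm (vel x t))\<^sup>2) (at t)"
    by (rule derivative_eq_intros d1 d2 assms refl)+ (simp only: norm_vec3, simp add: power2_eq_square)
  from DERIV_constant_on_open[OF this op assms(2) orth]
  show "x t $ 1 * acc x t $ 1 + x t $ 2 * acc x t $ 2 + x t $ 3 * acc x t $ 3
           = - (norm (vel x t))\<^sup>2"
    by simp
  show "((\<lambda>t. x t $ i) has_real_derivative vel x t $ i) (at t)"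
    "(x t $ 1)\<^sup>2 + (x t $ 2)\<^sup>2 + (x t $ 3)\<^sup>2 = R\<^sup>2"
    "x t $ 1 * vel x t $ 1 + x t $ 2 * vel x t $ 2 + x t $ 3 * vel x t $ 3 = 0"
    using d1 sph orth assms(2) by auto
qed

section \<open>Conservation laws\<close>

lemma open_interval_DERIV_zero_constant:
  fixes f :: "real \<Rightarrow> real"
  assumes "open_interval I" "\<And>t. t \<in> I \<Longrightarrow> (f has_real_derivative 0) (at t)" "s \<in> I" "t \<in> I"
  shows "f s = f t"
proof -
  have "convex I"
    using assms(1) by (simp add: open_interval_def is_interval_convex)
  then obtain c where "\<forall>x\<in>I. f x = c"
    using has_field_derivative_zero_constant[of I f] assms(2)
    by (metis has_field_derivative_at_within)
  then show ?thesis
    using assms by simp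
qed

text \<open>With \<open>L\<close> the left-hand side of the equation of motion, the triple product
  \<open>v \<bullet> (x \<times> L)\<close> equals
  \<open>- R\<^sup>2 (v \<bullet> w + \<Omega> v\<^sub>3)\<close> up to multiples of
  \<open>x \<bullet> v\<close>. Here \<open>L = 0\<close> and \<open>x \<bullet> v = 0\<close>. The
  polynomial identity in the proof is this computation in coordinates.\<close>

lemma vel_dot_acc_algebra:
  fixes x1 x2 x3 v1 v2 v3 w1 w2 w3 :: real
  assumes "x2 * w3 - x3 * w2 + \<Omega> * x2 + a * v1 = 0"
    and "x3 * w1 - x1 * w3 - \<Omega> * x1 + a * v2 = 0"
    and "x1 * w2 - x2 * w1 + a * v3 = 0"
    and "x1\<^sup>2 + x2\<^sup>2 + x3\<^sup>2 = R\<^sup>2" and "R > 0"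
    and "x1 * v1 + x2 * v2 + x3 * v3 = 0"
  shows "v1 * w1 + v2 * w2 + v3 * w3 = - \<Omega> * v3"
proof -
  have "(x1\<^sup>2 + x2\<^sup>2 + x3\<^sup>2) * (v1 * w1 + v2 * w2 + v3 * w3 + \<Omega> * v3)
    = - (v1 * (x2 * (x1 * w2 - x2 * w1 + a * v3) - x3 * (x3 * w1 - x1 * w3 - \<Omega> * x1 + a * v2))
       + v2 * (x3 * (x2 * w3 - x3 * w2 + \<Omega> * x2 + a * v1) - x1 * (x1 * w2 - x2 * w1 + a * v3))
       + v3 * (x1 * (x3 * w1 - x1 * w3 - \<Omega> * x1 + a * v2)
             - x2 * (x2 * w3 - x3 * w2 + \<Omega> * x2 + a * v1)))
      + (x1 * v1 + x2 * v2 + x3 * v3) * (x1 * w1 + x2 * w2 + x3 * w3 + \<Omega> * x3)"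
    by (simp add: algebra_simps power2_eq_square)
  then have "R\<^sup>2 * (v1 * w1 + v2 * w2 + v3 * w3 + \<Omega> * v3) = 0"
    unfolding assms by simp
  then show ?thesis
    using assms(5) by simp
qed

text \<open>With the angular momentum \<open>J = x\<^sub>1 v\<^sub>2 - x\<^sub>2 v\<^sub>1\<close>,
  the third component of the equation reads \<open>J' = - a v\<^sub>3\<close>, which gives
  \<open>C' = 0\<close>. Then \<open>E' = a (v \<bullet> w) - \<Omega> J'\<close>, and both terms
  equal \<open>a \<Omega> v\<^sub>3\<close> up to opposite signs.\<close>

lemma conserved_exists:
  assumes "is_solution a \<Omega> R I x" "R > 0"
  obtains C E where "conserved a \<Omega> I x C E"
proof -
  have I: "open_interval I"
    using assms by (simp add: is_solution_def)
  let ?C = "\<lambda>t. x t $ 1 * vel x t $ 2 - x t $ 2 * vel x t $ 1 + a * x t $ 3"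
  let ?E = "\<lambda>t. a / 2 * ((vel x t $ 1)\<^sup>2 + (vel x t $ 2)\<^sup>2 + (vel x t $ 3)\<^sup>2)
    + \<Omega> * (x t $ 2 * vel x t $ 1 - x t $ 1 * vel x t $ 2)"
  note c = is_solution_components[OF assms(1)]
  have dC: "(?C has_real_derivative 0) (at t)" if "t \<in> I" for t
    by (rule derivative_eq_intros c that refl)+ (use c(5)[OF that] in \<open>simp add: algebra_simps\<close>)
  have dE: "(?E has_real_derivative 0) (at t)" if t: "t \<in> I" for t
  proof -
    have va: "vel x t $ 1 * acc x t $ 1 + vel x t $ 2 * acc x t $ 2 + vel x t $ 3 * acc x t $ 3
        = - \<Omega> * vel x t $ 3"
      by (rule vel_dot_acc_algebra[OF c(3)[OF t] c(4)[OF t] c(5)[OF t] c(6)[OF t] assms(2) c(7)[OF t]])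
    have "(?E has_real_derivative
        a * (vel x t $ 1 * acc x t $ 1 + vel x t $ 2 * acc x t $ 2 + vel x t $ 3 * acc x t $ 3)
        - \<Omega> * (x t $ 1 * acc x t $ 2 - x t $ 2 * acc x t $ 1)) (at t)"
      by (rule derivative_eq_intros c t refl)+ (simp add: algebra_simps)
    moreover have "x t $ 1 * acc x t $ 2 - x t $ 2 * acc x t $ 1 = - a * vel x t $ 3"
      using c(5)[OF t] by simp
    ultimately show ?thesis
      by (simp add: va)
  qed
  obtain s where s: "s \<in> I"
    using I by (auto simp: open_interval_def)
  have "?C s = ?C t" "?E s = ?E t" if "t \<in> I" for t
    using open_interval_DERIV_zero_constant[OF I dC that s]
      open_interval_DERIV_zero_constant[OF I dE that s] by auto
  then have "conserved a \<Omega> I x (?C s) (?E s)"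
    unfolding conserved_def norm_vec3 by blast
  then show thesis
    by (rule that)
qed

section \<open>Uniqueness\<close>

text \<open>To the right of \<open>t\<^sub>0\<close> the function \<open>h s * exp (- L * s)\<close>
  cannot grow, and to the left \<open>h s * exp (L * s)\<close> cannot drop as \<open>s\<close>
  moves towards \<open>t\<^sub>0\<close>. Both vanish at \<open>t\<^sub>0\<close>, which bounds
  \<open>h t\<close> above by zero in either direction.\<close>

lemma gronwall_zero:
  fixes h h' :: "real \<Rightarrow> real"
  assumes I: "open_interval I" and "t\<^sub>0 \<in> I" and "t \<in> I"
    and d: "\<And>s. s \<in> I \<Longrightarrow> (h has_real_derivative h' s) (at s)"
    and le: "\<And>s. s \<in> I \<Longrightarrow> \<bar>h' s\<bar> \<le> L * h s"
    and "h t\<^sub>0 = 0" and "h t \<ge> 0"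
  shows "h t = 0"
proof -
  have sub: "s \<in> I" if "p \<in> I" "q \<in> I" "p \<le> s" "s \<le> q" for s p q
    using I that unfolding open_interval_def is_interval_1 by blast
  have "h t \<le> 0"
  proof (cases "t\<^sub>0 \<le> t")
    case True
    have "h t * exp (- L * t) \<le> h t\<^sub>0 * exp (- L * t\<^sub>0)"
    proof (rule DERIV_nonpos_imp_nonincreasing[OF True])
      fix s assume "t\<^sub>0 \<le> s" "s \<le> t"
      then have s: "s \<in> I"
        using assms sub by blast
      have "((\<lambda>s. h s * exp (- L * s)) has_real_derivative (h' s - L * h s) * exp (- L * s)) (at s)"
        by (rule derivative_eq_intros d s refl)+ (simp add: algebra_simps)
      moreover have "(h' s - L * h s) * exp (- L * s) \<le> 0"
        using le[OF s] by (simp add: mult_nonpos_nonneg)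
      ultimately show "\<exists>y. ((\<lambda>s. h s * exp (- L * s)) has_real_derivative y) (at s) \<and> y \<le> 0"
        by blast
    qed
    then show ?thesis
      using assms by (simp add: mult_le_0_iff)
  next
    case False
    have "h t * exp (L * t) \<le> h t\<^sub>0 * exp (L * t\<^sub>0)"
    proof (rule DERIV_nonneg_imp_nondecreasing[where f = "\<lambda>s. h s * exp (L * s)"])
      fix s assume "t \<le> s" "s \<le> t\<^sub>0"
      then have s: "s \<in> I"
        using assms sub by blast
      have "((\<lambda>s. h s * exp (L * s)) has_real_derivative (h' s + L * h s) * exp (L * s)) (at s)"
        by (rule derivative_eq_intros d s refl)+ (simp add: algebra_simps)
      moreover have "(h' s + L * h s) * exp (L * s) \<ge> 0"
        using le[OF s] by simp
      ultimately show "\<exists>y. ((\<lambda>s. h s * exp (L * s)) has_real_derivative y) (at s) \<and> 0 \<le> y"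
        by blast
    qed (use False in simp)
    then show ?thesis
      using assms by (simp add: mult_le_0_iff)
  qed
  then show ?thesis
    using assms by simp
qed

lemma norm_cross_le: "norm (x \<times> y) \<le> norm x * norm y" for x y :: "real^3"
proof -
  have "(norm (x \<times> y))\<^sup>2 \<le> (norm x * norm y)\<^sup>2"
    using norm_cross_dot[of x y] by (smt (verit) zero_le_power2)
  then show ?thesis
    by (rule power2_le_imp_le) simp
qed

text \<open>The equation fixes only the part of the acceleration orthogonal to \<open>x\<close>.
  Taking the cross product with \<open>x\<close> recovers that part, and the radial part is minus
  the squared speed; together they solve for \<open>acc\<close>.\<close>

lemma solution_acc_eq:
  assumes "is_solution a \<Omega> R I x" "t \<in> I"
  shows "R\<^sup>2 *\<^sub>R acc x t = - ((norm (vel x t))\<^sup>2 *\<^sub>R x t)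
    - \<Omega> *\<^sub>R (x t \<times> (unit3 \<times> x t)) + a *\<^sub>R (x t \<times> vel x t)"
proof -
  have "x t \<times> acc x t - \<Omega> *\<^sub>R (unit3 \<times> x t) + a *\<^sub>R vel x t = 0"
    using assms by (auto simp: is_solution_def)
  then have e: "x t \<times> acc x t = \<Omega> *\<^sub>R (unit3 \<times> x t) - a *\<^sub>R vel x t"
    by (simp add: algebra_simps)
  have "x t \<bullet> acc x t = - (norm (vel x t))\<^sup>2"
    using is_solution_components(8)[OF assms] by (simp add: inner_vec_def sum_3)
  moreover have "x t \<bullet> x t = R\<^sup>2"
    using assms by (auto simp: is_solution_def power2_norm_eq_inner[symmetric])
  ultimately have "x t \<times> (x t \<times> acc x t) = - ((norm (vel x t))\<^sup>2 *\<^sub>R x t) - R\<^sup>2 *\<^sub>R acc x t"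
    by (simp add: Lagrange)
  then have "R\<^sup>2 *\<^sub>R acc x t = - ((norm (vel x t))\<^sup>2 *\<^sub>R x t) - x t \<times> (x t \<times> acc x t)"
    by simp
  also have "x t \<times> (x t \<times> acc x t) = \<Omega> *\<^sub>R (x t \<times> (unit3 \<times> x t)) - a *\<^sub>R (x t \<times> vel x t)"
    unfolding e by (simp add: Cross3.right_diff_distrib cross_mult_right)
  finally show ?thesis
    by simp
qed

text \<open>In \<open>E + \<Omega> * C\<close> the angular momentum cancels, leaving kinetic energy
  and height.\<close>

lemma conserved_speed:
  assumes "conserved a \<Omega> I x C E" "a > 0" "t \<in> I"
  shows "(norm (vel x t))\<^sup>2 = 2 * (E + \<Omega> * C) / a - 2 * \<Omega> * x t $ 3"
proof -
  have C: "C = x t $ 1 * vel x t $ 2 - x t $ 2 * vel x t $ 1 + a * x t $ 3"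
    and E: "E = a / 2 * (norm (vel x t))\<^sup>2 + \<Omega> * (x t $ 2 * vel x t $ 1 - x t $ 1 * vel x t $ 2)"
    using assms by (auto simp: conserved_def)
  have "a * (norm (vel x t))\<^sup>2 = 2 * (E + \<Omega> * C) - 2 * \<Omega> * x t $ 3 * a"
    unfolding C E by (simp add: algebra_simps)
  then show ?thesis
    using assms(2) by (simp add: field_simps)
qed

lemma solution_vel_bounded:
  assumes "is_solution a \<Omega> R I x" "a > 0" "R > 0"
  obtains M where "\<And>t. t \<in> I \<Longrightarrow> norm (vel x t) \<le> M"
proof -
  obtain C E where ce: "conserved a \<Omega> I x C E"
    using conserved_exists assms by blast
  have "norm (vel x t) \<le> sqrt (2 * (E + \<Omega> * C) / a + 2 * \<bar>\<Omega>\<bar> * R)" if "t \<in> I" for t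
  proof (rule real_le_rsqrt)
    have "\<bar>x t $ 3\<bar> \<le> R"
      using component_le_norm_cart[of "x t" 3] assms(1) that by (simp add: is_solution_def)
    then have "\<bar>\<Omega> * x t $ 3\<bar> \<le> \<bar>\<Omega>\<bar> * R"
      unfolding abs_mult by (intro mult_left_mono) auto
    then show "(norm (vel x t))\<^sup>2 \<le> 2 * (E + \<Omega> * C) / a + 2 * \<bar>\<Omega>\<bar> * R"
      using conserved_speed[OF ce assms(2) that] by linarith
  qed
  then show thesis
    by (rule that)
qed

lemma norm_unit3: "norm unit3 = 1"
  using norm_eq_iff_vec3[of 1 unit3] by (simp add: unit3_def)

text \<open>Each product in \<open>solution_acc_eq\<close> is telescoped so that every term contains
  the position difference or the velocity difference once. The term quadratic in the velocity is not
  globally Lipschitz, hence the bound \<open>M\<close> on both speeds.\<close>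

lemma solution_acc_lipschitz:
  assumes x: "is_solution a \<Omega> R I x" and y: "is_solution a \<Omega> R I y" and t: "t \<in> I" and R: "R > 0"
    and M: "norm (vel x t) \<le> M" "norm (vel y t) \<le> M"
  shows "R\<^sup>2 * norm (acc x t - acc y t) \<le> (M\<^sup>2 + 2 * \<bar>\<Omega>\<bar> * R + \<bar>a\<bar> * M) * norm (x t - y t)
    + (2 * M * R + \<bar>a\<bar> * R) * norm (vel x t - vel y t)"
proof -
  define D where "D = x t - y t"
  define V where "V = vel x t - vel y t"
  let ?v = "vel x t" and ?w = "vel y t"
  have nx: "norm (x t) = R" and ny: "norm (y t) = R"
    using x y t by (auto simp: is_solution_def)
  have sq: "(norm ?v)\<^sup>2 *\<^sub>R x t - (norm ?w)\<^sup>2 *\<^sub>R y t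
      = (norm ?v)\<^sup>2 *\<^sub>R D + ((norm ?v - norm ?w) * (norm ?v + norm ?w)) *\<^sub>R y t"
    unfolding D_def by (simp add: algebra_simps power2_eq_square)
  have c1: "x t \<times> (unit3 \<times> x t) - y t \<times> (unit3 \<times> y t) = D \<times> (unit3 \<times> x t) + y t \<times> (unit3 \<times> D)"
    unfolding D_def by (simp add: Cross3.left_diff_distrib Cross3.right_diff_distrib)
  have c2: "x t \<times> ?v - y t \<times> ?w = D \<times> ?v + y t \<times> V"
    unfolding D_def V_def by (simp add: Cross3.left_diff_distrib Cross3.right_diff_distrib)
  have n1: "norm ((norm ?v)\<^sup>2 *\<^sub>R x t - (norm ?w)\<^sup>2 *\<^sub>R y t) \<le> M\<^sup>2 * norm D + 2 * M * R * norm V"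
  proof -
    have "norm ((norm ?v)\<^sup>2 *\<^sub>R D) \<le> M\<^sup>2 * norm D"
      using M by (simp add: mult_right_mono power_mono)
    moreover have "norm (((norm ?v - norm ?w) * (norm ?v + norm ?w)) *\<^sub>R y t) \<le> 2 * M * R * norm V"
    proof -
      have "\<bar>norm ?v - norm ?w\<bar> * \<bar>norm ?v + norm ?w\<bar> \<le> norm V * (2 * M)"
        using M unfolding V_def by (intro mult_mono norm_triangle_ineq3) auto
      then have "\<bar>norm ?v - norm ?w\<bar> * \<bar>norm ?v + norm ?w\<bar> * R \<le> norm V * (2 * M) * R"
        using R by (intro mult_right_mono) auto
      then show ?thesis
        unfolding norm_scaleR abs_mult ny by (simp only: ac_simps)
    qed
    ultimately show ?thesis
      unfolding sq by (meson add_mono norm_triangle_le)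
  qed
  have n2: "norm (x t \<times> (unit3 \<times> x t) - y t \<times> (unit3 \<times> y t)) \<le> 2 * R * norm D"
  proof -
    have "norm (D \<times> (unit3 \<times> x t)) \<le> norm D * (norm unit3 * norm (x t))"
      using norm_cross_le by (meson mult_left_mono norm_ge_zero order_trans)
    moreover have "norm (y t \<times> (unit3 \<times> D)) \<le> norm (y t) * (norm unit3 * norm D)"
      using norm_cross_le by (meson mult_left_mono norm_ge_zero order_trans)
    ultimately show ?thesis
      unfolding c1 nx ny norm_unit3
      by (intro norm_triangle_le) (simp add: algebra_simps)
  qed
  have n3: "norm (x t \<times> ?v - y t \<times> ?w) \<le> M * norm D + R * norm V"
  proof -
    have "norm (D \<times> ?v) \<le> norm D * M"
      using norm_cross_le M(1) by (meson mult_left_mono norm_ge_zero order_trans)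
    moreover have "norm (y t \<times> V) \<le> R * norm V"
      using norm_cross_le[of "y t" V] ny by simp
    ultimately show ?thesis
      unfolding c2 by (intro norm_triangle_le) (simp add: algebra_simps)
  qed
  have tri: "norm (p + q + r) \<le> norm p + norm q + norm r" for p q r :: "real^3"
    by (meson add_mono norm_triangle_ineq norm_triangle_le order_refl)
  have "R\<^sup>2 *\<^sub>R (acc x t - acc y t) = - ((norm ?v)\<^sup>2 *\<^sub>R x t - (norm ?w)\<^sup>2 *\<^sub>R y t)
      + (- \<Omega> *\<^sub>R (x t \<times> (unit3 \<times> x t) - y t \<times> (unit3 \<times> y t)))
      + a *\<^sub>R (x t \<times> ?v - y t \<times> ?w)"
    unfolding scaleR_diff_right solution_acc_eq[OF x t] solution_acc_eq[OF y t]
    by (simp add: algebra_simps)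
  then have "norm (R\<^sup>2 *\<^sub>R (acc x t - acc y t)) \<le> norm (- ((norm ?v)\<^sup>2 *\<^sub>R x t - (norm ?w)\<^sup>2 *\<^sub>R y t))
      + norm (- \<Omega> *\<^sub>R (x t \<times> (unit3 \<times> x t) - y t \<times> (unit3 \<times> y t)))
      + norm (a *\<^sub>R (x t \<times> ?v - y t \<times> ?w))"
    by (simp only: tri)
  also have "\<dots> \<le> (M\<^sup>2 * norm D + 2 * M * R * norm V) + \<bar>\<Omega>\<bar> * (2 * R * norm D)
      + \<bar>a\<bar> * (M * norm D + R * norm V)"
    unfolding norm_minus_cancel norm_scaleR abs_minus_cancel
    by (intro add_mono mult_left_mono n1 n2 n3) auto
  finally have "R\<^sup>2 * norm (acc x t - acc y t) \<le> (M\<^sup>2 * norm D + 2 * M * R * norm V)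
      + \<bar>\<Omega>\<bar> * (2 * R * norm D) + \<bar>a\<bar> * (M * norm D + R * norm V)"
    by simp
  then show ?thesis
    by (simp add: D_def V_def algebra_simps)
qed

theorem solution_unique:
  assumes x: "is_solution a \<Omega> R I x" and y: "is_solution a \<Omega> R I y" and a: "a > 0" and R: "R > 0"
    and t0: "t\<^sub>0 \<in> I" "x t\<^sub>0 = y t\<^sub>0" "vel x t\<^sub>0 = vel y t\<^sub>0" and t: "t \<in> I"
  shows "x t = y t"
proof -
  obtain M1 M2 where M12: "\<And>t. t \<in> I \<Longrightarrow> norm (vel x t) \<le> M1" "\<And>t. t \<in> I \<Longrightarrow> norm (vel y t) \<le> M2"
    using solution_vel_bounded x y a R by metis
  define M where "M = max M1 M2"
  have M: "norm (vel x t) \<le> M" "norm (vel y t) \<le> M" if "t \<in> I" for t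
    using M12[OF that] by (auto simp: M_def)
  have M0: "M \<ge> 0"
    using M(1)[OF t] norm_ge_zero order_trans by blast
  define P where "P = (M\<^sup>2 + 2 * \<bar>\<Omega>\<bar> * R + \<bar>a\<bar> * M) / R\<^sup>2"
  define Q where "Q = (2 * M * R + \<bar>a\<bar> * R) / R\<^sup>2"
  have PQ: "P \<ge> 0" "Q \<ge> 0"
    using M0 R by (auto simp: P_def Q_def)
  let ?D = "\<lambda>t. x t - y t" and ?V = "\<lambda>t. vel x t - vel y t" and ?W = "\<lambda>t. acc x t - acc y t"
  let ?h = "\<lambda>t. ?D t \<bullet> ?D t + ?V t \<bullet> ?V t"
  have C2: "C2_on x I" "C2_on y I" and I: "open_interval I"
    using x y by (auto simp: is_solution_def)
  have dD: "(?D has_vector_derivative ?V s) (at s)" and dV: "(?V has_vector_derivative ?W s) (at s)"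
    if "s \<in> I" for s
    using C2_on_D[OF C2(1) that] C2_on_D[OF C2(2) that] by (auto intro: has_vector_derivative_diff)
  have inner: "((\<lambda>t. f t \<bullet> f t) has_real_derivative 2 * (f s \<bullet> f')) (at s)"
    if "(f has_vector_derivative f') (at s)" for f :: "real \<Rightarrow> real^3" and f' s
    using bounded_bilinear.has_vector_derivative[OF bounded_bilinear_inner that that]
    by (simp add: has_real_derivative_iff_has_vector_derivative inner_commute)
  have "?h t = 0"
  \<comment> \<open>With \<open>d\<close> and \<open>v\<close> the norms of the two differences, the
    derivative of \<open>?h\<close> is at most \<open>2 d v + 2 v (P d + Q v)\<close>. Collecting
    this as \<open>(1 + P) * 2 d v + 2 Q v\<^sup>2\<close> and using
    \<open>2 d v \<le> d\<^sup>2 + v\<^sup>2\<close> yields the constant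
    \<open>1 + P + 2 * Q\<close>.\<close>
  proof (rule gronwall_zero[OF I t0(1) t, where h = ?h and L = "1 + P + 2 * Q"])
    fix s assume s: "s \<in> I"
    show "(?h has_real_derivative 2 * (?D s \<bullet> ?V s) + 2 * (?V s \<bullet> ?W s)) (at s)"
      by (intro DERIV_add inner dD dV s)
    let ?d = "norm (?D s)" and ?v = "norm (?V s)"
    have W: "norm (?W s) \<le> P * ?d + Q * ?v"
    proof -
      have "R\<^sup>2 * P = M\<^sup>2 + 2 * \<bar>\<Omega>\<bar> * R + \<bar>a\<bar> * M" "R\<^sup>2 * Q = 2 * M * R + \<bar>a\<bar> * R"
        using R by (simp_all add: P_def Q_def)
      then have "R\<^sup>2 * norm (?W s) \<le> (R\<^sup>2 * P) * ?d + (R\<^sup>2 * Q) * ?v"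
        using solution_acc_lipschitz[OF x y s R M[OF s]] by simp
      then have "R\<^sup>2 * norm (?W s) \<le> R\<^sup>2 * (P * ?d + Q * ?v)"
        by (simp only: distrib_left mult.assoc)
      then show ?thesis
        using R by simp
    qed
    have am: "2 * (?d * ?v) \<le> ?d\<^sup>2 + ?v\<^sup>2"
      using sum_squares_bound[of ?d ?v] by simp
    have "\<bar>?D s \<bullet> ?V s\<bar> \<le> ?d * ?v"
      by (rule Cauchy_Schwarz_ineq2)
    moreover have "\<bar>?V s \<bullet> ?W s\<bar> \<le> ?v * (P * ?d + Q * ?v)"
      by (rule order_trans[OF Cauchy_Schwarz_ineq2 mult_left_mono[OF W]]) simp
    ultimately have "\<bar>2 * (?D s \<bullet> ?V s) + 2 * (?V s \<bullet> ?W s)\<bar>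
        \<le> (1 + P) * (2 * (?d * ?v)) + 2 * Q * ?v\<^sup>2"
      by (simp add: abs_le_iff algebra_simps power2_eq_square)
    also have "\<dots> \<le> (1 + P) * (?d\<^sup>2 + ?v\<^sup>2) + 2 * Q * (?d\<^sup>2 + ?v\<^sup>2)"
      using PQ am by (intro add_mono mult_left_mono) auto
    also have "\<dots> = (1 + P + 2 * Q) * ?h s"
      by (simp add: power2_norm_eq_inner algebra_simps)
    finally show "\<bar>2 * (?D s \<bullet> ?V s) + 2 * (?V s \<bullet> ?W s)\<bar> \<le> (1 + P + 2 * Q) * ?h s" .
  qed (use t0 in auto)
  then have "?D t \<bullet> ?D t = 0"
    by (smt (verit) inner_ge_zero)
  then show ?thesis
    by simp
qed

text \<open>The horizontal velocity is the unknown of a linear 2 x 2 system: orthogonality to the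
  position gives its radial part, the common value of \<open>C\<close> its angular part. The
  determinant is the squared distance from the axis, which is positive off the poles.\<close>

lemma solution_unique_latitude:
  assumes x: "is_solution a \<Omega> R I x" and y: "is_solution a \<Omega> R I y" and a: "a > 0" and R: "R > 0"
    and t0: "t\<^sub>0 \<in> I" "x t\<^sub>0 = y t\<^sub>0" "\<bar>x t\<^sub>0 $ 3\<bar> < R" "vel x t\<^sub>0 $ 3 = vel y t\<^sub>0 $ 3"
    and C: "conserved a \<Omega> I x C E" "conserved a \<Omega> I y C E'" and t: "t \<in> I"
  shows "x t = y t"
proof (rule solution_unique[OF x y a R t0(1,2) _ t])
  let ?x = "x t\<^sub>0" and ?v = "vel x t\<^sub>0 $ 1 - vel y t\<^sub>0 $ 1" and ?w = "vel x t\<^sub>0 $ 2 - vel y t\<^sub>0 $ 2"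
  have "(?x $ 3)\<^sup>2 < R\<^sup>2"
    using t0(3) R by (metis abs_of_pos power2_abs power2_strict_mono)
  then have pos: "(?x $ 1)\<^sup>2 + (?x $ 2)\<^sup>2 > 0"
    using is_solution_components(6)[OF x t0(1)] by linarith
  have o: "?x $ 1 * ?v + ?x $ 2 * ?w = 0"
    using is_solution_components(7)[OF x t0(1)] is_solution_components(7)[OF y t0(1)] t0
    by (simp add: algebra_simps)
  have j: "?x $ 1 * ?w - ?x $ 2 * ?v = 0"
  proof -
    have "C = ?x $ 1 * vel x t\<^sub>0 $ 2 - ?x $ 2 * vel x t\<^sub>0 $ 1 + a * ?x $ 3"
      "C = ?x $ 1 * vel y t\<^sub>0 $ 2 - ?x $ 2 * vel y t\<^sub>0 $ 1 + a * ?x $ 3"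
      using C t0(1,2) by (simp_all add: conserved_def)
    then show ?thesis
      by (simp add: algebra_simps)
  qed
  have "((?x $ 1)\<^sup>2 + (?x $ 2)\<^sup>2) * ?v = ?x $ 1 * (?x $ 1 * ?v + ?x $ 2 * ?w) - ?x $ 2 * (?x $ 1 * ?w - ?x $ 2 * ?v)"
    "((?x $ 1)\<^sup>2 + (?x $ 2)\<^sup>2) * ?w = ?x $ 2 * (?x $ 1 * ?v + ?x $ 2 * ?w) + ?x $ 1 * (?x $ 1 * ?w - ?x $ 2 * ?v)"
    by (simp_all add: algebra_simps power2_eq_square)
  then have "?v = 0" "?w = 0"
    unfolding o j using pos by auto
  then show "vel x t\<^sub>0 = vel y t\<^sub>0"
    using t0(4) by (simp add: vec_eq_iff forall_3)
qed

section \<open>Rotating curves\<close>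

text \<open>The radius is an independent signed function. \<open>sphere_curve\<close> uses a
  nonnegative square root, which has a corner where a curve passes through a pole; here the radius
  may change sign there instead.\<close>

definition rot_curve :: "(real \<Rightarrow> real) \<Rightarrow> (real \<Rightarrow> real) \<Rightarrow> (real \<Rightarrow> real) \<Rightarrow> real \<Rightarrow> real^3" where
  "rot_curve r \<phi> u t = vector [r t * cos (\<phi> t), r t * sin (\<phi> t), u t]"

lemma rot_curve_nth [simp]:
  "rot_curve r \<phi> u t $ 1 = r t * cos (\<phi> t)" "rot_curve r \<phi> u t $ 2 = r t * sin (\<phi> t)"
  "rot_curve r \<phi> u t $ 3 = u t"
  by (simp_all add: rot_curve_def)

lemma sphere_curve_eq_rot_curve:
  "sphere_curve R z \<phi> = rot_curve (\<lambda>t. R * sqrt (1 - (z t)\<^sup>2)) \<phi> (\<lambda>t. R * z t)"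
  by (simp add: fun_eq_iff sphere_curve_def rot_curve_def)

text \<open>The hypotheses are the equation of motion in the frame rotating with the azimuth:
  \<open>B\<close> is its radial component, \<open>A\<close> its azimuthal component up to sign, and
  \<open>C\<close> its vertical component.\<close>

lemma rot_curve_solution:
  assumes r: "\<And>t. (r has_real_derivative r1 t) (at t)" "\<And>t. (r1 has_real_derivative r2 t) (at t)"
    and \<phi>: "\<And>t. (\<phi> has_real_derivative \<beta> t) (at t)" "\<And>t. (\<beta> has_real_derivative b t) (at t)"
    and u: "\<And>t. (u has_real_derivative p t) (at t)" "\<And>t. (p has_real_derivative q t) (at t)"
    and cont: "continuous_on UNIV r2" "continuous_on UNIV b" "continuous_on UNIV q"
    and sph: "\<And>t. (r t)\<^sup>2 + (u t)\<^sup>2 = R\<^sup>2" and R: "R > 0"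
    and A: "\<And>t. r t * q t - u t * (r2 t - r t * (\<beta> t)\<^sup>2) + \<Omega> * r t - a * r t * \<beta> t = 0"
    and B: "\<And>t. a * r1 t - u t * (r t * b t + 2 * r1 t * \<beta> t) = 0"
    and C: "\<And>t. r t * (r t * b t + 2 * r1 t * \<beta> t) + a * p t = 0"
  shows "is_solution a \<Omega> R UNIV (rot_curve r \<phi> u)"
    and "vel (rot_curve r \<phi> u) t = vector [r1 t * cos (\<phi> t) - r t * \<beta> t * sin (\<phi> t),
           r1 t * sin (\<phi> t) + r t * \<beta> t * cos (\<phi> t), p t]"
proof -
  let ?x = "rot_curve r \<phi> u"
  define v :: "real \<Rightarrow> real^3" where
    "v = (\<lambda>t. vector [r1 t * cos (\<phi> t) - r t * \<beta> t * sin (\<phi> t),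
           r1 t * sin (\<phi> t) + r t * \<beta> t * cos (\<phi> t), p t])"
  \<comment> \<open>\<open>g\<close> and \<open>h\<close> are the radial and azimuthal accelerations
    in cylindrical coordinates.\<close>
  define g where "g = (\<lambda>t. r2 t - r t * (\<beta> t)\<^sup>2)"
  define h where "h = (\<lambda>t. r t * b t + 2 * r1 t * \<beta> t)"
  define w :: "real \<Rightarrow> real^3" where
    "w = (\<lambda>t. vector [g t * cos (\<phi> t) - h t * sin (\<phi> t), g t * sin (\<phi> t) + h t * cos (\<phi> t), q t])"
  have dx: "(?x has_vector_derivative v t) (at t)" for t
    unfolding rot_curve_def[abs_def] v_def
    by (intro has_vector_derivative_vec3; (rule derivative_eq_intros r \<phi> u refl)+; simp add: algebra_simps)
  have dv: "(v has_vector_derivative w t) (at t)" for t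
    unfolding v_def w_def g_def h_def
    by (intro has_vector_derivative_vec3; (rule derivative_eq_intros r \<phi> u refl)+;
        simp add: algebra_simps power2_eq_square)
  have co: "continuous_on UNIV r" "continuous_on UNIV r1" "continuous_on UNIV \<phi>" "continuous_on UNIV \<beta>"
    by (meson r \<phi> DERIV_continuous continuous_at_imp_continuous_on)+
  have cw: "continuous_on UNIV w"
    unfolding w_def g_def h_def by (intro continuous_on_vec3 continuous_intros co cont)
  note * = C2_onI[of UNIV ?x v w, OF open_UNIV dx dv cw]
  show v: "vel ?x t = vector [r1 t * cos (\<phi> t) - r t * \<beta> t * sin (\<phi> t),
           r1 t * sin (\<phi> t) + r t * \<beta> t * cos (\<phi> t), p t]" for t
    using *(2)[of t] by (simp add: v_def)
  have "?x t \<times> w t - \<Omega> *\<^sub>R (unit3 \<times> ?x t) + a *\<^sub>R v t = 0" for t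
  proof -
    let ?c = "cos (\<phi> t)" and ?s = "sin (\<phi> t)"
    have A': "r t * q t - u t * g t + \<Omega> * r t - a * r t * \<beta> t = 0" and B': "a * r1 t - u t * h t = 0"
      and C': "r t * h t + a * p t = 0"
      using A[of t] B[of t] C[of t] by (simp_all add: g_def h_def)
    have "r t * ?s * q t - u t * (g t * ?s + h t * ?c) + \<Omega> * (r t * ?s) + a * (r1 t * ?c - r t * \<beta> t * ?s)
        = ?s * (r t * q t - u t * g t + \<Omega> * r t - a * r t * \<beta> t) + ?c * (a * r1 t - u t * h t)"
      by (simp add: algebra_simps)
    then have 1: "r t * ?s * q t - u t * (g t * ?s + h t * ?c) + \<Omega> * (r t * ?s)
        + a * (r1 t * ?c - r t * \<beta> t * ?s) = 0"
      unfolding A' B' by simp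
    have "u t * (g t * ?c - h t * ?s) - r t * ?c * q t - \<Omega> * (r t * ?c) + a * (r1 t * ?s + r t * \<beta> t * ?c)
        = - ?c * (r t * q t - u t * g t + \<Omega> * r t - a * r t * \<beta> t) + ?s * (a * r1 t - u t * h t)"
      by (simp add: algebra_simps)
    then have 2: "u t * (g t * ?c - h t * ?s) - r t * ?c * q t - \<Omega> * (r t * ?c)
        + a * (r1 t * ?s + r t * \<beta> t * ?c) = 0"
      unfolding A' B' by simp
    have "r t * ?c * (g t * ?s + h t * ?c) - r t * ?s * (g t * ?c - h t * ?s) + a * p t
        = r t * h t * (?s\<^sup>2 + ?c\<^sup>2) + a * p t"
      by (simp add: algebra_simps power2_eq_square del: sin_cos_squared_add sin_cos_squared_add2 sin_cos_squared_add3)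
    then have 3: "r t * ?c * (g t * ?s + h t * ?c) - r t * ?s * (g t * ?c - h t * ?s) + a * p t = 0"
      by (simp only: sin_cos_squared_add mult_1_right C')
    show ?thesis
      using 1 2 3 by (simp add: vec_eq_iff forall_3 cross3_def unit3_def v_def w_def)
  qed
  moreover have "norm (?x t) = R" for t
  proof -
    have "(r t * cos (\<phi> t))\<^sup>2 + (r t * sin (\<phi> t))\<^sup>2 + (u t)\<^sup>2
        = (r t)\<^sup>2 * ((sin (\<phi> t))\<^sup>2 + (cos (\<phi> t))\<^sup>2) + (u t)\<^sup>2"
      by (simp add: power_mult_distrib distrib_left del: sin_cos_squared_add sin_cos_squared_add2 sin_cos_squared_add3)
    then show ?thesis
      unfolding norm_eq_iff_vec3[OF R] using sph[of t] by simp
  qed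
  ultimately show "is_solution a \<Omega> R UNIV ?x"
    using * by (simp add: is_solution_def open_interval_def v_def)
qed

text \<open>A simple zero of \<open>r\<close> is isolated, so \<open>f\<close> vanishes on a
  punctured neighbourhood and then, by continuity, at the point.\<close>

lemma eq_zero_at_simple_zero:
  fixes r f :: "real \<Rightarrow> real"
  assumes "(r has_real_derivative d) (at t)" "d \<noteq> 0" "r t = 0" "isCont f t"
    and "\<And>s. r s \<noteq> 0 \<Longrightarrow> f s = 0"
  shows "f t = 0"
proof -
  have "((\<lambda>s. (r s - r t) / (s - t)) \<longlongrightarrow> d) (at t)"
    using assms(1) by (simp add: has_field_derivative_iff)
  then have "eventually (\<lambda>s. (r s - r t) / (s - t) \<noteq> 0) (at t)"
    using assms(2) by (rule tendsto_imp_eventually_ne)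
  then have "eventually (\<lambda>s. f s = 0) (at t)"
    by eventually_elim (use assms(3,5) in auto)
  then have "(f \<longlongrightarrow> 0) (at t)"
    by (rule tendsto_eventually)
  then show ?thesis
    using assms(4) LIM_unique unfolding isCont_def by blast
qed

text \<open>At a zero of \<open>r\<close> the curve runs through a pole. The equation of motion holds there by
  continuity, so that only its form off the poles has to be verified.\<close>

lemma profile_solution:
  assumes r: "\<And>t. (r has_real_derivative r1 t) (at t)" "\<And>t. (r1 has_real_derivative r2 t) (at t)"
    and \<phi>: "\<And>t. (\<phi> has_real_derivative \<beta> t) (at t)" "\<And>t. (\<beta> has_real_derivative b t) (at t)"
    and u: "\<And>t. (u has_real_derivative p t) (at t)" "\<And>t. (p has_real_derivative q t) (at t)"
    and cont: "continuous_on UNIV r2" "continuous_on UNIV b" "continuous_on UNIV q"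
    and sph: "\<And>t. (r t)\<^sup>2 + (u t)\<^sup>2 = R\<^sup>2" and R: "R > 0"
    and p: "\<And>t. R\<^sup>2 * (p t)\<^sup>2 = (r t)\<^sup>2 * (V - 2 * \<Omega> * u t) - (C - a * u t)\<^sup>2"
    and q: "\<And>t. R\<^sup>2 * q t = a * (C - a * u t) - u t * (V - 2 * \<Omega> * u t) - \<Omega> * (r t)\<^sup>2"
    and \<beta>: "\<And>t. (r t)\<^sup>2 * \<beta> t = C - a * u t"
    and simple: "\<And>t. r t = 0 \<Longrightarrow> r1 t \<noteq> 0"
  shows "is_solution a \<Omega> R UNIV (rot_curve r \<phi> u)"
    and "vel (rot_curve r \<phi> u) t $ 3 = p t"
    and "\<exists>E. conserved a \<Omega> UNIV (rot_curve r \<phi> u) C E"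
proof -
  have d1: "r t * r1 t = - (u t * p t)" for t
  proof -
    have "((\<lambda>t. (r t)\<^sup>2 + (u t)\<^sup>2) has_real_derivative 2 * (r t * r1 t + u t * p t)) (at t)"
      by (rule derivative_eq_intros r u refl)+ simp
    from DERIV_constant_on_open[OF this open_UNIV _ sph] show ?thesis
      by simp
  qed
  have d2: "(r1 t)\<^sup>2 + r t * r2 t = - ((p t)\<^sup>2 + u t * q t)" for t
  proof -
    have "((\<lambda>t. r t * r1 t + u t * p t) has_real_derivative
        (r1 t)\<^sup>2 + r t * r2 t + ((p t)\<^sup>2 + u t * q t)) (at t)"
      by (rule derivative_eq_intros r u refl)+ (simp add: power2_eq_square algebra_simps)
    from DERIV_constant_on_open[OF this open_UNIV, of 0] d1 show ?thesis
      by simp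
  qed
  have C: "r t * (r t * b t + 2 * r1 t * \<beta> t) + a * p t = 0" for t
  proof -
    have "((\<lambda>t. (r t)\<^sup>2 * \<beta> t + a * u t) has_real_derivative
        r t * (r t * b t + 2 * r1 t * \<beta> t) + a * p t) (at t)"
      by (rule derivative_eq_intros r u \<phi> refl)+ (simp add: power2_eq_square algebra_simps)
    from DERIV_constant_on_open[OF this open_UNIV, of C] \<beta> show ?thesis
      by simp
  qed
  have co: "isCont r t" "isCont r1 t" "isCont \<beta> t" "isCont u t" "isCont r2 t" "isCont b t" "isCont q t" for t
    using r \<phi> u DERIV_isCont cont by (blast | simp add: continuous_on_eq_continuous_at)+
  have A0: "r t * q t - u t * (r2 t - r t * (\<beta> t)\<^sup>2) + \<Omega> * r t - a * r t * \<beta> t = 0" if "r t \<noteq> 0" for t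
  proof -
    let ?r = "r t" and ?u = "u t" and ?J = "C - a * u t"
    \<comment> \<open>Multiplying by the cube of the radius removes all divisions: differentiating
      the sphere constraint gives \<open>r * r1\<close>, and differentiating again gives
      \<open>r1\<^sup>2 + r * r2\<close>.\<close>
    have r2: "?r ^ 3 * r2 t = - ?r\<^sup>2 * ((p t)\<^sup>2 + ?u * q t) - ?u\<^sup>2 * (p t)\<^sup>2"
    proof -
      have "?r ^ 3 * r2 t = ?r\<^sup>2 * ((r1 t)\<^sup>2 + ?r * r2 t) - (?r * r1 t)\<^sup>2"
        by (simp add: power2_eq_square power3_eq_cube algebra_simps)
      then show ?thesis
        unfolding d1 d2 by (simp add: power2_eq_square algebra_simps)
    qed
    \<comment> \<open>The same factor turns \<open>\<beta>\<close> into the angular momentum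
      \<open>C - a * u\<close>. What remains is polynomial, and the prescribed values of
      \<open>R\<^sup>2 p\<^sup>2\<close> and \<open>R\<^sup>2 q\<close> make it cancel.\<close>
    have "?r ^ 3 * (?r * q t - ?u * (r2 t - ?r * (\<beta> t)\<^sup>2) + \<Omega> * ?r - a * ?r * \<beta> t)
      = ?r ^ 4 * q t - ?u * (?r ^ 3 * r2 t) + ?u * (?r\<^sup>2 * \<beta> t)\<^sup>2 + \<Omega> * ?r ^ 4 - a * ?r\<^sup>2 * (?r\<^sup>2 * \<beta> t)"
      by (simp add: power2_eq_square power3_eq_cube power4_eq_xxxx algebra_simps)
    also have "\<dots> = (?r\<^sup>2 + ?u\<^sup>2) * (?r\<^sup>2 * q t + ?u * (p t)\<^sup>2) + ?u * ?J\<^sup>2 + \<Omega> * ?r ^ 4 - a * ?r\<^sup>2 * ?J"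
      unfolding \<beta> r2 by (simp add: power2_eq_square power4_eq_xxxx algebra_simps)
    also have "\<dots> = ?r\<^sup>2 * (R\<^sup>2 * q t) + ?u * (R\<^sup>2 * (p t)\<^sup>2) + ?u * ?J\<^sup>2 + \<Omega> * ?r ^ 4 - a * ?r\<^sup>2 * ?J"
      unfolding sph by (simp add: algebra_simps)
    also have "\<dots> = 0"
      unfolding p q by (simp add: power2_eq_square power4_eq_xxxx algebra_simps)
    finally show ?thesis
      using that by simp
  qed
  have B0: "a * r1 t - u t * (r t * b t + 2 * r1 t * \<beta> t) = 0" if "r t \<noteq> 0" for t
  proof -
    have "r t * (a * r1 t - u t * (r t * b t + 2 * r1 t * \<beta> t))
      = a * (r t * r1 t) - u t * (r t * (r t * b t + 2 * r1 t * \<beta> t) + a * p t) + a * (u t * p t)"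
      by (simp add: algebra_simps)
    then have "r t * (a * r1 t - u t * (r t * b t + 2 * r1 t * \<beta> t)) = 0"
      unfolding C d1 by simp
    then show ?thesis
      using that by simp
  qed
  have A: "r t * q t - u t * (r2 t - r t * (\<beta> t)\<^sup>2) + \<Omega> * r t - a * r t * \<beta> t = 0" for t
  proof (cases "r t = 0")
    case True
    show ?thesis
      by (rule eq_zero_at_simple_zero[OF r(1) simple[OF True] True _ A0])
        (intro continuous_intros co)
  qed (rule A0)
  have B: "a * r1 t - u t * (r t * b t + 2 * r1 t * \<beta> t) = 0" for t
  proof (cases "r t = 0")
    case True
    show ?thesis
      by (rule eq_zero_at_simple_zero[OF r(1) simple[OF True] True _ B0])
        (intro continuous_intros co)
  qed (rule B0)
  note * = rot_curve_solution[OF r \<phi> u cont sph R A B C]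
  show sol: "is_solution a \<Omega> R UNIV (rot_curve r \<phi> u)"
    by (rule *(1))
  show "vel (rot_curve r \<phi> u) t $ 3 = p t"
    using *(2) by simp
  \<comment> \<open>Conservation holds with some constants; evaluating the first one at time 0
    identifies it with the prescribed \<open>C\<close>.\<close>
  obtain C' E where CE: "conserved a \<Omega> UNIV (rot_curve r \<phi> u) C' E"
    using conserved_exists[OF sol R] .
  then have "C' = rot_curve r \<phi> u 0 $ 1 * vel (rot_curve r \<phi> u) 0 $ 2
      - rot_curve r \<phi> u 0 $ 2 * vel (rot_curve r \<phi> u) 0 $ 1 + a * rot_curve r \<phi> u 0 $ 3"
    unfolding conserved_def by blast
  then have "C' = r 0 * cos (\<phi> 0) * (r1 0 * sin (\<phi> 0) + r 0 * \<beta> 0 * cos (\<phi> 0))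
      - r 0 * sin (\<phi> 0) * (r1 0 * cos (\<phi> 0) - r 0 * \<beta> 0 * sin (\<phi> 0)) + a * u 0"
    by (simp add: *(2))
  also have "\<dots> = (r 0)\<^sup>2 * \<beta> 0 * ((sin (\<phi> 0))\<^sup>2 + (cos (\<phi> 0))\<^sup>2) + a * u 0"
    by (simp add: algebra_simps power2_eq_square del: sin_cos_squared_add sin_cos_squared_add2 sin_cos_squared_add3)
  also have "\<dots> = C"
    using \<beta>[of 0] by simp
  finally show "\<exists>E. conserved a \<Omega> UNIV (rot_curve r \<phi> u) C E"
    using CE by blast
qed

lemma conserved_subset: "conserved a \<Omega> J x C E \<Longrightarrow> I \<subseteq> J \<Longrightarrow> conserved a \<Omega> I x C E"
  by (auto simp: conserved_def)

text \<open>The equation is invariant under rotation about the third axis, so a whole family in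
  \<open>\<phi>\<^sub>0\<close> is available. Its parameter is spent on the azimuth at
  \<open>t\<^sub>0\<close>; height, vertical speed and \<open>C\<close> agree by hypothesis, which
  is what \<open>solution_unique_latitude\<close> asks for.\<close>

lemma rot_curve_match:
  assumes x: "nonpolar_solution a \<Omega> R I x" "conserved a \<Omega> I x C E" and a: "a > 0" and R: "R > 0"
    and sol: "\<And>\<phi>\<^sub>0. is_solution a \<Omega> R UNIV (rot_curve r (\<lambda>t. \<phi>\<^sub>0 + \<phi> t) u)"
    and vel: "\<And>\<phi>\<^sub>0. vel (rot_curve r (\<lambda>t. \<phi>\<^sub>0 + \<phi> t) u) t\<^sub>0 $ 3 = p"
    and con: "\<And>\<phi>\<^sub>0. \<exists>E. conserved a \<Omega> UNIV (rot_curve r (\<lambda>t. \<phi>\<^sub>0 + \<phi> t) u) C E"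
    and t0: "t\<^sub>0 \<in> I" "x t\<^sub>0 $ 3 = u t\<^sub>0" "vel x t\<^sub>0 $ 3 = p"
  shows "\<exists>\<phi>\<^sub>0. \<forall>t\<in>I. x t = rot_curve r (\<lambda>t. \<phi>\<^sub>0 + \<phi> t) u t"
proof -
  have xs: "is_solution a \<Omega> R I x" and np: "\<bar>x t\<^sub>0 $ 3\<bar> < R" and I: "open_interval I"
    using x t0 by (auto simp: nonpolar_solution_def is_solution_def)
  have r: "(r t\<^sub>0)\<^sup>2 + (u t\<^sub>0)\<^sup>2 = R\<^sup>2"
  proof -
    have "(r t\<^sub>0 * cos (0 + \<phi> t\<^sub>0))\<^sup>2 + (r t\<^sub>0 * sin (0 + \<phi> t\<^sub>0))\<^sup>2 + (u t\<^sub>0)\<^sup>2 = R\<^sup>2"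
      using is_solution_components(6)[OF sol[of 0], of t\<^sub>0] by simp
    moreover have "(r t\<^sub>0 * cos (0 + \<phi> t\<^sub>0))\<^sup>2 + (r t\<^sub>0 * sin (0 + \<phi> t\<^sub>0))\<^sup>2
        = (r t\<^sub>0)\<^sup>2 * ((sin (0 + \<phi> t\<^sub>0))\<^sup>2 + (cos (0 + \<phi> t\<^sub>0))\<^sup>2)"
      by (simp add: power_mult_distrib distrib_left del: sin_cos_squared_add sin_cos_squared_add2 sin_cos_squared_add3)
    ultimately show ?thesis
      by simp
  qed
  have "(x t\<^sub>0 $ 3)\<^sup>2 < R\<^sup>2"
    using np R by (metis abs_of_pos power2_abs power2_strict_mono)
  then have "r t\<^sub>0 \<noteq> 0"
    using r t0(2) by auto
  moreover have "(x t\<^sub>0 $ 1)\<^sup>2 + (x t\<^sub>0 $ 2)\<^sup>2 = (r t\<^sub>0)\<^sup>2"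
    using is_solution_components(6)[OF xs t0(1)] r t0(2) by simp
  ultimately have "(x t\<^sub>0 $ 1 / r t\<^sub>0)\<^sup>2 + (x t\<^sub>0 $ 2 / r t\<^sub>0)\<^sup>2 = 1"
    by (simp add: power_divide flip: add_divide_distrib)
  \<comment> \<open>Dividing by the signed radius gives the azimuth in the convention of
    \<open>rot_curve\<close>, also where \<open>r\<close> is negative.\<close>
  then obtain \<theta> where "x t\<^sub>0 $ 1 / r t\<^sub>0 = cos \<theta>" "x t\<^sub>0 $ 2 / r t\<^sub>0 = sin \<theta>"
    using sincos_total_2pi by metis
  then have \<theta>: "x t\<^sub>0 $ 1 = r t\<^sub>0 * cos \<theta>" "x t\<^sub>0 $ 2 = r t\<^sub>0 * sin \<theta>"
    using \<open>r t\<^sub>0 \<noteq> 0\<close> by (auto simp: field_simps)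
  let ?y = "rot_curve r (\<lambda>t. (\<theta> - \<phi> t\<^sub>0) + \<phi> t) u"
  have y: "is_solution a \<Omega> R I ?y"
    using is_solution_subset[OF sol I] by simp
  obtain E' where con': "conserved a \<Omega> I ?y C E'"
    using con conserved_subset by blast
  have y0: "x t\<^sub>0 = ?y t\<^sub>0"
    using \<theta> t0 by (simp add: vec_eq_iff forall_3)
  have "x t = ?y t" if "t \<in> I" for t
    by (rule solution_unique_latitude[OF xs y a R t0(1) y0 np _ x(2) con' that])
      (simp only: t0 vel)
  then show ?thesis
    by blast
qed

text \<open>Strictly between the poles the positive root of \<open>R\<^sup>2 - u\<^sup>2\<close> is
  a smooth radius without zeros, so the condition on simple zeros in \<open>profile_solution\<close>
  holds vacuously.\<close>

lemma sphere_profile_solution: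
  assumes u: "\<And>t. (u has_real_derivative p t) (at t)" "\<And>t. (p has_real_derivative q t) (at t)"
    and \<phi>: "\<And>t. (\<phi> has_real_derivative (C - a * u t) / (R\<^sup>2 - (u t)\<^sup>2)) (at t)"
    and cont: "continuous_on UNIV q"
    and R: "R > 0" and np: "\<And>t. \<bar>u t\<bar> < R"
    and p: "\<And>t. R\<^sup>2 * (p t)\<^sup>2 = (R\<^sup>2 - (u t)\<^sup>2) * (V - 2 * \<Omega> * u t) - (C - a * u t)\<^sup>2"
    and q: "\<And>t. R\<^sup>2 * q t = a * (C - a * u t) - u t * (V - 2 * \<Omega> * u t) - \<Omega> * (R\<^sup>2 - (u t)\<^sup>2)"
    and uz: "\<And>t. u t = R * z t"
  shows "is_solution a \<Omega> R UNIV (sphere_curve R z \<phi>)"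
    and "vel (sphere_curve R z \<phi>) t $ 3 = p t"
    and "\<exists>E. conserved a \<Omega> UNIV (sphere_curve R z \<phi>) C E"
proof -
  define r where "r = (\<lambda>t. sqrt (R\<^sup>2 - (u t)\<^sup>2))"
  have pos: "R\<^sup>2 - (u t)\<^sup>2 > 0" for t
    using np[of t] R by (metis abs_of_pos power2_abs power2_strict_mono diff_gt_0_iff_gt abs_ge_zero)
  have r0: "r t > 0" and r2: "(r t)\<^sup>2 = R\<^sup>2 - (u t)\<^sup>2" for t
    using pos[of t] by (simp_all add: r_def)
  have "sphere_curve R z \<phi> = rot_curve r \<phi> u"
  proof -
    have "R * sqrt (1 - (z t)\<^sup>2) = r t" for t
    proof -
      have "r t = sqrt (R\<^sup>2 * (1 - (z t)\<^sup>2))"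
        by (simp add: r_def uz power_mult_distrib right_diff_distrib)
      then show ?thesis
        using R by (simp add: real_sqrt_mult)
    qed
    then show ?thesis
      by (simp add: sphere_curve_eq_rot_curve uz flip: uz)
  qed
  have dr: "(r has_real_derivative - (u t * p t / r t)) (at t)" for t
  proof -
    have "((\<lambda>t. R\<^sup>2 - (u t)\<^sup>2) has_real_derivative - (2 * u t * p t)) (at t)"
      by (rule derivative_eq_intros u refl)+ simp
    from DERIV_chain2[OF DERIV_real_sqrt[OF pos] this] show ?thesis
      unfolding r_def by (rule DERIV_cong) (simp add: inverse_eq_divide)
  qed
  have rne: "r t \<noteq> 0" for t
    using r0[of t] by simp
  define r2' where "r2' = (\<lambda>t. - ((p t * p t + u t * q t) / r t + u t * p t * (u t * p t) / (r t)^3))"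
  have dr2: "((\<lambda>t. - (u t * p t / r t)) has_real_derivative r2' t) (at t)" for t
    unfolding r2'_def
    by (rule derivative_eq_intros u dr refl rne)+
      (use r0[of t] in \<open>simp add: field_simps power2_eq_square power3_eq_cube\<close>)
  define b where "b = (\<lambda>t. (- (a * p t) * (R\<^sup>2 - (u t)\<^sup>2) + (C - a * u t) * (2 * u t * p t))
      / ((R\<^sup>2 - (u t)\<^sup>2) * (R\<^sup>2 - (u t)\<^sup>2)))"
  have db: "((\<lambda>t. (C - a * u t) / (R\<^sup>2 - (u t)\<^sup>2)) has_real_derivative b t) (at t)" for t
    unfolding b_def
    by (rule derivative_eq_intros u refl)+ (use pos[of t] in simp_all)
  have co: "continuous_on UNIV u" "continuous_on UNIV p" "continuous_on UNIV r"
    by (meson u dr DERIV_continuous continuous_at_imp_continuous_on)+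
  have "is_solution a \<Omega> R UNIV (rot_curve r \<phi> u) \<and> vel (rot_curve r \<phi> u) t $ 3 = p t
    \<and> (\<exists>E. conserved a \<Omega> UNIV (rot_curve r \<phi> u) C E)"
  proof -
    have c1: "continuous_on UNIV r2'"
      unfolding r2'_def by (intro continuous_intros co cont) (simp_all add: rne)
    have c2: "continuous_on UNIV b"
      unfolding b_def by (intro continuous_intros co cont) (use pos less_numeral_extra(3) in \<open>force\<close>)
    have s: "(r t)\<^sup>2 + (u t)\<^sup>2 = R\<^sup>2" for t
      by (simp add: r2)
    have p': "R\<^sup>2 * (p t)\<^sup>2 = (r t)\<^sup>2 * (V - 2 * \<Omega> * u t) - (C - a * u t)\<^sup>2" for t
      by (simp only: r2 p)
    have q': "R\<^sup>2 * q t = a * (C - a * u t) - u t * (V - 2 * \<Omega> * u t) - \<Omega> * (r t)\<^sup>2" for t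
      by (simp only: r2 q)
    have \<beta>: "(r t)\<^sup>2 * ((C - a * u t) / (R\<^sup>2 - (u t)\<^sup>2)) = C - a * u t" for t
      using pos[of t] by (simp add: r2)
    note * = profile_solution[OF dr dr2 \<phi> db u c1 c2 cont s R p' q' \<beta>]
    show ?thesis
      using * rne by blast
  qed
  then show "is_solution a \<Omega> R UNIV (sphere_curve R z \<phi>)"
    and "vel (sphere_curve R z \<phi>) t $ 3 = p t"
    and "\<exists>E. conserved a \<Omega> UNIV (sphere_curve R z \<phi>) C E"
    unfolding \<open>sphere_curve R z \<phi> = rot_curve r \<phi> u\<close> by auto
qed

section \<open>Jacobi elliptic functions\<close>

lemma DERIV_interval_integral:
  fixes f :: "real \<Rightarrow> real"
  assumes "continuous_on UNIV f"
  shows "((\<lambda>u. LBINT y=ereal 0..ereal u. f y) has_real_derivative f u) (at u)"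
proof -
  let ?b = "\<bar>u\<bar> + 1"
  have "((\<lambda>u. LBINT y=ereal 0..ereal u. f y) has_vector_derivative f u) (at u within {- ?b..?b})"
    by (rule interval_integral_FTC2) (auto intro: continuous_on_subset[OF assms])
  moreover have "at u within {- ?b..?b} = at u"
    by (rule at_within_Icc_at) linarith+
  ultimately show ?thesis
    unfolding has_real_derivative_iff_has_vector_derivative by (simp only:)
qed

definition jacobi_cn :: "real \<Rightarrow> real \<Rightarrow> real" where
  "jacobi_cn u k = cos (jacobi_am u k)"

definition jacobi_dn :: "real \<Rightarrow> real \<Rightarrow> real" where
  "jacobi_dn u k = sqrt (1 - k * (jacobi_sn u k)\<^sup>2)"

lemma one_minus_mult_square_pos:
  fixes n s :: real
  assumes "n < 1" "s\<^sup>2 \<le> 1"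
  shows "1 - n * s\<^sup>2 > 0"
proof (cases "n \<le> 0")
  case True
  then have "n * s\<^sup>2 \<le> 0"
    by (simp add: mult_nonpos_nonneg)
  then show ?thesis
    by simp
next
  case False
  then have "n * s\<^sup>2 \<le> n * 1"
    using assms by (intro mult_left_mono) auto
  then show ?thesis
    using assms by simp
qed

lemma sin_square_le_1: "(sin x)\<^sup>2 \<le> (1 :: real)"
  by (simp add: abs_square_le_1)

lemma jacobi_sn_square_le_1: "(jacobi_sn u k)\<^sup>2 \<le> 1"
  by (simp add: jacobi_sn_def sin_square_le_1)

context
  fixes k :: real
  assumes k: "0 < k" "k < 1"
begin

lemma ellip_modulus_pos: "1 - k * (sin \<theta>)\<^sup>2 > 0"
  using k by (intro one_minus_mult_square_pos sin_square_le_1)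

lemma DERIV_ellip_F: "((\<lambda>\<phi>. ellip_F \<phi> k) has_real_derivative 1 / sqrt (1 - k * (sin \<phi>)\<^sup>2)) (at \<phi>)"
proof -
  have "sqrt (1 - k * (sin \<theta>)\<^sup>2) \<noteq> 0" for \<theta>
    using ellip_modulus_pos[of \<theta>] by simp
  then have "continuous_on UNIV (\<lambda>\<theta>. 1 / sqrt (1 - k * (sin \<theta>)\<^sup>2))"
    by (intro continuous_intros) auto
  from DERIV_interval_integral[OF this] show ?thesis
    unfolding ellip_F_def .
qed

lemma ellip_F_0 [simp]: "ellip_F 0 k = 0"
  by (simp add: ellip_F_def)

text \<open>The integrand is at least 1. This one estimate gives injectivity and surjectivity of the
  amplitude integral and makes its inverse \<open>jacobi_am\<close> 1-Lipschitz, which supplies the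
  continuity needed by the inverse function rule.\<close>

lemma ellip_F_increment_ge:
  assumes "x \<le> y"
  shows "y - x \<le> ellip_F y k - ellip_F x k"
proof -
  have "ellip_F x k - x \<le> ellip_F y k - y"
  proof (rule DERIV_nonneg_imp_nondecreasing[OF assms, where f = "\<lambda>\<phi>. ellip_F \<phi> k - \<phi>"])
    fix \<phi>
    have "sqrt (1 - k * (sin \<phi>)\<^sup>2) \<le> 1"
      using k by simp
    then have "1 / sqrt (1 - k * (sin \<phi>)\<^sup>2) - 1 \<ge> 0"
      using ellip_modulus_pos[of \<phi>] by simp
    moreover have "((\<lambda>\<phi>. ellip_F \<phi> k - \<phi>) has_real_derivative 1 / sqrt (1 - k * (sin \<phi>)\<^sup>2) - 1) (at \<phi>)"
      by (intro DERIV_diff DERIV_ellip_F DERIV_ident)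
    ultimately show "\<exists>y. ((\<lambda>\<phi>. ellip_F \<phi> k - \<phi>) has_real_derivative y) (at \<phi>) \<and> 0 \<le> y"
      by blast
  qed
  then show ?thesis
    by simp
qed

lemma ellip_F_strict_mono: "x < y \<Longrightarrow> ellip_F x k < ellip_F y k"
  using ellip_F_increment_ge[of x y] by simp

lemma ellip_F_inject [simp]: "ellip_F x k = ellip_F y k \<longleftrightarrow> x = y"
  by (metis ellip_F_strict_mono less_irrefl linorder_neqE_linordered_idom)

lemma ellip_F_surj: "\<exists>\<phi>. ellip_F \<phi> k = u"
proof -
  have "- \<bar>u\<bar> \<le> u" "u \<le> \<bar>u\<bar>" "- \<bar>u\<bar> \<le> 0" "0 \<le> \<bar>u\<bar>"
    by auto
  then have "ellip_F (- \<bar>u\<bar>) k \<le> u" "u \<le> ellip_F \<bar>u\<bar> k" "- \<bar>u\<bar> \<le> \<bar>u\<bar>"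
    using ellip_F_increment_ge[of "- \<bar>u\<bar>" 0] ellip_F_increment_ge[of 0 "\<bar>u\<bar>"] by auto
  moreover have "isCont (\<lambda>\<phi>. ellip_F \<phi> k) x" for x
    by (rule DERIV_isCont[OF DERIV_ellip_F])
  ultimately show ?thesis
    using IVT[of "\<lambda>\<phi>. ellip_F \<phi> k" "- \<bar>u\<bar>" u "\<bar>u\<bar>"] by blast
qed

lemma jacobi_am_ellip_F [simp]: "jacobi_am (ellip_F \<phi> k) k = \<phi>"
  unfolding jacobi_am_def by (rule the_equality) auto

lemma ellip_F_jacobi_am [simp]: "ellip_F (jacobi_am u k) k = u"
  by (metis ellip_F_surj jacobi_am_ellip_F)

lemma jacobi_dn_pos: "jacobi_dn u k > 0"
  using ellip_modulus_pos by (simp add: jacobi_dn_def jacobi_sn_def)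

lemma jacobi_dn_square: "(jacobi_dn u k)\<^sup>2 = 1 - k * (jacobi_sn u k)\<^sup>2"
  using jacobi_dn_pos[of u] by (simp add: jacobi_dn_def)

lemma jacobi_cn_square: "(jacobi_cn u k)\<^sup>2 = 1 - (jacobi_sn u k)\<^sup>2"
  by (simp add: jacobi_cn_def jacobi_sn_def cos_squared_eq)

lemma isCont_jacobi_am: "isCont (\<lambda>u. jacobi_am u k) u"
proof -
  have "\<bar>jacobi_am v k - jacobi_am u k\<bar> \<le> \<bar>v - u\<bar>" for v
    using ellip_F_increment_ge[of "jacobi_am u k" "jacobi_am v k"]
      ellip_F_increment_ge[of "jacobi_am v k" "jacobi_am u k"]
    by (cases "jacobi_am u k \<le> jacobi_am v k") auto
  then have "dist (jacobi_am v k) (jacobi_am u k) \<le> dist v u" for v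
    by (simp add: dist_real_def)
  then show ?thesis
    unfolding continuous_at_eps_delta by (meson le_less_trans)
qed

lemma DERIV_jacobi_am: "((\<lambda>u. jacobi_am u k) has_real_derivative jacobi_dn u k) (at u)"
proof -
  have "((\<lambda>u. jacobi_am u k) has_real_derivative inverse (1 / sqrt (1 - k * (sin (jacobi_am u k))\<^sup>2))) (at u)"
    by (rule DERIV_inverse_function[where f = "\<lambda>\<phi>. ellip_F \<phi> k" and a = "u - 1" and b = "u + 1"])
      (use DERIV_ellip_F ellip_modulus_pos[of "jacobi_am u k"] isCont_jacobi_am in auto)
  then show ?thesis
    by (simp add: jacobi_dn_def jacobi_sn_def inverse_eq_divide)
qed

lemma DERIV_jacobi_sn: "((\<lambda>u. jacobi_sn u k) has_real_derivative jacobi_cn u k * jacobi_dn u k) (at u)"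
  unfolding jacobi_sn_def jacobi_cn_def by (rule derivative_eq_intros DERIV_jacobi_am refl)+

lemma DERIV_jacobi_cn: "((\<lambda>u. jacobi_cn u k) has_real_derivative - (jacobi_sn u k * jacobi_dn u k)) (at u)"
  unfolding jacobi_sn_def jacobi_cn_def by (rule derivative_eq_intros DERIV_jacobi_am refl)+ simp

lemma DERIV_jacobi_dn:
  "((\<lambda>u. jacobi_dn u k) has_real_derivative - (k * jacobi_sn u k * jacobi_cn u k)) (at u)"
proof -
  have pos: "1 - k * (jacobi_sn u k)\<^sup>2 > 0"
    using ellip_modulus_pos by (simp add: jacobi_sn_def)
  have "((\<lambda>u. 1 - k * (jacobi_sn u k)\<^sup>2) has_real_derivative
      - (2 * k * jacobi_sn u k * (jacobi_cn u k * jacobi_dn u k))) (at u)"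
    by (rule derivative_eq_intros DERIV_jacobi_sn refl)+ simp
  from DERIV_chain2[OF DERIV_real_sqrt[OF pos] this]
  have "((\<lambda>u. jacobi_dn u k) has_real_derivative
      inverse (jacobi_dn u k) / 2 * - (2 * k * jacobi_sn u k * (jacobi_cn u k * jacobi_dn u k))) (at u)"
    by (simp add: jacobi_dn_def)
  then show ?thesis
    by (rule DERIV_cong) (use jacobi_dn_pos[of u] in \<open>simp add: field_simps\<close>)
qed

lemma ellip_F_minus: "ellip_F (- \<phi>) k = - ellip_F \<phi> k"
proof -
  have "((\<lambda>\<phi>. ellip_F (- \<phi>) k + ellip_F \<phi> k) has_real_derivative 0) (at x)" for x
    by (rule derivative_eq_intros DERIV_chain2[OF DERIV_ellip_F] DERIV_ellip_F refl)+ simp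
  then have "ellip_F (- \<phi>) k + ellip_F \<phi> k = ellip_F (- 0) k + ellip_F 0 k"
    by (intro DERIV_isconst_all[where f = "\<lambda>\<phi>. ellip_F (- \<phi>) k + ellip_F \<phi> k"]) blast
  then show ?thesis
    by simp
qed

lemma ellip_F_plus_pi: "ellip_F (\<phi> + pi) k = ellip_F \<phi> k + 2 * ellip_K k"
proof -
  have "((\<lambda>\<phi>. ellip_F (\<phi> + pi) k - ellip_F \<phi> k) has_real_derivative 0) (at x)" for x
    by (rule derivative_eq_intros DERIV_chain2[OF DERIV_ellip_F] DERIV_ellip_F refl)+ simp
  \<comment> \<open>The shift is evaluated at \<open>- (pi / 2)\<close>, where oddness turns the
    constant into twice the complete integral.\<close>
  then have "ellip_F (\<phi> + pi) k - ellip_F \<phi> k = ellip_F (- (pi / 2) + pi) k - ellip_F (- (pi / 2)) k"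
    by (intro DERIV_isconst_all[where f = "\<lambda>\<phi>. ellip_F (\<phi> + pi) k - ellip_F \<phi> k"]) blast
  also have "- (pi / 2) + pi = pi / 2"
    by simp
  finally show ?thesis
    by (simp add: ellip_K_def ellip_F_minus)
qed

lemma ellip_K_pos: "ellip_K k > 0"
  using ellip_F_strict_mono[of 0 "pi / 2"] by (simp add: ellip_K_def)

lemma jacobi_am_plus_period: "jacobi_am (u + 2 * ellip_K k) k = jacobi_am u k + pi"
  by (metis ellip_F_jacobi_am ellip_F_plus_pi jacobi_am_ellip_F)

lemma jacobi_sn_square_period: "(jacobi_sn (u + 2 * ellip_K k) k)\<^sup>2 = (jacobi_sn u k)\<^sup>2"
  by (simp add: jacobi_sn_def jacobi_am_plus_period)

text \<open>The amplitude gains \<open>pi\<close> per half period, so it runs through the zeros of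
  the sine exactly at the multiples of \<open>2 * ellip_K k\<close>.\<close>

lemma jacobi_sn_eq_0_iff: "jacobi_sn u k = 0 \<longleftrightarrow> (\<exists>n :: int. u = 2 * ellip_K k * of_int n)"
proof -
  have F: "ellip_F (of_int n * pi) k = 2 * ellip_K k * of_int n" for n :: int
  proof (induction n rule: int_induct[where k = 0])
    case (step1 n)
    then show ?case
      using ellip_F_plus_pi[of "of_int n * pi"] by (simp add: algebra_simps)
  next
    case (step2 n)
    then show ?case
      using ellip_F_plus_pi[of "of_int (n - 1) * pi"] by (simp add: algebra_simps)
  qed simp
  have "jacobi_sn u k = 0 \<longleftrightarrow> (\<exists>n :: int. jacobi_am u k = of_int n * pi)"
    by (simp add: jacobi_sn_def sin_zero_iff_int2)
  also have "\<dots> \<longleftrightarrow> (\<exists>n :: int. u = 2 * ellip_K k * of_int n)"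
    by (metis F ellip_F_jacobi_am jacobi_am_ellip_F)
  finally show ?thesis .
qed

text \<open>This finds a phase on the oscillation with a given height and a given direction of
  motion. At \<open>\<alpha> = arcsin (sqrt y)\<close> sine and cosine are both positive, and
  passing to \<open>- \<alpha>\<close> reverses the sign of their product.\<close>

lemma jacobi_sn_cn_exists:
  assumes "0 < y" "y < 1" "p \<noteq> (0 :: real)"
  obtains v where "(jacobi_sn v k)\<^sup>2 = y" "p * (jacobi_sn v k * jacobi_cn v k) > 0"
proof -
  define \<alpha> where "\<alpha> = arcsin (sqrt y)"
  have y: "0 < sqrt y" "sqrt y < 1"
    using assms by auto
  then have s: "sin \<alpha> = sqrt y"
    unfolding \<alpha>_def by (intro sin_arcsin) linarith+
  have c: "cos \<alpha> = sqrt (1 - y)"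
  proof -
    have "cos \<alpha> = sqrt (1 - (sqrt y)\<^sup>2)"
      unfolding \<alpha>_def using y by (intro cos_arcsin) linarith+
    then show ?thesis
      using assms(1) by simp
  qed
  show thesis
  proof (cases "p > 0")
    case True
    show thesis
      by (rule that[of "ellip_F \<alpha> k"]) (use True assms in \<open>simp_all add: jacobi_sn_def jacobi_cn_def s c\<close>)
  next
    case False
    then have "p < 0"
      using assms(3) by simp
    show thesis
      by (rule that[of "ellip_F (- \<alpha>) k"])
        (use \<open>p < 0\<close> assms in \<open>simp_all add: jacobi_sn_def jacobi_cn_def s c mult_neg_pos\<close>)
  qed
qed

lemma DERIV_ellip_Pi_inc:
  assumes "n < 1"
  shows "((\<lambda>u. ellip_Pi_inc u n k) has_real_derivative 1 / (1 - n * (jacobi_sn u k)\<^sup>2)) (at u)"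
proof -
  have "continuous_on UNIV (\<lambda>u. jacobi_sn u k)"
    by (rule continuous_at_imp_continuous_on) (blast intro: DERIV_isCont DERIV_jacobi_sn)
  moreover have "1 - n * (jacobi_sn u k)\<^sup>2 \<noteq> 0" for u
    using one_minus_mult_square_pos[OF assms jacobi_sn_square_le_1[of u k]] by simp
  ultimately have "continuous_on UNIV (\<lambda>u. 1 / (1 - n * (jacobi_sn u k)\<^sup>2))"
    by (intro continuous_intros) auto
  from DERIV_interval_integral[OF this] show ?thesis
    unfolding ellip_Pi_inc_def .
qed

text \<open>The integrand has period \<open>2 * ellip_K k\<close>, so the gain is constant. Its
  value at 0 is the integral over one full period, of which \<open>ellip_Pi\<close> is half by
  definition.\<close>

lemma ellip_Pi_inc_plus_period:
  assumes "n < 1"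
  shows "ellip_Pi_inc (u + 2 * ellip_K k) n k = ellip_Pi_inc u n k + 2 * ellip_Pi n k"
proof -
  have "((\<lambda>u. ellip_Pi_inc (u + 2 * ellip_K k) n k - ellip_Pi_inc u n k) has_real_derivative 0) (at x)" for x
    by (rule derivative_eq_intros DERIV_chain2[OF DERIV_ellip_Pi_inc] DERIV_ellip_Pi_inc assms refl)+
      (simp add: jacobi_sn_square_period)
  then have "ellip_Pi_inc (u + 2 * ellip_K k) n k - ellip_Pi_inc u n k
      = ellip_Pi_inc (0 + 2 * ellip_K k) n k - ellip_Pi_inc 0 n k"
    by (intro DERIV_isconst_all[where f = "\<lambda>u. ellip_Pi_inc (u + 2 * ellip_K k) n k - ellip_Pi_inc u n k"]) blast
  then show ?thesis
    by (simp add: ellip_Pi_inc_def ellip_Pi_def)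
qed

end

section \<open>The latitude cubic\<close>

lemma poly_cubic:
  assumes "a > 0" "R > 0"
  shows "R\<^sup>2 * poly (cubic a \<Omega> R C E) s
      = (R\<^sup>2 - s\<^sup>2) * (2 * (E + \<Omega> * C) / a - 2 * \<Omega> * s) - (C - a * s)\<^sup>2"
proof -
  have "R\<^sup>2 * poly (cubic a \<Omega> R C E) s = (2 * E * R\<^sup>2 - a * C\<^sup>2 + 2 * \<Omega> * C * R\<^sup>2) / a
      + s * (2 * a * C - 2 * \<Omega> * R\<^sup>2) - s\<^sup>2 * ((2 * E + a ^ 3 + 2 * \<Omega> * C) / a) + s ^ 3 * (2 * \<Omega>)"
    using assms by (simp add: cubic_def Let_def distrib_left field_simps power2_eq_square power3_eq_cube)
  also have "\<dots> = (R\<^sup>2 - s\<^sup>2) * (2 * (E + \<Omega> * C) / a - 2 * \<Omega> * s) - (C - a * s)\<^sup>2"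
    using assms by (simp add: field_simps power2_eq_square power3_eq_cube)
  finally show ?thesis .
qed

text \<open>Differentiating \<open>u'\<^sup>2 = P(u)\<close> leads to
  \<open>u'' = P'(u) / 2\<close>; the formula comes from differentiating both sides of
  \<open>poly_cubic\<close>.\<close>

lemma poly_pderiv_cubic:
  assumes "a > 0" "R > 0"
  shows "R\<^sup>2 * (poly (pderiv (cubic a \<Omega> R C E)) s / 2)
      = a * (C - a * s) - s * (2 * (E + \<Omega> * C) / a - 2 * \<Omega> * s) - \<Omega> * (R\<^sup>2 - s\<^sup>2)"
proof -
  define V where "V = 2 * (E + \<Omega> * C) / a"
  have "((\<lambda>s. R\<^sup>2 * poly (cubic a \<Omega> R C E) s) has_real_derivative
      R\<^sup>2 * poly (pderiv (cubic a \<Omega> R C E)) s) (at s)"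
    by (rule derivative_eq_intros poly_DERIV refl)+ simp
  moreover have "((\<lambda>s. (R\<^sup>2 - s\<^sup>2) * (V - 2 * \<Omega> * s) - (C - a * s)\<^sup>2) has_real_derivative
      2 * (a * (C - a * s) - s * (V - 2 * \<Omega> * s) - \<Omega> * (R\<^sup>2 - s\<^sup>2))) (at s)"
    by (rule derivative_eq_intros refl)+ (simp add: algebra_simps)
  ultimately have "R\<^sup>2 * poly (pderiv (cubic a \<Omega> R C E)) s
      = 2 * (a * (C - a * s) - s * (V - 2 * \<Omega> * s) - \<Omega> * (R\<^sup>2 - s\<^sup>2))"
    unfolding poly_cubic[OF assms] V_def by (rule DERIV_unique)
  then show ?thesis
    by (simp add: V_def)
qed

lemma cubic_third_root:
  assumes "\<Omega> > 0" "R > 0" "poly (cubic a \<Omega> R C E) e1 = 0" "poly (cubic a \<Omega> R C E) e2 = 0" "e1 \<noteq> e2"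
  shows "\<exists>e3. \<forall>s. poly (cubic a \<Omega> R C E) s = 2 * \<Omega> / R\<^sup>2 * ((s - e1) * (s - e2) * (s - e3))"
proof -
  define c where "c = 2 * \<Omega> / R\<^sup>2"
  have c: "c \<noteq> 0"
    using assms by (simp add: c_def)
  obtain c0 c1 c2 where "cubic a \<Omega> R C E = [:c0, c1, c2, c:]"
    unfolding cubic_def Let_def c_def by blast
  then have P: "poly (cubic a \<Omega> R C E) s = c0 + c1 * s + c2 * s\<^sup>2 + c * s ^ 3" for s
    by (simp add: algebra_simps power2_eq_square power3_eq_cube)
  \<comment> \<open>The third root is chosen by Vieta's formula for the sum of the roots. This
    matches the quadratic coefficients, so the difference of the two cubics is affine; vanishing at
    two distinct points, it is zero.\<close>
  define e3 where "e3 = - (c2 / c) - e1 - e2"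
  define d0 where "d0 = c0 + c * e1 * e2 * e3"
  define d1 where "d1 = c1 - c * (e1 * e2 + e1 * e3 + e2 * e3)"
  have c2: "c2 = - (c * (e1 + e2 + e3))"
    using c by (simp add: e3_def field_simps)
  have D: "poly (cubic a \<Omega> R C E) s = c * ((s - e1) * (s - e2) * (s - e3)) + (d0 + d1 * s)" for s
    unfolding P c2 d0_def d1_def by (simp add: algebra_simps power2_eq_square power3_eq_cube)
  have z: "d0 + d1 * e1 = 0" "d0 + d1 * e2 = 0"
    using D[of e1] D[of e2] assms(3,4) by simp_all
  moreover have "d1 * (e1 - e2) = (d0 + d1 * e1) - (d0 + d1 * e2)"
    by (simp add: algebra_simps)
  ultimately have "d1 * (e1 - e2) = 0"
    by simp
  then have "d1 = 0" "d0 = 0"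
    using assms(5) z by simp_all
  then have "poly (cubic a \<Omega> R C E) s = 2 * \<Omega> / R\<^sup>2 * ((s - e1) * (s - e2) * (s - e3))" for s
    using D by (simp add: c_def)
  then show ?thesis
    by blast
qed

lemma cubic_factor:
  assumes "\<Omega> > 0" "R > 0" "poly (cubic a \<Omega> R C E) e1 = 0" "poly (cubic a \<Omega> R C E) e2 = 0"
    "poly (cubic a \<Omega> R C E) e3 = 0" "e1 \<noteq> e2" "e1 \<noteq> e3" "e2 \<noteq> e3"
  shows "poly (cubic a \<Omega> R C E) s = 2 * \<Omega> / R\<^sup>2 * ((s - e1) * (s - e2) * (s - e3))"
proof -
  obtain e where e: "\<forall>s. poly (cubic a \<Omega> R C E) s = 2 * \<Omega> / R\<^sup>2 * ((s - e1) * (s - e2) * (s - e))"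
    using cubic_third_root[OF assms(1-4,6)] by blast
  then have "2 * \<Omega> / R\<^sup>2 * ((e3 - e1) * (e3 - e2) * (e3 - e)) = 0"
    using assms(5) by metis
  then have "e = e3"
    using assms by simp
  then show ?thesis
    using e by simp
qed

lemma pderiv_from_factor:
  fixes P :: "real poly"
  assumes "\<And>s. poly P s = c * ((s - e1) * (s - e2) * (s - e3))"
  shows "poly (pderiv P) s = c * ((s - e2) * (s - e3) + (s - e1) * (s - e3) + (s - e1) * (s - e2))"
proof -
  have "((\<lambda>s. c * ((s - e1) * (s - e2) * (s - e3))) has_real_derivative
      c * ((s - e2) * (s - e3) + (s - e1) * (s - e3) + (s - e1) * (s - e2))) (at s)"
    by (rule derivative_eq_intros refl)+ (simp add: algebra_simps)
  moreover have "((\<lambda>s. c * ((s - e1) * (s - e2) * (s - e3))) has_real_derivative poly (pderiv P) s) (at s)"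
    using poly_DERIV[of P s] by (simp add: assms[abs_def])
  ultimately show ?thesis
    by (rule DERIV_unique[symmetric])
qed

text \<open>Lagrange's identity for the horizontal parts of position and velocity: product of the
  squared lengths minus squared angular momentum is the squared inner product, and orthogonality of
  \<open>x\<close> and its velocity turns that inner product into
  \<open>- x\<^sub>3 v\<^sub>3\<close>.\<close>

lemma solution_latitude_square:
  assumes "is_solution a \<Omega> R I x" "conserved a \<Omega> I x C E" "a > 0" "R > 0" "t \<in> I"
  shows "(vel x t $ 3)\<^sup>2 = poly (cubic a \<Omega> R C E) (x t $ 3)"
proof -
  let ?x = "x t" and ?v = "vel x t"
  have s: "(?x $ 1)\<^sup>2 + (?x $ 2)\<^sup>2 + (?x $ 3)\<^sup>2 = R\<^sup>2"
    and o: "?x $ 1 * ?v $ 1 + ?x $ 2 * ?v $ 2 + ?x $ 3 * ?v $ 3 = 0"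
    using is_solution_components(6,7)[OF assms(1,5)] by simp_all
  have r: "R\<^sup>2 - (?x $ 3)\<^sup>2 = (?x $ 1)\<^sup>2 + (?x $ 2)\<^sup>2"
    using s by simp
  have J: "C - a * ?x $ 3 = ?x $ 1 * ?v $ 2 - ?x $ 2 * ?v $ 1"
    using assms(2,5) by (simp add: conserved_def)
  have o1: "?x $ 1 * ?v $ 1 + ?x $ 2 * ?v $ 2 = - (?x $ 3 * ?v $ 3)"
    using o by linarith
  have o2: "(?x $ 1 * ?v $ 1 + ?x $ 2 * ?v $ 2)\<^sup>2 = (?x $ 3)\<^sup>2 * (?v $ 3)\<^sup>2"
    unfolding o1 by (simp add: power_mult_distrib)
  have "R\<^sup>2 * poly (cubic a \<Omega> R C E) (?x $ 3)
      = ((?x $ 1)\<^sup>2 + (?x $ 2)\<^sup>2) * ((?v $ 1)\<^sup>2 + (?v $ 2)\<^sup>2 + (?v $ 3)\<^sup>2) - (?x $ 1 * ?v $ 2 - ?x $ 2 * ?v $ 1)\<^sup>2"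
    unfolding poly_cubic[OF assms(3,4)] conserved_speed[OF assms(2,3,5), symmetric] r J norm_vec3 ..
  also have "\<dots> = (?x $ 1 * ?v $ 1 + ?x $ 2 * ?v $ 2)\<^sup>2 + ((?x $ 1)\<^sup>2 + (?x $ 2)\<^sup>2) * (?v $ 3)\<^sup>2"
    by (simp add: algebra_simps power2_eq_square)
  also have "\<dots> = R\<^sup>2 * (?v $ 3)\<^sup>2"
    unfolding o2 s[symmetric] by (simp add: algebra_simps)
  finally show ?thesis
    using assms(4) by simp
qed

lemma not_constant_latitude_obtains:
  assumes "is_solution a \<Omega> R I x" "\<not> constant_latitude I x"
  obtains t where "t \<in> I" "vel x t $ 3 \<noteq> 0"
proof (rule ccontr)
  assume "\<not> thesis"
  then have "((\<lambda>t. x t $ 3) has_real_derivative 0) (at t)" if "t \<in> I" for t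
    using is_solution_components(1)[OF assms(1) that, of 3] that \<open>\<And>t. t \<in> I \<Longrightarrow> vel x t $ 3 \<noteq> 0 \<Longrightarrow> thesis\<close>
    by metis
  moreover have I: "open_interval I"
    using assms(1) by (simp add: is_solution_def)
  ultimately have "x s $ 3 = x t $ 3" if "s \<in> I" "t \<in> I" for s t
    using open_interval_DERIV_zero_constant[of I "\<lambda>t. x t $ 3" s t] that by blast
  then have "constant_latitude I x"
    unfolding constant_latitude_def constant_on_def by blast
  then show False
    using assms(2) by simp
qed

lemma cubic_poles_nonpos:
  assumes "a > 0" "R > 0"
  shows "R\<^sup>2 * poly (cubic a \<Omega> R C E) R = - (C - a * R)\<^sup>2"
    "R\<^sup>2 * poly (cubic a \<Omega> R C E) (- R) = - (C + a * R)\<^sup>2"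
  by (simp_all add: poly_cubic[OF assms])

text \<open>Only the order of the roots is fixed, not their position relative to the poles, so one
  oscillation serves both the curves that avoid the poles and those that cross one.\<close>

locale elliptic_latitude =
  fixes \<Omega> R e1 e2 e3 \<omega> k :: real
  assumes pos: "\<Omega> > 0" "R > 0" and e: "e1 < e2" "e2 < e3"
    and \<omega>: "\<omega> = sqrt (\<Omega> / (2 * R\<^sup>2) * (e3 - e1))" and k: "k = (e2 - e1) / (e3 - e1)"
begin

lemma elliptic_modulus: "0 < k" "k < 1"
  using e by (simp_all add: k)

lemma elliptic_frequency: "\<omega> > 0" "\<omega>\<^sup>2 = \<Omega> / R\<^sup>2 / 2 * (e3 - e1)"
  using e pos by (simp_all add: \<omega>)

abbreviation "S \<xi> t \<equiv> jacobi_sn (\<omega> * (t - \<xi>)) k"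
abbreviation "N \<xi> t \<equiv> jacobi_cn (\<omega> * (t - \<xi>)) k"
abbreviation "D \<xi> t \<equiv> jacobi_dn (\<omega> * (t - \<xi>)) k"

definition "lat \<xi> t = e1 + (e2 - e1) * (S \<xi> t)\<^sup>2"
definition "lat1 \<xi> t = 2 * (e2 - e1) * \<omega> * (S \<xi> t * N \<xi> t * D \<xi> t)"
definition "lat2 \<xi> t = 2 * (e2 - e1) * \<omega>\<^sup>2 *
  ((N \<xi> t)\<^sup>2 * (D \<xi> t)\<^sup>2 - (S \<xi> t)\<^sup>2 * (D \<xi> t)\<^sup>2 - k * (S \<xi> t)\<^sup>2 * (N \<xi> t)\<^sup>2)"

lemma DERIV_S: "((\<lambda>t. S \<xi> t) has_real_derivative \<omega> * (N \<xi> t * D \<xi> t)) (at t)"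
  by (rule DERIV_cong[OF DERIV_chain2[OF DERIV_jacobi_sn[OF elliptic_modulus]]],
      (rule derivative_eq_intros refl)+) simp

lemma DERIV_N: "((\<lambda>t. N \<xi> t) has_real_derivative - \<omega> * (S \<xi> t * D \<xi> t)) (at t)"
  by (rule DERIV_cong[OF DERIV_chain2[OF DERIV_jacobi_cn[OF elliptic_modulus]]],
      (rule derivative_eq_intros refl)+) simp

lemma DERIV_D: "((\<lambda>t. D \<xi> t) has_real_derivative - \<omega> * (k * S \<xi> t * N \<xi> t)) (at t)"
  by (rule DERIV_cong[OF DERIV_chain2[OF DERIV_jacobi_dn[OF elliptic_modulus]]],
      (rule derivative_eq_intros refl)+) simp

lemma DERIV_lat: "(lat \<xi> has_real_derivative lat1 \<xi> t) (at t)"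
  unfolding lat_def[abs_def] lat1_def
  by (rule derivative_eq_intros DERIV_S refl)+ simp

lemma DERIV_lat1: "(lat1 \<xi> has_real_derivative lat2 \<xi> t) (at t)"
  unfolding lat1_def[abs_def] lat2_def
  by (rule derivative_eq_intros DERIV_S DERIV_N DERIV_D refl)+ (simp add: algebra_simps power2_eq_square)

lemma continuous_lat2: "continuous_on UNIV (lat2 \<xi>)"
  unfolding lat2_def[abs_def]
  by (intro continuous_intros continuous_at_imp_continuous_on ballI DERIV_isCont[OF DERIV_S] DERIV_isCont[OF DERIV_N]
      DERIV_isCont[OF DERIV_D])

text \<open>The choice of \<open>k\<close> makes \<open>(e3 - e1) * k = e2 - e1\<close>, so the
  three linear factors of the cubic are multiples of the squares of sn, cn and dn. Their product is
  then the square of the derivative of sn squared, up to a constant that fixes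
  \<open>\<omega>\<close>.\<close>

lemma lat_minus_roots:
  "lat \<xi> t - e1 = (e2 - e1) * (S \<xi> t)\<^sup>2" "lat \<xi> t - e2 = - (e2 - e1) * (N \<xi> t)\<^sup>2"
  "lat \<xi> t - e3 = - (e3 - e1) * (D \<xi> t)\<^sup>2"
proof -
  show "lat \<xi> t - e1 = (e2 - e1) * (S \<xi> t)\<^sup>2" "lat \<xi> t - e2 = - (e2 - e1) * (N \<xi> t)\<^sup>2"
    by (simp_all add: lat_def jacobi_cn_square[OF elliptic_modulus] algebra_simps)
  have "(e3 - e1) * k = e2 - e1"
    using e by (simp add: k)
  then have "- (e3 - e1) * (D \<xi> t)\<^sup>2 = - (e3 - e1) + (e2 - e1) * (S \<xi> t)\<^sup>2"
    unfolding jacobi_dn_square[OF elliptic_modulus] by (metis (no_types, opaque_lifting) add.commute diff_minus_eq_add minus_diff_eq minus_mult_left mult.assoc mult.right_neutral right_diff_distrib)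
  then show "lat \<xi> t - e3 = - (e3 - e1) * (D \<xi> t)\<^sup>2"
    by (simp add: lat_def)
qed

lemma lat_bounds: "e1 \<le> lat \<xi> t" "lat \<xi> t \<le> e2"
  using lat_minus_roots(1,2)[of \<xi> t] e by (smt (verit) mult_minus_left mult_nonneg_nonneg zero_le_power2)+

lemma lat1_square: "(lat1 \<xi> t)\<^sup>2 = 2 * \<Omega> / R\<^sup>2 * ((lat \<xi> t - e1) * (lat \<xi> t - e2) * (lat \<xi> t - e3))"
proof -
  have "(lat1 \<xi> t)\<^sup>2 = 4 * \<omega>\<^sup>2 * ((e2 - e1)\<^sup>2 * ((S \<xi> t)\<^sup>2 * (N \<xi> t)\<^sup>2 * (D \<xi> t)\<^sup>2))"
    unfolding lat1_def power_mult_distrib by simp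
  also have "\<dots> = 2 * \<Omega> / R\<^sup>2 * ((lat \<xi> t - e1) * (lat \<xi> t - e2) * (lat \<xi> t - e3))"
  proof -
    \<comment> \<open>Here \<open>c\<close> stands for \<open>\<Omega> / R\<^sup>2\<close>,
      \<open>m\<close> for \<open>e3 - e1\<close>, \<open>\<delta>\<close> for
      \<open>e2 - e1\<close>, and \<open>A\<close>, \<open>B\<close>, \<open>d\<close> for the
      squares of sn, cn and dn.\<close>
    have id: "4 * (c / 2 * m) * (\<delta>\<^sup>2 * (A * B * d)) = 2 * c * (\<delta> * A * (- \<delta> * B) * (- m * d))"
      for A B c d m \<delta> :: real
      by (simp add: algebra_simps power2_eq_square)
    show ?thesis
      unfolding lat_minus_roots elliptic_frequency(2) times_divide_eq_right[symmetric] by (rule id)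
  qed
  finally show ?thesis .
qed

lemma lat2_eq: "lat2 \<xi> t = \<Omega> / R\<^sup>2 * ((lat \<xi> t - e2) * (lat \<xi> t - e3) + (lat \<xi> t - e1) * (lat \<xi> t - e3)
    + (lat \<xi> t - e1) * (lat \<xi> t - e2))"
proof -
  have k': "e2 - e1 = (e3 - e1) * k"
    using e by (simp add: k)
  have id: "2 * (m * k) * (c / 2 * m) * (B * d - A * d - k * A * B)
      = c * (- (m * k) * B * (- m * d) + m * k * A * (- m * d) + m * k * A * (- (m * k) * B))"
    for A B c d m :: real
    by (simp add: algebra_simps)
  show ?thesis
    unfolding lat2_def lat_minus_roots elliptic_frequency(2) k' by (rule id)
qed

text \<open>A phase with the right height already has the right vertical speed up to sign, since
  both squares equal the cubic. The sign is arranged through \<open>jacobi_sn_cn_exists\<close>, and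
  the time shift moves this phase to time \<open>t\<close>.\<close>

lemma lat_match:
  assumes "e1 < y" "y < e2" "p \<noteq> 0" "p\<^sup>2 = 2 * \<Omega> / R\<^sup>2 * ((y - e1) * (y - e2) * (y - e3))"
  obtains \<xi> where "lat \<xi> t = y" "lat1 \<xi> t = p"
proof -
  have "0 < (y - e1) / (e2 - e1)" "(y - e1) / (e2 - e1) < 1"
    using assms e by auto
  then obtain v where v: "(jacobi_sn v k)\<^sup>2 = (y - e1) / (e2 - e1)" "p * (jacobi_sn v k * jacobi_cn v k) > 0"
    using jacobi_sn_cn_exists[OF elliptic_modulus] assms(3) by metis
  let ?\<xi> = "t - v / \<omega>"
  have arg: "\<omega> * (t - ?\<xi>) = v"
    using elliptic_frequency(1) by simp
  have y: "lat ?\<xi> t = y"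
    unfolding lat_def arg v(1) using e by simp
  have "(lat1 ?\<xi> t)\<^sup>2 = p\<^sup>2"
    unfolding lat1_square y assms(4) ..
  moreover have "p * lat1 ?\<xi> t > 0"
  proof -
    have "p * lat1 ?\<xi> t = 2 * (e2 - e1) * \<omega> * jacobi_dn v k * (p * (jacobi_sn v k * jacobi_cn v k))"
      unfolding lat1_def arg by simp
    moreover have "2 * (e2 - e1) * \<omega> * jacobi_dn v k > 0"
      using e elliptic_frequency(1) jacobi_dn_pos[OF elliptic_modulus] by simp
    ultimately show ?thesis
      using v(2) by (metis mult_pos_pos)
  qed
  ultimately have "lat1 ?\<xi> t = p"
    by (metis mult_less_0_iff mult_minus_right neg_0_less_iff_less not_less_iff_gr_or_eq power2_eq_iff zero_less_mult_iff)
  with y show thesis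
    by (rule that)
qed

end

section \<open>Passing through a pole\<close>

text \<open>\<open>\<sigma>\<close> is 1 for the north and -1 for the south pole. For
  \<open>C = \<sigma> * a * R\<close> the numerator \<open>C - a * u\<close> is
  \<open>\<sigma> * a * (R - \<sigma> * u)\<close>; it cancels the singular factor of
  \<open>R\<^sup>2 - u\<^sup>2\<close> and leaves an azimuthal speed that is regular at this pole.
  The radius is likewise split into a signed root \<open>w\<close> of
  \<open>R - \<sigma> * u\<close> and the positive root of the other factor.\<close>

lemma polar_profile_solution:
  assumes u: "\<And>t. (u has_real_derivative p t) (at t)" "\<And>t. (p has_real_derivative q t) (at t)"
    and w: "\<And>t. (w has_real_derivative w1 t) (at t)" "\<And>t. (w1 has_real_derivative w2 t) (at t)"
    and \<phi>: "\<And>t. (\<phi> has_real_derivative \<sigma> * a / (R + \<sigma> * u t)) (at t)"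
    and cont: "continuous_on UNIV q" "continuous_on UNIV w2"
    and R: "R > 0" and \<sigma>: "\<sigma>\<^sup>2 = 1" and C: "C = \<sigma> * a * R"
    and w_sq: "\<And>t. (w t)\<^sup>2 = R - \<sigma> * u t" and pos: "\<And>t. R + \<sigma> * u t > 0"
    and p: "\<And>t. R\<^sup>2 * (p t)\<^sup>2 = (R\<^sup>2 - (u t)\<^sup>2) * (V - 2 * \<Omega> * u t) - (C - a * u t)\<^sup>2"
    and q: "\<And>t. R\<^sup>2 * q t = a * (C - a * u t) - u t * (V - 2 * \<Omega> * u t) - \<Omega> * (R\<^sup>2 - (u t)\<^sup>2)"
    and simple: "\<And>t. w t = 0 \<Longrightarrow> w1 t \<noteq> 0"
  defines "X \<equiv> rot_curve (\<lambda>t. w t * sqrt (R + \<sigma> * u t)) \<phi> u"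
  shows "is_solution a \<Omega> R UNIV X" and "vel X t $ 3 = p t" and "\<exists>E. conserved a \<Omega> UNIV X C E"
proof -
  define h where "h = (\<lambda>t. sqrt (R + \<sigma> * u t))"
  have h0: "h t \<noteq> 0" and h2: "(h t)\<^sup>2 = R + \<sigma> * u t" for t
    using pos[of t] by (auto simp: h_def)
  define h1 where "h1 = (\<lambda>t. \<sigma> * p t / (2 * h t))"
  have dh: "(h has_real_derivative h1 t) (at t)" for t
  proof -
    have "((\<lambda>t. R + \<sigma> * u t) has_real_derivative \<sigma> * p t) (at t)"
      by (rule derivative_eq_intros u refl)+ simp
    from DERIV_chain2[OF DERIV_real_sqrt[OF pos] this] show ?thesis
      unfolding h_def h1_def by (rule DERIV_cong) (simp add: inverse_eq_divide)
  qed
  define h2' where "h2' = (\<lambda>t. (\<sigma> * q t * (2 * h t) - \<sigma> * p t * (2 * h1 t)) / (2 * h t * (2 * h t)))"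
  have dh1: "(h1 has_real_derivative h2' t) (at t)" for t
    unfolding h1_def h2'_def[folded h1_def]
    by (rule derivative_eq_intros u dh refl)+ (use h0[of t] in \<open>simp_all add: h1_def\<close>)
  have dr: "((\<lambda>t. w t * h t) has_real_derivative w1 t * h t + w t * h1 t) (at t)" for t
    by (rule derivative_eq_intros w dh refl)+ (simp add: algebra_simps)
  have dr1: "((\<lambda>t. w1 t * h t + w t * h1 t) has_real_derivative
      w2 t * h t + 2 * (w1 t * h1 t) + w t * h2' t) (at t)" for t
    by (rule derivative_eq_intros w dh dh1 refl)+ (simp add: algebra_simps)
  define b where "b = (\<lambda>t. - (\<sigma> * a * (\<sigma> * p t)) / ((R + \<sigma> * u t) * (R + \<sigma> * u t)))"
  have Dne: "R + \<sigma> * u t \<noteq> 0" for t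
    using pos[of t] by simp
  have db: "((\<lambda>t. \<sigma> * a / (R + \<sigma> * u t)) has_real_derivative b t) (at t)" for t
    unfolding b_def by (rule derivative_eq_intros u Dne refl)+ simp
  have co: "continuous_on UNIV u" "continuous_on UNIV p" "continuous_on UNIV h" "continuous_on UNIV h1"
    "continuous_on UNIV w" "continuous_on UNIV w1"
    by (meson u w dh dh1 DERIV_continuous continuous_at_imp_continuous_on)+
  have ch2: "continuous_on UNIV h2'"
    unfolding h2'_def by (intro continuous_intros co cont) (simp add: h0)
  have c1: "continuous_on UNIV (\<lambda>t. w2 t * h t + 2 * (w1 t * h1 t) + w t * h2' t)"
    by (intro continuous_intros co cont ch2)
  have c2: "continuous_on UNIV b"
    unfolding b_def by (intro continuous_intros co cont) (simp add: Dne)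
  have r2: "(w t * h t)\<^sup>2 = R\<^sup>2 - (u t)\<^sup>2" for t
  proof -
    have "(w t * h t)\<^sup>2 = (R - \<sigma> * u t) * (R + \<sigma> * u t)"
      by (simp add: power_mult_distrib w_sq h2)
    also have "\<dots> = R\<^sup>2 - \<sigma>\<^sup>2 * (u t)\<^sup>2"
      by (simp add: algebra_simps power2_eq_square)
    finally show ?thesis
      by (simp add: \<sigma>)
  qed
  have s: "(w t * h t)\<^sup>2 + (u t)\<^sup>2 = R\<^sup>2" for t
    by (simp add: r2)
  have p': "R\<^sup>2 * (p t)\<^sup>2 = (w t * h t)\<^sup>2 * (V - 2 * \<Omega> * u t) - (C - a * u t)\<^sup>2" for t
    by (simp only: r2 p)
  have q': "R\<^sup>2 * q t = a * (C - a * u t) - u t * (V - 2 * \<Omega> * u t) - \<Omega> * (w t * h t)\<^sup>2" for t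
    by (simp only: r2 q)
  have \<beta>: "(w t * h t)\<^sup>2 * (\<sigma> * a / (R + \<sigma> * u t)) = C - a * u t" for t
  proof -
    have "(w t * h t)\<^sup>2 * (\<sigma> * a / (R + \<sigma> * u t)) = (R - \<sigma> * u t) * (\<sigma> * a)"
      using Dne[of t] by (simp add: power_mult_distrib w_sq h2)
    also have "\<dots> = \<sigma> * a * R - \<sigma>\<^sup>2 * (a * u t)"
      by (simp add: algebra_simps power2_eq_square)
    finally show ?thesis
      by (simp add: \<sigma> C)
  qed
  have si: "w1 t * h t + w t * h1 t \<noteq> 0" if "w t * h t = 0" for t
    using that simple[of t] h0[of t] by auto
  note * = profile_solution[OF dr dr1 \<phi> db u c1 c2 cont(1) s R p' q' \<beta> si]
  show "is_solution a \<Omega> R UNIV X" "vel X t $ 3 = p t" "\<exists>E. conserved a \<Omega> UNIV X C E"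
    using *[unfolded h_def] unfolding X_def by blast+
qed

lemma jacobi_am_0: "0 < k \<Longrightarrow> k < 1 \<Longrightarrow> jacobi_am 0 k = 0"
  using jacobi_am_ellip_F[of k 0] by simp

locale elliptic_profile = elliptic_latitude +
  fixes a C E :: real
  assumes a: "a > 0"
    and roots: "poly (cubic a \<Omega> R C E) e1 = 0" "poly (cubic a \<Omega> R C E) e2 = 0"
      "poly (cubic a \<Omega> R C E) e3 = 0"
begin

abbreviation "P \<equiv> cubic a \<Omega> R C E"

lemma P_factor: "poly P s = 2 * \<Omega> / R\<^sup>2 * ((s - e1) * (s - e2) * (s - e3))"
  using cubic_factor[OF pos roots] e by simp

lemma lat_cubic:
  "R\<^sup>2 * (lat1 \<xi> t)\<^sup>2 = (R\<^sup>2 - (lat \<xi> t)\<^sup>2) * (2 * (E + \<Omega> * C) / a - 2 * \<Omega> * lat \<xi> t) - (C - a * lat \<xi> t)\<^sup>2"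
  "R\<^sup>2 * lat2 \<xi> t = a * (C - a * lat \<xi> t) - lat \<xi> t * (2 * (E + \<Omega> * C) / a - 2 * \<Omega> * lat \<xi> t)
     - \<Omega> * (R\<^sup>2 - (lat \<xi> t)\<^sup>2)"
proof -
  have "(lat1 \<xi> t)\<^sup>2 = poly P (lat \<xi> t)"
    by (simp only: lat1_square P_factor)
  then show "R\<^sup>2 * (lat1 \<xi> t)\<^sup>2
      = (R\<^sup>2 - (lat \<xi> t)\<^sup>2) * (2 * (E + \<Omega> * C) / a - 2 * \<Omega> * lat \<xi> t) - (C - a * lat \<xi> t)\<^sup>2"
    by (simp only: poly_cubic[OF a pos(2)])
  have "lat2 \<xi> t = poly (pderiv P) (lat \<xi> t) / 2"
    by (simp add: lat2_eq pderiv_from_factor[OF P_factor])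
  then show "R\<^sup>2 * lat2 \<xi> t = a * (C - a * lat \<xi> t)
      - lat \<xi> t * (2 * (E + \<Omega> * C) / a - 2 * \<Omega> * lat \<xi> t) - \<Omega> * (R\<^sup>2 - (lat \<xi> t)\<^sup>2)"
    by (simp only: poly_pderiv_cubic[OF a pos(2)])
qed

text \<open>The cubic is positive between \<open>e1\<close> and \<open>e2\<close> and above
  \<open>e3\<close>. The bound \<open>R \<le> e3\<close> excludes the upper range for latitudes
  below \<open>R\<close>, so a moment of nonzero vertical speed lies strictly inside the
  oscillation.\<close>

lemma initial_latitude_match:
  assumes x: "nonpolar_solution a \<Omega> R I x" "conserved a \<Omega> I x C E" and "\<not> constant_latitude I x"
    and "R \<le> e3"
  obtains t\<^sub>0 \<xi> where "t\<^sub>0 \<in> I" "x t\<^sub>0 $ 3 = lat \<xi> t\<^sub>0" "vel x t\<^sub>0 $ 3 = lat1 \<xi> t\<^sub>0"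
proof -
  have xs: "is_solution a \<Omega> R I x"
    using x by (simp add: nonpolar_solution_def)
  obtain t0 where t0: "t0 \<in> I" "vel x t0 $ 3 \<noteq> 0"
    using not_constant_latitude_obtains[OF xs assms(3)] .
  let ?y = "x t0 $ 3" and ?p = "vel x t0 $ 3"
  have sq: "?p\<^sup>2 = 2 * \<Omega> / R\<^sup>2 * ((?y - e1) * (?y - e2) * (?y - e3))"
    using solution_latitude_square[OF xs x(2) a pos(2) t0(1)] by (simp only: P_factor)
  have "?y < e3"
    using x(1) t0(1) assms(4) by (force simp: nonpolar_solution_def)
  have "?p\<^sup>2 > 0"
    using t0 by simp
  then have "0 < 2 * \<Omega> / R\<^sup>2 * ((?y - e1) * (?y - e2) * (?y - e3))"
    by (simp only: sq)
  then have "0 < (?y - e1) * (?y - e2) * (?y - e3)"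
    by (rule zero_less_mult_pos) (use pos in simp)
  then have "(?y - e1) * (?y - e2) < 0"
    using \<open>?y < e3\<close> zero_less_mult_iff[of "(?y - e1) * (?y - e2)" "?y - e3"] by simp
  then have "e1 < ?y" "?y < e2"
    using e by (auto simp: mult_less_0_iff)
  then obtain \<xi> where "lat \<xi> t0 = ?y" "lat1 \<xi> t0 = ?p"
    using lat_match[OF _ _ t0(2) sq] by metis
  then show thesis
    using that t0(1) by metis
qed

text \<open>If \<open>\<sigma>R\<close> is a simple root next to the oscillation interval, then \<open>w\<close> changes sign where the
  curve crosses the pole, in contrast to \<open>sqrt (R - \<sigma> * u)\<close>, and keeps the curve smooth there.\<close>

lemma polar_continuation:
  assumes x: "nonpolar_solution a \<Omega> R I x" "conserved a \<Omega> I x C E" and "\<not> constant_latitude I x"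
    and "R \<le> e3" and \<sigma>: "\<sigma>\<^sup>2 = 1" and C: "C = \<sigma> * a * R"
    and w: "\<And>\<xi> t. (w \<xi> has_real_derivative w1 \<xi> t) (at t)" "\<And>\<xi> t. (w1 \<xi> has_real_derivative w2 \<xi> t) (at t)"
      "\<And>\<xi>. continuous_on UNIV (w2 \<xi>)"
    and w_sq: "\<And>\<xi> t. (w \<xi> t)\<^sup>2 = R - \<sigma> * lat \<xi> t" and sp: "\<And>\<xi> t. R + \<sigma> * lat \<xi> t > 0"
    and simple: "\<And>\<xi> t. w \<xi> t = 0 \<Longrightarrow> w1 \<xi> t \<noteq> 0"
    and zero: "\<And>\<xi>. \<exists>t. w \<xi> t = 0"
  shows "\<not> never_polar_solution a \<Omega> R I x"
proof
  assume np: "never_polar_solution a \<Omega> R I x"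
  obtain t0 \<xi> where t0: "t0 \<in> I" "x t0 $ 3 = lat \<xi> t0" "vel x t0 $ 3 = lat1 \<xi> t0"
    using initial_latitude_match[OF x assms(3,4)] .
  \<comment> \<open>The continuation only has to exist, so its azimuth is taken as a primitive
    instead of a closed form.\<close>
  define \<phi> where "\<phi> = (\<lambda>u. LBINT y=ereal 0..ereal u. \<sigma> * a / (R + \<sigma> * lat \<xi> y))"
  have "continuous_on UNIV (lat \<xi>)"
    by (meson DERIV_lat DERIV_isCont continuous_at_imp_continuous_on)
  moreover have "R + \<sigma> * lat \<xi> t \<noteq> 0" for t
    using sp[of \<xi> t] by simp
  ultimately have "continuous_on UNIV (\<lambda>t. \<sigma> * a / (R + \<sigma> * lat \<xi> t))"
    by (intro continuous_intros) auto
  from DERIV_interval_integral[OF this]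
  have d\<phi>: "((\<lambda>t. \<phi>\<^sub>0 + \<phi> t) has_real_derivative \<sigma> * a / (R + \<sigma> * lat \<xi> t)) (at t)" for \<phi>\<^sub>0 t
    unfolding \<phi>_def by (auto intro!: derivative_eq_intros)
  note sol = polar_profile_solution[OF DERIV_lat DERIV_lat1 w(1,2) d\<phi> continuous_lat2 w(3) pos(2) \<sigma> C
      w_sq sp lat_cubic simple]
  let ?r = "\<lambda>t. w \<xi> t * sqrt (R + \<sigma> * lat \<xi> t)"
  obtain \<phi>\<^sub>0 where eq: "\<forall>t\<in>I. x t = rot_curve ?r (\<lambda>t. \<phi>\<^sub>0 + \<phi> t) (lat \<xi>) t"
    using rot_curve_match[OF x a pos(2) sol t0] by blast
  obtain t where t: "w \<xi> t = 0"
    using zero by blast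
  \<comment> \<open>The explicit curve continues \<open>x\<close> to all times. Since no
    continuation of \<open>x\<close> may touch a pole, its latitude stays inside the open interval
    even at the zero of \<open>w\<close>, where it equals \<open>\<sigma> * R\<close>.\<close>
  have "nonpolar_solution a \<Omega> R UNIV (rot_curve ?r (\<lambda>t. \<phi>\<^sub>0 + \<phi> t) (lat \<xi>))"
    using np eq sol(1) unfolding never_polar_solution_def by simp
  then have "\<bar>lat \<xi> t\<bar> < R"
    by (simp add: nonpolar_solution_def)
  moreover have "\<bar>\<sigma>\<bar> = 1"
    using \<sigma> by (simp add: abs_square_eq_1)
  moreover have "\<sigma> * lat \<xi> t = R"
    using w_sq[of \<xi> t] t by simp
  ultimately show False
    using pos(2) by (metis abs_mult abs_of_pos less_irrefl mult_1)
qed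

text \<open>For \<open>e1 = - R\<close> the distance \<open>R + u\<close> is
  \<open>(e2 - e1)\<close> times the square of sn, so sn itself is the signed root. The pole is met
  at time \<open>\<xi>\<close>, where the derivative of sn is nonzero.\<close>

lemma not_never_polar_south:
  assumes x: "nonpolar_solution a \<Omega> R I x" "conserved a \<Omega> I x C E" and "\<not> constant_latitude I x"
    and "R < e3" "e1 = - R" "e2 < R" and C: "C = - a * R"
  shows "\<not> never_polar_solution a \<Omega> R I x"
proof (rule polar_continuation[OF x assms(3), where \<sigma> = "-1"
      and w = "\<lambda>\<xi> t. sqrt (e2 - e1) * S \<xi> t"
      and ?w1.0 = "\<lambda>\<xi> t. sqrt (e2 - e1) * (\<omega> * (N \<xi> t * D \<xi> t))"
      and ?w2.0 = "\<lambda>\<xi> t. sqrt (e2 - e1) * (\<omega> * (- \<omega> * (S \<xi> t * D \<xi> t) * D \<xi> t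
        + N \<xi> t * (- \<omega> * (k * S \<xi> t * N \<xi> t))))"])
  fix \<xi> t
  show "((\<lambda>t. sqrt (e2 - e1) * S \<xi> t) has_real_derivative sqrt (e2 - e1) * (\<omega> * (N \<xi> t * D \<xi> t))) (at t)"
    by (rule derivative_eq_intros DERIV_S refl)+ simp
  show "((\<lambda>t. sqrt (e2 - e1) * (\<omega> * (N \<xi> t * D \<xi> t))) has_real_derivative sqrt (e2 - e1)
      * (\<omega> * (- \<omega> * (S \<xi> t * D \<xi> t) * D \<xi> t + N \<xi> t * (- \<omega> * (k * S \<xi> t * N \<xi> t))))) (at t)"
    by (rule derivative_eq_intros DERIV_N DERIV_D refl)+ (simp add: algebra_simps)
  show "continuous_on UNIV (\<lambda>t. sqrt (e2 - e1) * (\<omega> * (- \<omega> * (S \<xi> t * D \<xi> t) * D \<xi> t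
        + N \<xi> t * (- \<omega> * (k * S \<xi> t * N \<xi> t)))))"
    by (intro continuous_intros continuous_at_imp_continuous_on ballI DERIV_isCont[OF DERIV_S]
        DERIV_isCont[OF DERIV_N] DERIV_isCont[OF DERIV_D])
  show "(sqrt (e2 - e1) * S \<xi> t)\<^sup>2 = R - (- 1) * lat \<xi> t"
    using lat_minus_roots(1)[of \<xi> t] e assms(5) by (simp add: power_mult_distrib)
  show "R + (- 1) * lat \<xi> t > 0"
    using lat_bounds(2)[of \<xi> t] assms(6) by simp
  show "sqrt (e2 - e1) * (\<omega> * (N \<xi> t * D \<xi> t)) \<noteq> 0" if "sqrt (e2 - e1) * S \<xi> t = 0"
  proof -
    have "S \<xi> t = 0"
      using that e by simp
    then have "(N \<xi> t)\<^sup>2 = 1"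
      by (simp add: jacobi_cn_square[OF elliptic_modulus])
    then show ?thesis
      using e elliptic_frequency(1) jacobi_dn_pos[OF elliptic_modulus, of "\<omega> * (t - \<xi>)"] by auto
  qed
  have "S \<xi> \<xi> = 0"
    by (simp add: jacobi_sn_def jacobi_am_0[OF elliptic_modulus])
  then show "\<exists>t. sqrt (e2 - e1) * S \<xi> t = 0"
    by (metis mult_zero_right)
qed (use assms in auto)

text \<open>For \<open>e2 = R\<close> the distance \<open>R - u\<close> is \<open>(e2 - e1)\<close>
  times the square of cn, so cn is the signed root. It vanishes a quarter period of sn after
  \<open>\<xi>\<close>, with nonzero derivative because dn is positive.\<close>

lemma not_never_polar_north:
  assumes x: "nonpolar_solution a \<Omega> R I x" "conserved a \<Omega> I x C E" and "\<not> constant_latitude I x"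
    and "- R < e1" "e2 = R" and C: "C = a * R"
  shows "\<not> never_polar_solution a \<Omega> R I x"
proof (rule polar_continuation[OF x assms(3), where \<sigma> = 1
      and w = "\<lambda>\<xi> t. sqrt (e2 - e1) * N \<xi> t"
      and ?w1.0 = "\<lambda>\<xi> t. sqrt (e2 - e1) * (- \<omega> * (S \<xi> t * D \<xi> t))"
      and ?w2.0 = "\<lambda>\<xi> t. sqrt (e2 - e1) * (- \<omega> * (\<omega> * (N \<xi> t * D \<xi> t) * D \<xi> t
        + S \<xi> t * (- \<omega> * (k * S \<xi> t * N \<xi> t))))"])
  fix \<xi> t
  show "((\<lambda>t. sqrt (e2 - e1) * N \<xi> t) has_real_derivative sqrt (e2 - e1) * (- \<omega> * (S \<xi> t * D \<xi> t))) (at t)"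
    by (rule derivative_eq_intros DERIV_N refl)+ simp
  show "((\<lambda>t. sqrt (e2 - e1) * (- \<omega> * (S \<xi> t * D \<xi> t))) has_real_derivative sqrt (e2 - e1)
      * (- \<omega> * (\<omega> * (N \<xi> t * D \<xi> t) * D \<xi> t + S \<xi> t * (- \<omega> * (k * S \<xi> t * N \<xi> t))))) (at t)"
    by (rule derivative_eq_intros DERIV_S DERIV_D refl)+ (simp add: algebra_simps)
  show "continuous_on UNIV (\<lambda>t. sqrt (e2 - e1) * (- \<omega> * (\<omega> * (N \<xi> t * D \<xi> t) * D \<xi> t
        + S \<xi> t * (- \<omega> * (k * S \<xi> t * N \<xi> t)))))"
    by (intro continuous_intros continuous_at_imp_continuous_on ballI DERIV_isCont[OF DERIV_S]
        DERIV_isCont[OF DERIV_N] DERIV_isCont[OF DERIV_D])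
  have "(sqrt (e2 - e1) * N \<xi> t)\<^sup>2 = e2 - lat \<xi> t"
    using lat_minus_roots(2)[of \<xi> t] e by (simp add: power_mult_distrib left_diff_distrib)
  then show "(sqrt (e2 - e1) * N \<xi> t)\<^sup>2 = R - 1 * lat \<xi> t"
    by (simp add: assms(5))
  show "R + 1 * lat \<xi> t > 0"
    using lat_bounds(1)[of \<xi> t] assms(4) by simp
  show "sqrt (e2 - e1) * (- \<omega> * (S \<xi> t * D \<xi> t)) \<noteq> 0" if "sqrt (e2 - e1) * N \<xi> t = 0"
  proof -
    have "N \<xi> t = 0"
      using that e by simp
    then have "(S \<xi> t)\<^sup>2 = 1"
      using jacobi_cn_square[OF elliptic_modulus, of "\<omega> * (t - \<xi>)"] by simp
    then show ?thesis
      using e elliptic_frequency(1) jacobi_dn_pos[OF elliptic_modulus, of "\<omega> * (t - \<xi>)"] by auto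
  qed
  have "N \<xi> (\<xi> + ellip_K k / \<omega>) = 0"
    using elliptic_frequency(1) by (simp add: jacobi_cn_def ellip_K_def jacobi_am_ellip_F[OF elliptic_modulus])
  then show "\<exists>t. sqrt (e2 - e1) * N \<xi> t = 0"
    by (metis mult_zero_right)
qed (use assms e in auto)

end

section \<open>Periodic latitude\<close>

locale elliptic_nonpolar = elliptic_profile +
  assumes e1: "- R < e1" and e2: "e2 < R"
begin

text \<open>If all three roots were below \<open>R\<close>, the cubic would be positive at the north
  pole, against \<open>cubic_poles_nonpos\<close>.\<close>

lemma third_root_ge: "R \<le> e3"
proof (rule ccontr)
  assume "\<not> R \<le> e3"
  then have "0 < (R - e1) * (R - e2) * (R - e3)"
    using e e2 by simp
  then have "0 < poly P R"
    unfolding P_factor using pos by simp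
  then have "0 < R\<^sup>2 * poly P R"
    using pos by simp
  then show False
    unfolding cubic_poles_nonpos[OF a pos(2)] by (smt (verit) zero_le_power2)
qed

definition "n1 = (e2 - e1) / (R - e1)"
definition "n2 = - ((e2 - e1) / (R + e1))"
definition "A1 = (C - a * R) / (2 * R * (R - e1) * \<omega>)"
definition "A2 = (C + a * R) / (2 * R * (R + e1) * \<omega>)"
definition "phase \<xi> t = A1 * ellip_Pi_inc (\<omega> * (t - \<xi>)) n1 k + A2 * ellip_Pi_inc (\<omega> * (t - \<xi>)) n2 k"
definition "height \<xi> t = 1 / R * (e1 + (e2 - e1) * (S \<xi> t)\<^sup>2)"
definition "X \<xi> \<phi>\<^sub>0 = sphere_curve R (height \<xi>) (\<lambda>t. \<phi>\<^sub>0 + phase \<xi> t)"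
definition "T = 2 * ellip_K k / \<omega>"
text \<open>The azimuth gained during one period \<open>T\<close> of the latitude; divided by
  \<open>2 * pi\<close> it is the rotation number.\<close>

definition "\<Delta> = 2 * A1 * ellip_Pi n1 k + 2 * A2 * ellip_Pi n2 k"

lemma lat_eq_height: "lat \<xi> t = R * height \<xi> t"
  using pos by (simp add: lat_def height_def)

lemma lat_nonpolar: "\<bar>lat \<xi> t\<bar> < R"
  using lat_bounds[of \<xi> t] e1 e2 by linarith

lemma height_bound: "\<bar>height \<xi> t\<bar> < 1"
  using lat_nonpolar[of \<xi> t] pos by (simp add: lat_eq_height abs_mult)

lemma characteristic_lt_1: "n1 < 1" "n2 < 1"
  using e e1 e2 by (auto simp: n1_def n2_def intro: less_trans[of _ 0])

text \<open>The denominators of the two integrands are \<open>(R - u) / (R - e1)\<close> and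
  \<open>(R + u) / (R + e1)\<close>, so \<open>A1\<close> and \<open>A2\<close> are the coefficients
  that produce the partial fractions of
  \<open>(C - a * u) / (R\<^sup>2 - u\<^sup>2)\<close>.\<close>

lemma DERIV_phase: "((\<lambda>t. \<phi>\<^sub>0 + phase \<xi> t) has_real_derivative (C - a * lat \<xi> t) / (R\<^sup>2 - (lat \<xi> t)\<^sup>2)) (at t)"
proof -
  let ?u = "lat \<xi> t"
  have u: "R - ?u > 0" "R + ?u > 0"
    using lat_nonpolar[of \<xi> t] by auto
  have r: "R - e1 > 0" "R + e1 > 0"
    using e e1 e2 by auto
  have d: "((\<lambda>t. \<omega> * (t - \<xi>)) has_real_derivative \<omega>) (at t)"
    by (rule derivative_eq_intros refl)+ simp
  note \<Pi> = DERIV_chain2[OF DERIV_ellip_Pi_inc[OF elliptic_modulus characteristic_lt_1(1)] d]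
    DERIV_chain2[OF DERIV_ellip_Pi_inc[OF elliptic_modulus characteristic_lt_1(2)] d]
  have "((\<lambda>t. \<phi>\<^sub>0 + phase \<xi> t) has_real_derivative
      A1 * (1 / (1 - n1 * (S \<xi> t)\<^sup>2) * \<omega>) + A2 * (1 / (1 - n2 * (S \<xi> t)\<^sup>2) * \<omega>)) (at t)"
    unfolding phase_def by (rule derivative_eq_intros \<Pi> refl)+ (simp add: mult.commute)
  moreover have "1 - n1 * (S \<xi> t)\<^sup>2 = (R - ?u) / (R - e1)" "1 - n2 * (S \<xi> t)\<^sup>2 = (R + ?u) / (R + e1)"
    using r by (simp_all add: n1_def n2_def lat_def field_simps)
  moreover have "A1 * (1 / ((R - ?u) / (R - e1)) * \<omega>) + A2 * (1 / ((R + ?u) / (R + e1)) * \<omega>)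
      = (C - a * R) / (2 * R * (R - ?u)) + (C + a * R) / (2 * R * (R + ?u))"
    using r elliptic_frequency(1) by (simp add: A1_def A2_def)
  moreover have "\<dots> = (C - a * ?u) / (R\<^sup>2 - ?u\<^sup>2)"
  proof -
    have D: "R\<^sup>2 - ?u\<^sup>2 = (R - ?u) * (R + ?u)"
      by (simp add: algebra_simps power2_eq_square)
    have "(C - a * R) / (2 * R * (R - ?u)) + (C + a * R) / (2 * R * (R + ?u))
        = ((C - a * R) * (R + ?u) + (C + a * R) * (R - ?u)) / (2 * R * ((R - ?u) * (R + ?u)))"
    proof -
      have "A / (c * x) + B / (c * y) = (A * y + B * x) / (c * (x * y))"
        if "c \<noteq> 0" "x \<noteq> 0" "y \<noteq> 0" for A B c x y :: real
        using that by (simp add: field_simps)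
      then show ?thesis
        using u pos by simp
    qed
    also have "(C - a * R) * (R + ?u) + (C + a * R) * (R - ?u) = 2 * R * (C - a * ?u)"
      by (simp add: algebra_simps)
    finally show ?thesis
      unfolding D using pos by simp
  qed
  ultimately show ?thesis
    by simp
qed

lemmas X_solution = sphere_profile_solution[OF DERIV_lat DERIV_lat1 DERIV_phase continuous_lat2 pos(2)
    lat_nonpolar lat_cubic lat_eq_height, folded X_def]

lemma solution_eq_X:
  assumes x: "nonpolar_solution a \<Omega> R I x" "conserved a \<Omega> I x C E" and "\<not> constant_latitude I x"
  shows "\<exists>\<xi>\<^sub>0 \<phi>\<^sub>0. \<forall>t\<in>I. x t = X \<xi>\<^sub>0 \<phi>\<^sub>0 t"
proof -
  obtain t0 \<xi> where t0: "t0 \<in> I" "x t0 $ 3 = lat \<xi> t0" "vel x t0 $ 3 = lat1 \<xi> t0"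
    using initial_latitude_match[OF x assms(3) third_root_ge] .
  have X: "X \<xi> = (\<lambda>\<phi>\<^sub>0. rot_curve (\<lambda>t. R * sqrt (1 - (height \<xi> t)\<^sup>2)) (\<lambda>t. \<phi>\<^sub>0 + phase \<xi> t) (\<lambda>t. R * height \<xi> t))"
    by (simp add: X_def fun_eq_iff sphere_curve_eq_rot_curve)
  note sol = X_solution[of \<xi>, unfolded X]
  have "\<exists>\<phi>\<^sub>0. \<forall>t\<in>I. x t = X \<xi> \<phi>\<^sub>0 t"
    unfolding X by (rule rot_curve_match[OF x a pos(2) sol t0(1) _ t0(3)]) (simp add: t0(2) lat_eq_height)
  then show ?thesis
    by blast
qed

section \<open>Periods of the latitude and of the whole curve\<close>

lemma T_pos: "T > 0"
  using elliptic_frequency(1) ellip_K_pos[OF elliptic_modulus] by (simp add: T_def)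

lemma arg_plus_T: "\<omega> * (t + T - \<xi>) = \<omega> * (t - \<xi>) + 2 * ellip_K k"
  using elliptic_frequency(1) by (simp add: T_def algebra_simps)

lemma height_plus_T: "height \<xi> (t + T) = height \<xi> t"
  by (simp add: height_def arg_plus_T jacobi_sn_square_period[OF elliptic_modulus])

lemma phase_plus_T: "phase \<xi> (t + T) = phase \<xi> t + \<Delta>"
  unfolding phase_def arg_plus_T \<Delta>_def
    ellip_Pi_inc_plus_period[OF elliptic_modulus characteristic_lt_1(1)]
    ellip_Pi_inc_plus_period[OF elliptic_modulus characteristic_lt_1(2)]
  by (simp add: algebra_simps)

lemma plus_multiple_T:
  "height \<xi> (t + real n * T) = height \<xi> t" "phase \<xi> (t + real n * T) = phase \<xi> t + real n * \<Delta>"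
proof (induction n)
  case (Suc n)
  have "t + real (Suc n) * T = (t + real n * T) + T"
    by (simp add: algebra_simps)
  then show "height \<xi> (t + real (Suc n) * T) = height \<xi> t"
    "phase \<xi> (t + real (Suc n) * T) = phase \<xi> t + real (Suc n) * \<Delta>"
    using Suc by (simp_all only: height_plus_T phase_plus_T) (simp add: algebra_simps)
qed simp_all

text \<open>At \<open>\<xi>\<close> the height has its minimum, where sn vanishes. A period carries
  this point to another zero of sn, and those zeros are spaced by \<open>T\<close>.\<close>

lemma height_period_cases:
  assumes "\<And>t. height \<xi> (t + s) = height \<xi> t" "s > 0"
  obtains n :: nat where "n \<ge> 1" "s = real n * T"
proof -
  have "(S \<xi> (\<xi> + s))\<^sup>2 = (S \<xi> \<xi>)\<^sup>2"
    using assms(1)[of \<xi>] e pos by (simp add: height_def)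
  then have "jacobi_sn (\<omega> * s) k = 0"
    by (simp add: jacobi_sn_def jacobi_am_0[OF elliptic_modulus])
  then obtain n :: int where n: "\<omega> * s = 2 * ellip_K k * of_int n"
    using jacobi_sn_eq_0_iff[OF elliptic_modulus] by blast
  then have s: "s = of_int n * T"
    using elliptic_frequency(1) by (simp add: T_def field_simps)
  then have "n > 0"
    using assms(2) T_pos by (simp add: zero_less_mult_iff)
  then show thesis
    using s by (intro that[of "nat n"]) simp_all
qed

lemma X_nth_3: "X \<xi> \<phi>\<^sub>0 t $ 3 = R * height \<xi> t"
  by (simp add: X_def sphere_curve_eq_rot_curve)

lemma X_eq_iff:
  assumes "height \<xi> s = height \<xi> t"
  shows "X \<xi> \<phi>\<^sub>0 s = X \<xi> \<phi>\<^sub>0 t \<longleftrightarrow> (\<exists>m :: int. phase \<xi> s = phase \<xi> t + 2 * pi * of_int m)"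
proof -
  have "(height \<xi> t)\<^sup>2 < 1"
    using height_bound[of \<xi> t] by (simp add: abs_square_less_1)
  then have "R * sqrt (1 - (height \<xi> t)\<^sup>2) \<noteq> 0"
    using pos by simp
  then have "X \<xi> \<phi>\<^sub>0 s = X \<xi> \<phi>\<^sub>0 t \<longleftrightarrow>
      sin (\<phi>\<^sub>0 + phase \<xi> s) = sin (\<phi>\<^sub>0 + phase \<xi> t) \<and> cos (\<phi>\<^sub>0 + phase \<xi> s) = cos (\<phi>\<^sub>0 + phase \<xi> t)"
    using assms by (auto simp: X_def sphere_curve_eq_rot_curve vec_eq_iff forall_3)
  also have "\<dots> \<longleftrightarrow> (\<exists>m :: int. phase \<xi> s = phase \<xi> t + 2 * pi * of_int m)"
    unfolding sin_cos_eq_iff by (auto simp: algebra_simps)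
  finally show ?thesis .
qed

text \<open>The third component forces a period to be a multiple of \<open>T\<close>. Over
  \<open>n\<close> such periods the azimuth gains \<open>n * \<Delta>\<close>, and off the poles the
  curve returns exactly when this is a multiple of \<open>2 * pi\<close>.\<close>

lemma X_period_iff:
  assumes "s > 0"
  shows "periodic_fun_simple (X \<xi> \<phi>\<^sub>0) s \<longleftrightarrow>
    (\<exists>(n :: nat) (m :: int). n \<ge> 1 \<and> s = real n * T \<and> real n * \<Delta> = 2 * pi * of_int m)"
proof
  assume "periodic_fun_simple (X \<xi> \<phi>\<^sub>0) s"
  then have per: "X \<xi> \<phi>\<^sub>0 (t + s) = X \<xi> \<phi>\<^sub>0 t" for t
    by (rule periodic_fun_simple.plus_period)
  have h: "height \<xi> (t + s) = height \<xi> t" for t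
    using arg_cong[OF per[of t], of "\<lambda>v. v $ 3"] pos by (simp add: X_nth_3)
  obtain n where n: "n \<ge> 1" "s = real n * T"
    using height_period_cases[OF h assms] .
  obtain m :: int where "phase \<xi> (0 + s) = phase \<xi> 0 + 2 * pi * of_int m"
    using per[of 0] X_eq_iff[OF h[of 0]] by blast
  then show "\<exists>(n :: nat) (m :: int). n \<ge> 1 \<and> s = real n * T \<and> real n * \<Delta> = 2 * pi * of_int m"
    using n plus_multiple_T(2)[of \<xi> 0 n] by (intro exI[of _ n] exI[of _ m]) simp
next
  assume "\<exists>(n :: nat) (m :: int). n \<ge> 1 \<and> s = real n * T \<and> real n * \<Delta> = 2 * pi * of_int m"
  then obtain n :: nat and m :: int where n: "s = real n * T" "real n * \<Delta> = 2 * pi * of_int m"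
    by blast
  show "periodic_fun_simple (X \<xi> \<phi>\<^sub>0) s"
  proof
    fix t
    show "X \<xi> \<phi>\<^sub>0 (t + s) = X \<xi> \<phi>\<^sub>0 t"
      unfolding X_eq_iff[OF plus_multiple_T(1)[of \<xi> t n, folded n(1)]]
      using plus_multiple_T(2)[of \<xi> t n] n by auto
  qed
qed

lemma height_minimal_period: "minimal_period (height \<xi>) T"
  unfolding minimal_period_def
proof (intro conjI allI impI)
  show "periodic_fun_simple (height \<xi>) T"
    by standard (rule height_plus_T)
  fix s assume s: "0 < s \<and> s < T"
  show "\<not> periodic_fun_simple (height \<xi>) s"
  proof
    assume "periodic_fun_simple (height \<xi>) s"
    then have "height \<xi> (t + s) = height \<xi> t" for t
      by (rule periodic_fun_simple.plus_period)
    then obtain n :: nat where "n \<ge> 1" "s = real n * T"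
      using height_period_cases s by blast
    then show False
      using s T_pos by simp
  qed
qed (rule T_pos)

lemma periodic_fun_simple_nth_3: "periodic_fun_simple (\<lambda>t. X \<xi> \<phi>\<^sub>0 t $ 3) s \<longleftrightarrow> periodic_fun_simple (height \<xi>) s"
  using pos by (simp add: periodic_fun_simple_def X_nth_3)

lemma minimal_period_nth_3: "minimal_period (\<lambda>t. X \<xi> \<phi>\<^sub>0 t $ 3) T"
  using height_minimal_period[of \<xi>] by (simp add: minimal_period_def periodic_fun_simple_nth_3)

definition "closing p q \<longleftrightarrow> q \<ge> 1 \<and> gcd p q = 1 \<and> \<Delta> = 2 * pi * (of_int p / of_int q)" for p q :: int

text \<open>The closing condition of the theorem is the condition on \<open>\<Delta>\<close>
  multiplied by \<open>\<omega>\<close>, which cancels the frequency in the denominators of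
  \<open>A1\<close> and \<open>A2\<close>.\<close>

lemma closing_iff:
  "closing p q \<longleftrightarrow> q \<ge> 1 \<and> gcd p q = 1 \<and>
     (C - a * R) / (R * (R - e1)) * ellip_Pi n1 k + (C + a * R) / (R * (R + e1)) * ellip_Pi n2 k
       = 2 * pi * \<omega> * (of_int p / of_int q)"
proof -
  have w: "\<omega> \<noteq> 0"
    using elliptic_frequency(1) by simp
  have "2 * (x / (2 * R * y * \<omega>)) * \<omega> = x / (R * y)" for x y
    using w by simp
  then have "(C - a * R) / (R * (R - e1)) = 2 * A1 * \<omega>" "(C + a * R) / (R * (R + e1)) = 2 * A2 * \<omega>"
    by (simp_all only: A1_def A2_def)
  then have "(C - a * R) / (R * (R - e1)) * ellip_Pi n1 k + (C + a * R) / (R * (R + e1)) * ellip_Pi n2 k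
      = \<omega> * \<Delta>"
    by (simp add: \<Delta>_def algebra_simps)
  moreover have "2 * pi * \<omega> * (of_int p / of_int q) = \<omega> * (2 * pi * (of_int p / of_int q))"
    by (simp only: ac_simps)
  ultimately show ?thesis
    using w by (simp only: closing_def mult_cancel_left simp_thms)
qed

lemma closing_exists_iff: "(\<exists>p q. closing p q) \<longleftrightarrow> \<Delta> / (2 * pi) \<in> \<rat>"
proof
  assume "\<exists>p q. closing p q"
  then obtain p q where "\<Delta> = 2 * pi * (of_int p / of_int q)"
    by (auto simp: closing_def)
  then have "\<Delta> / (2 * pi) = of_int p / of_int q"
    by simp
  then show "\<Delta> / (2 * pi) \<in> \<rat>"
    by simp
next
  assume "\<Delta> / (2 * pi) \<in> \<rat>"
  then obtain p q :: int where "q > 0" "coprime p q" "\<Delta> / (2 * pi) = of_int p / of_int q"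
    by (rule Rats_cases')
  then have "closing p q"
    by (simp add: closing_def coprime_iff_gcd_eq_1 field_simps)
  then show "\<exists>p q. closing p q"
    by blast
qed

text \<open>A period \<open>n * T\<close> requires \<open>n * p = m * q\<close> for some integer
  \<open>m\<close>; since \<open>p\<close> and \<open>q\<close> are coprime, \<open>q\<close>
  divides \<open>n\<close>.\<close>

lemma closing_minimal_period:
  assumes "closing p q"
  shows "minimal_period (X \<xi> \<phi>\<^sub>0) (of_int q * T)"
proof -
  have q: "q \<ge> 1" and co: "coprime q p" and \<Delta>: "\<Delta> = 2 * pi * (of_int p / of_int q)"
    using assms by (auto simp: closing_def coprime_iff_gcd_eq_1 gcd.commute)
  have qT: "of_int q * T > 0"
    using q T_pos by simp
  have "periodic_fun_simple (X \<xi> \<phi>\<^sub>0) (of_int q * T)"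
    unfolding X_period_iff[OF qT] using q \<Delta> by (intro exI[of _ "nat q"] exI[of _ p]) simp
  moreover have "\<not> periodic_fun_simple (X \<xi> \<phi>\<^sub>0) s" if s: "0 < s" "s < of_int q * T" for s
  proof
    assume "periodic_fun_simple (X \<xi> \<phi>\<^sub>0) s"
    then obtain n :: nat and m :: int where n: "n \<ge> 1" "s = real n * T" "real n * \<Delta> = 2 * pi * of_int m"
      using X_period_iff[OF s(1)] by blast
    have "real n * of_int p = of_int m * of_int q"
      using n(3) q by (simp add: \<Delta> field_simps)
    then have "int n * p = m * q"
      by (metis of_int_eq_iff of_int_mult of_int_of_nat_eq)
    then have "q dvd int n * p"
      by simp
    then have "q dvd int n"
      using co by (simp add: coprime_dvd_mult_left_iff)
    then have "q \<le> int n"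
      using n(1) by (intro zdvd_imp_le) simp_all
    then have "of_int q * T \<le> real n * T"
      using T_pos by (metis mult_right_mono less_imp_le of_int_le_iff of_int_of_nat_eq)
    then show False
      using s n(2) by simp
  qed
  ultimately show ?thesis
    using qT by (simp add: minimal_period_def)
qed

lemma periodic_iff_closing: "periodic (X \<xi> \<phi>\<^sub>0) \<longleftrightarrow> (\<exists>p q. closing p q)"
proof
  assume "periodic (X \<xi> \<phi>\<^sub>0)"
  then obtain n :: nat and m :: int where n: "n \<ge> 1" "real n * \<Delta> = 2 * pi * of_int m"
    unfolding periodic_def using X_period_iff by blast
  then have "\<Delta> / (2 * pi) = of_int m / real n"
    by (simp add: field_simps)
  then have "\<Delta> / (2 * pi) \<in> \<rat>"
    by simp
  then show "\<exists>p q. closing p q"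
    unfolding closing_exists_iff .
next
  assume "\<exists>p q. closing p q"
  then show "periodic (X \<xi> \<phi>\<^sub>0)"
    using closing_minimal_period unfolding minimal_period_def periodic_def by blast
qed

end

section \<open>Solitons\<close>

lemma tanh_artanh_real:
  fixes x :: real
  assumes "- 1 < x" "x < 1"
  shows "tanh (artanh x) = x"
proof -
  have q: "(1 + x) / (1 - x) > 0"
    using assms by simp
  have "exp (- 2 * artanh x) = inverse (exp (ln ((1 + x) / (1 - x))))"
    by (simp add: artanh_def exp_minus)
  also have "\<dots> = (1 - x) / (1 + x)"
    using q by simp
  finally have e: "exp (- 2 * artanh x) = (1 - x) / (1 + x)" .
  have "1 - (1 - x) / (1 + x) = 2 * x / (1 + x)" "1 + (1 - x) / (1 + x) = 2 / (1 + x)"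
    using assms by (simp_all add: field_simps)
  then show ?thesis
    unfolding tanh_real_altdef e using assms by simp
qed

text \<open>The degenerate case \<open>e2 = e3 = R\<close> of the elliptic oscillation: the
  parameter \<open>k\<close> becomes 1, sn becomes tanh, and the period becomes infinite. The
  elliptic locale requires \<open>e2 < e3\<close>, so this case is treated separately.\<close>

locale soliton_profile =
  fixes a \<Omega> R C E e1 \<omega> \<delta> :: real
  assumes pos: "a > 0" "\<Omega> > 0" "R > 0" and e1: "- R < e1" "e1 < R"
    and P_factor: "\<And>s. poly (cubic a \<Omega> R C E) s = 2 * \<Omega> / R\<^sup>2 * ((s - e1) * (s - R) * (s - R))"
    and C: "C = a * R"
    and \<omega>: "\<omega> = sqrt (\<Omega> / (2 * R\<^sup>2) * (R - e1))" and \<delta>: "\<delta> = sqrt ((R - e1) / (R + e1))"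
begin

abbreviation "P \<equiv> cubic a \<Omega> R C E"
abbreviation "H \<xi> t \<equiv> tanh (\<omega> * (t - \<xi>))"

definition "lat \<xi> t = e1 + (R - e1) * (H \<xi> t)\<^sup>2"
definition "lat1 \<xi> t = 2 * (R - e1) * \<omega> * (H \<xi> t * (1 - (H \<xi> t)\<^sup>2))"
definition "lat2 \<xi> t = 2 * (R - e1) * \<omega>\<^sup>2 * ((1 - (H \<xi> t)\<^sup>2)\<^sup>2 - 2 * (H \<xi> t)\<^sup>2 * (1 - (H \<xi> t)\<^sup>2))"
definition "height \<xi> t = 1 / R * (e1 + (R - e1) * (H \<xi> t)\<^sup>2)"
definition "phase \<xi> t = a / (2 * R) * (t - \<xi> + \<delta> / \<omega> * arctan (\<delta> * H \<xi> t))"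
definition "X \<xi> \<phi>\<^sub>0 = sphere_curve R (height \<xi>) (\<lambda>t. \<phi>\<^sub>0 + phase \<xi> t)"

lemma frequency: "\<omega> > 0" "\<omega>\<^sup>2 = \<Omega> / R\<^sup>2 / 2 * (R - e1)"
  using pos e1 by (simp_all add: \<omega>)

lemma \<delta>_props: "\<delta> > 0" "\<delta>\<^sup>2 = (R - e1) / (R + e1)"
  using e1 by (simp_all add: \<delta>)

lemma DERIV_H: "((\<lambda>t. H \<xi> t) has_real_derivative \<omega> * (1 - (H \<xi> t)\<^sup>2)) (at t)"
  by (rule derivative_eq_intros refl | simp)+

lemma DERIV_lat: "(lat \<xi> has_real_derivative lat1 \<xi> t) (at t)"
  unfolding lat_def[abs_def] lat1_def
  by (rule derivative_eq_intros DERIV_H refl)+ simp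

lemma DERIV_lat1: "(lat1 \<xi> has_real_derivative lat2 \<xi> t) (at t)"
  unfolding lat1_def[abs_def] lat2_def
  by (rule derivative_eq_intros DERIV_H refl)+ (simp add: algebra_simps power2_eq_square)

lemma continuous_lat2: "continuous_on UNIV (lat2 \<xi>)"
  unfolding lat2_def[abs_def]
  by (intro continuous_intros) simp_all

lemma H_square_lt_1: "(H \<xi> t)\<^sup>2 < 1"
proof -
  have "- 1 < H \<xi> t" "H \<xi> t < 1"
    using tanh_real_bounds[of "\<omega> * (t - \<xi>)"] by auto
  then show ?thesis
    unfolding abs_square_less_1 by linarith
qed

lemma lat_minus_roots: "lat \<xi> t - e1 = (R - e1) * (H \<xi> t)\<^sup>2" "lat \<xi> t - R = - (R - e1) * (1 - (H \<xi> t)\<^sup>2)"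
  by (simp_all add: lat_def algebra_simps)

lemma lat_bounds: "e1 \<le> lat \<xi> t" "lat \<xi> t < R"
proof -
  show "e1 \<le> lat \<xi> t"
    using e1 by (simp add: lat_def)
  have "(R - e1) * (1 - (H \<xi> t)\<^sup>2) > 0"
    using e1 H_square_lt_1[of t \<xi>] by simp
  then show "lat \<xi> t < R"
    using lat_minus_roots(2)[of \<xi> t] unfolding mult_minus_left by linarith
qed

lemma lat_nonpolar: "\<bar>lat \<xi> t\<bar> < R"
  using lat_bounds[of \<xi> t] e1 by linarith

lemma lat1_square: "(lat1 \<xi> t)\<^sup>2 = poly P (lat \<xi> t)"
proof -
  have id: "4 * m\<^sup>2 * (c / 2 * m) * (h\<^sup>2 * g\<^sup>2) = 2 * c * (m * h\<^sup>2 * (- m * g) * (- m * g))" for c m h g :: real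
    by (simp add: algebra_simps power2_eq_square)
  have "(lat1 \<xi> t)\<^sup>2 = 4 * (R - e1)\<^sup>2 * \<omega>\<^sup>2 * ((H \<xi> t)\<^sup>2 * (1 - (H \<xi> t)\<^sup>2)\<^sup>2)"
    unfolding lat1_def power_mult_distrib by simp
  also have "\<dots> = 2 * (\<Omega> / R\<^sup>2) * ((lat \<xi> t - e1) * (lat \<xi> t - R) * (lat \<xi> t - R))"
    unfolding lat_minus_roots frequency(2) by (rule id)
  finally show ?thesis
    by (simp add: P_factor)
qed

lemma lat2_eq: "lat2 \<xi> t = poly (pderiv P) (lat \<xi> t) / 2"
proof -
  have id: "2 * m * (c / 2 * m) * (g\<^sup>2 - 2 * h * g)
      = c * ((- m * g) * (- m * g) + m * h * (- m * g) + m * h * (- m * g))" for c m h g :: real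
    by (simp add: algebra_simps power2_eq_square)
  have "lat2 \<xi> t = \<Omega> / R\<^sup>2 * ((lat \<xi> t - R) * (lat \<xi> t - R) + (lat \<xi> t - e1) * (lat \<xi> t - R)
      + (lat \<xi> t - e1) * (lat \<xi> t - R))"
    unfolding lat2_def lat_minus_roots frequency(2) by (rule id)
  then show ?thesis
    by (simp add: pderiv_from_factor[OF P_factor])
qed

lemma lat_cubic:
  "R\<^sup>2 * (lat1 \<xi> t)\<^sup>2 = (R\<^sup>2 - (lat \<xi> t)\<^sup>2) * (2 * (E + \<Omega> * C) / a - 2 * \<Omega> * lat \<xi> t) - (C - a * lat \<xi> t)\<^sup>2"
  "R\<^sup>2 * lat2 \<xi> t = a * (C - a * lat \<xi> t) - lat \<xi> t * (2 * (E + \<Omega> * C) / a - 2 * \<Omega> * lat \<xi> t)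
     - \<Omega> * (R\<^sup>2 - (lat \<xi> t)\<^sup>2)"
  by (simp_all only: lat1_square lat2_eq poly_cubic[OF pos(1,3)] poly_pderiv_cubic[OF pos(1,3)])

lemma lat_eq_height: "lat \<xi> t = R * height \<xi> t"
  using pos by (simp add: lat_def height_def)

text \<open>With \<open>C = a * R\<close> the azimuthal speed is \<open>a / (R + u)\<close>. Writing
  \<open>2 * R / (R + u)\<close> as \<open>1 + (R - u) / (R + u)\<close> separates the linear term
  from the arctan term, whose derivative is the second summand.\<close>

lemma DERIV_phase: "((\<lambda>t. \<phi>\<^sub>0 + phase \<xi> t) has_real_derivative (C - a * lat \<xi> t) / (R\<^sup>2 - (lat \<xi> t)\<^sup>2)) (at t)"
proof -
  let ?h = "(H \<xi> t)\<^sup>2" and ?u = "lat \<xi> t"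
  have r: "R - e1 > 0" "R + e1 > 0" "R - ?u > 0" "R + ?u > 0"
    using e1 lat_nonpolar[of \<xi> t] by auto
  have "((\<lambda>t. \<phi>\<^sub>0 + phase \<xi> t) has_real_derivative
      a / (2 * R) * (1 + \<delta> / \<omega> * (inverse (1 + (\<delta> * H \<xi> t)\<^sup>2) * (\<delta> * (\<omega> * (1 - ?h)))))) (at t)"
    unfolding phase_def by (rule derivative_eq_intros DERIV_chain2[OF DERIV_arctan] DERIV_H refl)+ simp
  moreover have "a / (2 * R) * (1 + \<delta> / \<omega> * (inverse (1 + (\<delta> * H \<xi> t)\<^sup>2) * (\<delta> * (\<omega> * (1 - ?h)))))
      = a / (R + ?u)"
  proof -
    have "1 + (\<delta> * H \<xi> t)\<^sup>2 = (R + ?u) / (R + e1)"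
      using r by (simp add: power_mult_distrib \<delta>_props lat_def field_simps)
    then have "\<delta> / \<omega> * (inverse (1 + (\<delta> * H \<xi> t)\<^sup>2) * (\<delta> * (\<omega> * (1 - ?h))))
        = \<delta>\<^sup>2 * (1 - ?h) * ((R + e1) / (R + ?u))"
      using frequency(1) by (simp add: power2_eq_square)
    also have "\<dots> = (R - ?u) / (R + ?u)"
    proof -
      have "R - ?u = (R - e1) * (1 - ?h)"
        by (simp add: lat_def algebra_simps)
      then show ?thesis
        using r by (simp add: \<delta>_props)
    qed
    also have "a / (2 * R) * (1 + (R - ?u) / (R + ?u)) = a / (R + ?u)"
      using r pos by (simp add: field_simps)
    finally show ?thesis .
  qed
  moreover have "(C - a * ?u) / (R\<^sup>2 - ?u\<^sup>2) = a / (R + ?u)"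
  proof -
    have "C - a * ?u = (R - ?u) * a" "R\<^sup>2 - ?u\<^sup>2 = (R - ?u) * (R + ?u)"
      by (simp_all add: C algebra_simps power2_eq_square)
    then show ?thesis
      using r by simp
  qed
  ultimately show ?thesis
    by simp
qed

lemmas X_solution = sphere_profile_solution[OF DERIV_lat DERIV_lat1 DERIV_phase continuous_lat2 pos(3)
    lat_nonpolar lat_cubic lat_eq_height, folded X_def]

lemma lat_match:
  assumes "\<bar>y\<bar> < R" "p \<noteq> 0" "p\<^sup>2 = poly P y"
  obtains \<xi> where "lat \<xi> t = y" "lat1 \<xi> t = p"
proof -
  \<comment> \<open>The double root contributes a square, so positivity of the cubic at
    \<open>y\<close> can only come from the factor \<open>y - e1\<close>.\<close>
  have "poly P y = 2 * \<Omega> / R\<^sup>2 * (y - R)\<^sup>2 * (y - e1)"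
    by (simp only: P_factor power2_eq_square ac_simps)
  moreover have "0 < poly P y"
    unfolding assms(3)[symmetric] using assms(2) by simp
  ultimately have "0 < 2 * \<Omega> / R\<^sup>2 * (y - R)\<^sup>2 * (y - e1)"
    by simp
  moreover have "2 * \<Omega> / R\<^sup>2 * (y - R)\<^sup>2 > 0"
    using pos assms(1) by simp
  ultimately have "0 < y - e1"
    by (rule zero_less_mult_pos)
  then have y: "e1 < y"
    by simp
  define h where "h = (y - e1) / (R - e1)"
  have h: "0 < h" "h < 1"
    using y e1 assms(1) by (auto simp: h_def)
  \<comment> \<open>The square root fixes the height and the factor \<open>sgn p\<close> selects the
    rising or the falling branch.\<close>
  define v where "v = sgn p * artanh (sqrt h)"
  have T: "tanh v = sgn p * sqrt h"
  proof -
    have "tanh (artanh (sqrt h)) = sqrt h"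
      by (rule tanh_artanh_real) (use h in \<open>simp_all add: less_le_trans[of _ 0]\<close>)
    then show ?thesis
      using assms(2) by (cases "p > 0") (auto simp: v_def)
  qed
  let ?\<xi> = "t - v / \<omega>"
  have arg: "\<omega> * (t - ?\<xi>) = v"
    using frequency(1) by simp
  have T2: "(tanh v)\<^sup>2 = h"
    using h assms(2) by (auto simp: T power_mult_distrib sgn_if)
  have l: "lat ?\<xi> t = y"
    unfolding lat_def arg T2 h_def using e1 by simp
  have "(lat1 ?\<xi> t)\<^sup>2 = p\<^sup>2"
    unfolding lat1_square l assms(3) ..
  moreover have "p * lat1 ?\<xi> t > 0"
  proof -
    have "p * lat1 ?\<xi> t = 2 * (R - e1) * \<omega> * (1 - h) * sqrt h * (p * sgn p)"
      unfolding lat1_def arg T2 by (simp add: T)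
    moreover have "p * sgn p > 0"
      using assms(2) by (simp add: sgn_if)
    moreover have "2 * (R - e1) * \<omega> * (1 - h) * sqrt h > 0"
      using h e1 frequency(1) by simp
    ultimately show ?thesis
      by (metis mult_pos_pos)
  qed
  ultimately have "lat1 ?\<xi> t = p"
    by (metis mult_less_0_iff mult_minus_right neg_0_less_iff_less not_less_iff_gr_or_eq power2_eq_iff zero_less_mult_iff)
  with l show thesis
    by (rule that)
qed

lemma solution_eq_X:
  assumes x: "nonpolar_solution a \<Omega> R I x" "conserved a \<Omega> I x C E" and "\<not> constant_latitude I x"
  shows "\<exists>\<xi>\<^sub>0 \<phi>\<^sub>0. \<forall>t\<in>I. x t = X \<xi>\<^sub>0 \<phi>\<^sub>0 t"
proof -
  have xs: "is_solution a \<Omega> R I x"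
    using x by (simp add: nonpolar_solution_def)
  obtain t0 where t0: "t0 \<in> I" "vel x t0 $ 3 \<noteq> 0"
    using not_constant_latitude_obtains[OF xs assms(3)] .
  have "\<bar>x t0 $ 3\<bar> < R"
    using x(1) t0(1) by (simp add: nonpolar_solution_def)
  from lat_match[OF this t0(2) solution_latitude_square[OF xs x(2) pos(1,3) t0(1)]]
  obtain \<xi> where \<xi>: "lat \<xi> t0 = x t0 $ 3" "lat1 \<xi> t0 = vel x t0 $ 3"
    by blast
  have X: "X \<xi> = (\<lambda>\<phi>\<^sub>0. rot_curve (\<lambda>t. R * sqrt (1 - (height \<xi> t)\<^sup>2)) (\<lambda>t. \<phi>\<^sub>0 + phase \<xi> t) (\<lambda>t. R * height \<xi> t))"
    by (simp add: X_def fun_eq_iff sphere_curve_eq_rot_curve)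
  note sol = X_solution[of \<xi>, unfolded X]
  have "\<exists>\<phi>\<^sub>0. \<forall>t\<in>I. x t = X \<xi> \<phi>\<^sub>0 t"
    unfolding X by (rule rot_curve_match[OF x pos(1,3) sol t0(1)]) (simp_all add: \<xi> flip: lat_eq_height)
  then show ?thesis
    by blast
qed

lemma height_tendsto: "(height \<xi> \<longlongrightarrow> 1) at_infinity"
proof -
  have t: "filterlim (\<lambda>t. \<omega> * (t - \<xi>)) at_top at_top" "filterlim (\<lambda>t. \<omega> * (t - \<xi>)) at_bot at_bot"
    using frequency(1) by real_asymp+
  have "((\<lambda>t. H \<xi> t) \<longlongrightarrow> 1) at_top" "((\<lambda>t. H \<xi> t) \<longlongrightarrow> -1) at_bot"
    using filterlim_compose[OF tanh_real_at_top t(1)] filterlim_compose[OF tanh_real_at_bot t(2)] by auto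
  note lim = this
  have "(height \<xi> \<longlongrightarrow> 1 / R * (e1 + (R - e1) * 1\<^sup>2)) at_top"
    unfolding height_def[abs_def] by (intro tendsto_intros lim)
  moreover have "(height \<xi> \<longlongrightarrow> 1 / R * (e1 + (R - e1) * (- 1)\<^sup>2)) at_bot"
    unfolding height_def[abs_def] by (intro tendsto_intros lim)
  ultimately show ?thesis
    using pos by (simp add: at_infinity_eq_at_top_bot filterlim_sup)
qed

text \<open>The azimuth grows without bound, but it enters only through bounded trigonometric
  factors multiplied by a radius that tends to zero.\<close>

lemma X_tendsto: "(X \<xi> \<phi>\<^sub>0 \<longlongrightarrow> vector [0, 0, R]) at_infinity"
proof (rule vec_tendstoI)
  fix i :: 3
  let ?r = "\<lambda>t. R * sqrt (1 - (height \<xi> t)\<^sup>2)"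
  have "(?r \<longlongrightarrow> R * sqrt (1 - 1\<^sup>2)) at_infinity"
    by (intro tendsto_intros height_tendsto)
  then have r: "(?r \<longlongrightarrow> 0) at_infinity"
    by simp
  have trig: "((\<lambda>t. ?r t * f (\<phi>\<^sub>0 + phase \<xi> t)) \<longlongrightarrow> 0) at_infinity" if "\<And>x. \<bar>f x\<bar> \<le> 1" for f :: "real \<Rightarrow> real"
  proof (rule Lim_null_comparison)
    show "\<forall>\<^sub>F t in at_infinity. norm (?r t * f (\<phi>\<^sub>0 + phase \<xi> t)) \<le> \<bar>?r t\<bar>"
      using that by (intro always_eventually allI) (simp add: abs_mult mult_left_le)
    show "((\<lambda>t. \<bar>?r t\<bar>) \<longlongrightarrow> 0) at_infinity"
      using r by (rule tendsto_rabs_zero)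
  qed
  have "((\<lambda>t. R * height \<xi> t) \<longlongrightarrow> R * 1) at_infinity"
    by (intro tendsto_intros height_tendsto)
  then show "((\<lambda>t. X \<xi> \<phi>\<^sub>0 t $ i) \<longlongrightarrow> vector [0, 0, R] $ i) at_infinity"
    using trig[of cos] trig[of sin] exhaust_3[of i]
    by (auto simp: X_def sphere_curve_eq_rot_curve)
qed

text \<open>Along \<open>\<xi> + n * T\<close> a periodic curve would keep the latitude
  \<open>e1\<close> it has at \<open>\<xi>\<close>, whereas the latitude tends to
  \<open>R\<close>.\<close>

lemma X_not_periodic: "\<not> periodic (X \<xi> \<phi>\<^sub>0)"
proof
  assume "periodic (X \<xi> \<phi>\<^sub>0)"
  then obtain T where T: "T > 0" "periodic_fun_simple (X \<xi> \<phi>\<^sub>0) T"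
    unfolding periodic_def by blast
  interpret periodic_fun_simple "X \<xi> \<phi>\<^sub>0" T
    by (rule T(2))
  have "filterlim (\<lambda>n. \<xi> + real n * T) at_top sequentially"
    using T(1) by real_asymp
  then have "filterlim (\<lambda>n. \<xi> + real n * T) at_infinity sequentially"
    using at_top_le_at_infinity filterlim_mono by blast
  from filterlim_compose[OF X_tendsto[of \<xi> \<phi>\<^sub>0] this]
  have "(\<lambda>n. X \<xi> \<phi>\<^sub>0 (\<xi> + real n * T) $ 3) \<longlonglongrightarrow> (vector [0, 0, R] :: real^3) $ 3"
    by (rule tendsto_vec_nth)
  moreover have "X \<xi> \<phi>\<^sub>0 (\<xi> + real n * T) $ 3 = e1" for n
    using pos by (simp add: plus_of_nat) (simp add: X_def sphere_curve_eq_rot_curve height_def)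
  ultimately have "R = e1"
    using LIMSEQ_unique[OF tendsto_const] by fastforce
  then show False
    using e1 by simp
qed

end

section \<open>Root multiplicities and the factorization in the soliton case\<close>

lemma poly_linear_factor: "poly [:- b, 1 :: real:] s = s - b"
  by simp

lemma order_linear_eq: "order x [:- b, 1 :: real:] = (if x = b then 1 else 0)"
  using order_power_n_n[of b 1] by (auto intro: order_0I)

lemma order_three_linear_factors:
  fixes c :: real
  assumes "c \<noteq> 0"
  shows "order x (smult c ([:- b1, 1:] * ([:- b2, 1:] * [:- b3, 1:])))
    = (if x = b1 then 1 else 0) + (if x = b2 then 1 else 0) + (if x = b3 then 1 else 0)"
  using assms by (simp add: order_smult order_mult order_linear_eq
      del: mult_pCons_left mult_pCons_right smult_pCons)

text \<open>A root at the north pole makes the square \<open>(C - a * R)\<^sup>2\<close> vanish. The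
  multiplicity then identifies the remaining root of the factorization: the order at
  \<open>R\<close> would be 1 if the third root differed from \<open>R\<close>.\<close>

lemma soliton_roots_factor:
  assumes "a > 0" "\<Omega> > 0" "R > 0" "soliton_roots R (cubic a \<Omega> R C E) e1"
  shows "C = a * R"
    and "poly (cubic a \<Omega> R C E) s = 2 * \<Omega> / R\<^sup>2 * ((s - e1) * (s - R) * (s - R))"
proof -
  let ?P = "cubic a \<Omega> R C E"
  have P: "poly ?P e1 = 0" "- R < e1" "e1 < R" "order R ?P = 2"
    using assms by (auto simp: soliton_roots_def)
  have PR: "poly ?P R = 0"
    using P(4) order_root[of ?P R] by simp
  then show "C = a * R"
    using cubic_poles_nonpos(1)[OF assms(1,3), of \<Omega> C E] by simp
  obtain e3 where e3: "\<forall>s. poly ?P s = 2 * \<Omega> / R\<^sup>2 * ((s - e1) * (s - R) * (s - e3))"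
    using cubic_third_root[OF assms(2,3) P(1) PR] P by auto
  have eq: "?P = smult (2 * \<Omega> / R\<^sup>2) ([:- e1, 1:] * ([:- R, 1:] * [:- e3, 1:]))"
    by (rule poly_ext) (simp only: e3 poly_smult poly_mult poly_linear_factor mult.assoc)
  have "order R ?P = (if R = e3 then 2 else 1)"
    unfolding eq using assms(2,3) P by (subst order_three_linear_factors) auto
  then have "e3 = R"
    using P(4) by (simp split: if_splits)
  then show "poly ?P s = 2 * \<Omega> / R\<^sup>2 * ((s - e1) * (s - R) * (s - R))"
    using e3 by simp
qed

lemma soliton_rootsI:
  assumes "\<Omega> > 0" "R > 0" "- R < e1" "e1 < R"
    and "\<And>s. poly (cubic a \<Omega> R C E) s = 2 * \<Omega> / R\<^sup>2 * ((s - e1) * (s - R) * (s - R))"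
  shows "soliton_roots R (cubic a \<Omega> R C E) e1"
proof -
  have eq: "cubic a \<Omega> R C E = smult (2 * \<Omega> / R\<^sup>2) ([:- e1, 1:] * ([:- R, 1:] * [:- R, 1:]))"
    by (rule poly_ext) (simp only: assms(5) poly_smult poly_mult poly_linear_factor mult.assoc)
  have "order R (cubic a \<Omega> R C E) = 2"
    unfolding eq using assms(1-4) by (subst order_three_linear_factors) auto
  then show ?thesis
    using assms by (simp add: soliton_roots_def)
qed

section \<open>Constant latitude and the list of cases\<close>

lemma latitude_circle_eq_rot_curve:
  "latitude_circle R e \<phi>\<^sub>0 \<nu> = rot_curve (\<lambda>_. sqrt (R\<^sup>2 - e\<^sup>2)) (\<lambda>t. \<phi>\<^sub>0 + \<nu> * t) (\<lambda>_. e)"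
  by (simp add: fun_eq_iff latitude_circle_def rot_curve_def)

lemma square_less_square_real:
  fixes e R :: real
  assumes "- R < e" "e < R"
  shows "e\<^sup>2 < R\<^sup>2"
proof -
  have "0 < (R - e) * (R + e)"
    using assms by simp
  then show ?thesis
    by (simp add: algebra_simps power2_eq_square)
qed

lemma latitude_circle_solution:
  assumes R: "R > 0" and e: "- R < e" "e < R" and \<nu>: "e * \<nu>\<^sup>2 - a * \<nu> + \<Omega> = 0"
  shows "is_solution a \<Omega> R UNIV (latitude_circle R e \<phi>\<^sub>0 \<nu>)"
    and "vel (latitude_circle R e \<phi>\<^sub>0 \<nu>) t = \<nu> *\<^sub>R (unit3 \<times> latitude_circle R e \<phi>\<^sub>0 \<nu> t)"
    and "conserved a \<Omega> UNIV (latitude_circle R e \<phi>\<^sub>0 \<nu>) C E \<Longrightarrow> C = \<nu> * (R\<^sup>2 - e\<^sup>2) + a * e"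
    and "\<exists>E. conserved a \<Omega> UNIV (latitude_circle R e \<phi>\<^sub>0 \<nu>) (\<nu> * (R\<^sup>2 - e\<^sup>2) + a * e) E"
proof -
  let ?r = "sqrt (R\<^sup>2 - e\<^sup>2)" and ?x = "latitude_circle R e \<phi>\<^sub>0 \<nu>"
  have pos: "R\<^sup>2 - e\<^sup>2 > 0"
    using square_less_square_real[OF e] by simp
  \<comment> \<open>On a circle the only component of the equation that is not trivial is the
    azimuthal one, which is the radius times the quadratic condition on
    \<open>\<nu>\<close>.\<close>
  have A: "?r * 0 - e * (0 - ?r * \<nu>\<^sup>2) + \<Omega> * ?r - a * ?r * \<nu> = 0"
  proof -
    have "?r * 0 - e * (0 - ?r * \<nu>\<^sup>2) + \<Omega> * ?r - a * ?r * \<nu> = ?r * (e * \<nu>\<^sup>2 - a * \<nu> + \<Omega>)"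
      by (simp add: algebra_simps)
    then show ?thesis
      by (simp add: \<nu>)
  qed
  have d\<phi>: "((\<lambda>t. \<phi>\<^sub>0 + \<nu> * t) has_real_derivative \<nu>) (at t)" for t
    by (rule derivative_eq_intros refl)+ simp
  have c0: "continuous_on UNIV (\<lambda>_. 0 :: real)"
    by simp
  have sph: "?r\<^sup>2 + e\<^sup>2 = R\<^sup>2"
    using pos by simp
  have B: "a * 0 - e * (?r * 0 + 2 * 0 * \<nu>) = 0" "?r * (?r * 0 + 2 * 0 * \<nu>) + a * 0 = 0"
    by simp_all
  note * = rot_curve_solution[where r = "\<lambda>_. ?r" and ?r1.0 = "\<lambda>_. 0" and ?r2.0 = "\<lambda>_. 0" and u = "\<lambda>_. e"
      and p = "\<lambda>_. 0" and q = "\<lambda>_. 0" and b = "\<lambda>_. 0" and \<beta> = "\<lambda>_. \<nu>" and \<phi> = "\<lambda>t. \<phi>\<^sub>0 + \<nu> * t",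
      OF DERIV_const DERIV_const d\<phi> DERIV_const DERIV_const DERIV_const c0 c0 c0 sph R A B,
      folded latitude_circle_eq_rot_curve]
  show sol: "is_solution a \<Omega> R UNIV ?x"
    by (rule *(1))
  show vel: "vel ?x t = \<nu> *\<^sub>R (unit3 \<times> ?x t)" for t
    unfolding *(2) by (simp add: vec_eq_iff forall_3 cross3_def unit3_def latitude_circle_def)
  show C: "C = \<nu> * (R\<^sup>2 - e\<^sup>2) + a * e" if "conserved a \<Omega> UNIV ?x C E" for C E
  proof -
    have "C = ?x 0 $ 1 * vel ?x 0 $ 2 - ?x 0 $ 2 * vel ?x 0 $ 1 + a * ?x 0 $ 3"
      using that by (simp add: conserved_def)
    also have "\<dots> = \<nu> * (?r\<^sup>2 * ((sin \<phi>\<^sub>0)\<^sup>2 + (cos \<phi>\<^sub>0)\<^sup>2)) + a * e"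
      unfolding vel by (simp add: cross3_def unit3_def latitude_circle_def power2_eq_square algebra_simps
          del: sin_cos_squared_add sin_cos_squared_add2 sin_cos_squared_add3)
    also have "\<dots> = \<nu> * (R\<^sup>2 - e\<^sup>2) + a * e"
      using pos by simp
    finally show ?thesis .
  qed
  obtain C E where "conserved a \<Omega> UNIV ?x C E"
    using conserved_exists[OF sol R] .
  then show "\<exists>E. conserved a \<Omega> UNIV ?x (\<nu> * (R\<^sup>2 - e\<^sup>2) + a * e) E"
    using C by blast
qed

text \<open>At constant height the horizontal velocity is orthogonal to the horizontal position and
  has constant angular momentum, so it is a rotation at constant rate. Inserted into the equation,
  this gives the quadratic condition multiplied by the horizontal position, which is nonzero off the
  poles.\<close>

lemma constant_latitude_solution:
  assumes a: "a > 0" and R: "R > 0"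
    and x: "nonpolar_solution a \<Omega> R I x" "constant_latitude I x"
  shows "\<exists>e \<phi>\<^sub>0 \<nu>. - R < e \<and> e < R \<and> e * \<nu>\<^sup>2 - a * \<nu> + \<Omega> = 0 \<and> (\<forall>\<xi>\<in>I. x \<xi> = latitude_circle R e \<phi>\<^sub>0 \<nu> \<xi>)"
proof -
  have xs: "is_solution a \<Omega> R I x" and I: "open I" "I \<noteq> {}"
    using x by (auto simp: nonpolar_solution_def is_solution_def open_interval_def)
  obtain t0 where t0: "t0 \<in> I"
    using I(2) by blast
  obtain e where e: "\<And>t. t \<in> I \<Longrightarrow> x t $ 3 = e"
    using x(2) by (auto simp: constant_latitude_def constant_on_def)
  have eR: "- R < e" "e < R"
    using x(1) t0 e[OF t0] by (auto simp: nonpolar_solution_def abs_less_iff)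
  have pos: "R\<^sup>2 - e\<^sup>2 > 0"
    using square_less_square_real[OF eR] by simp
  obtain C E where con: "conserved a \<Omega> I x C E"
    using conserved_exists[OF xs R] .
  \<comment> \<open>The angular velocity is read off \<open>C\<close>: on a circle the angular
    momentum is \<open>\<nu>\<close> times the squared radius.\<close>
  define \<nu> where "\<nu> = (C - a * e) / (R\<^sup>2 - e\<^sup>2)"
  note c = is_solution_components[OF xs]
  have v3: "vel x t $ 3 = 0" if "t \<in> I" for t
    using DERIV_constant_on_open[OF c(1)[OF that, of 3] I(1) that e] .
  have w3: "acc x t $ 3 = 0" if "t \<in> I" for t
    using DERIV_constant_on_open[OF c(2)[OF that, of 3] I(1) that v3] .
  have r: "(x t $ 1)\<^sup>2 + (x t $ 2)\<^sup>2 = R\<^sup>2 - e\<^sup>2" if "t \<in> I" for t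
    using c(6)[OF that] e[OF that] by simp
  have v: "vel x t $ 1 = - \<nu> * x t $ 2" "vel x t $ 2 = \<nu> * x t $ 1" if "t \<in> I" for t
  proof -
    let ?J = "x t $ 1 * vel x t $ 2 - x t $ 2 * vel x t $ 1"
    let ?O = "x t $ 1 * vel x t $ 1 + x t $ 2 * vel x t $ 2"
    have O: "?O = 0"
      using c(7)[OF that] v3[OF that] by simp
    have "?J = C - a * e"
      using con that e[OF that] by (auto simp: conserved_def)
    then have J: "?J = \<nu> * (R\<^sup>2 - e\<^sup>2)"
      using pos by (simp add: \<nu>_def)
    have "((x t $ 1)\<^sup>2 + (x t $ 2)\<^sup>2) * vel x t $ 1 = x t $ 1 * ?O - x t $ 2 * ?J"
      "((x t $ 1)\<^sup>2 + (x t $ 2)\<^sup>2) * vel x t $ 2 = x t $ 2 * ?O + x t $ 1 * ?J"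
      by (simp_all add: algebra_simps power2_eq_square)
    then have "(R\<^sup>2 - e\<^sup>2) * vel x t $ 1 = (R\<^sup>2 - e\<^sup>2) * (- \<nu> * x t $ 2)"
      "(R\<^sup>2 - e\<^sup>2) * vel x t $ 2 = (R\<^sup>2 - e\<^sup>2) * (\<nu> * x t $ 1)"
      unfolding O J r[OF that] by (simp_all only: mult_zero_right diff_0 add_0 ac_simps mult_minus_left mult_minus_right)
    then show "vel x t $ 1 = - \<nu> * x t $ 2" "vel x t $ 2 = \<nu> * x t $ 1"
      using pos by (simp_all only: mult_cancel_left) auto
  qed
  have w: "acc x t0 $ 1 = - \<nu> * vel x t0 $ 2" "acc x t0 $ 2 = \<nu> * vel x t0 $ 1"
  proof -
    have "((\<lambda>t. vel x t $ 1 + \<nu> * x t $ 2) has_real_derivative acc x t0 $ 1 + \<nu> * vel x t0 $ 2) (at t0)"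
      by (rule derivative_eq_intros c t0 refl)+ simp
    from DERIV_constant_on_open[OF this I(1) t0, of 0] show "acc x t0 $ 1 = - \<nu> * vel x t0 $ 2"
      by (simp add: v)
    have "((\<lambda>t. vel x t $ 2 - \<nu> * x t $ 1) has_real_derivative acc x t0 $ 2 - \<nu> * vel x t0 $ 1) (at t0)"
      by (rule derivative_eq_intros c t0 refl)+ simp
    from DERIV_constant_on_open[OF this I(1) t0, of 0] show "acc x t0 $ 2 = \<nu> * vel x t0 $ 1"
      by (simp add: v)
  qed
  have \<nu>: "e * \<nu>\<^sup>2 - a * \<nu> + \<Omega> = 0"
  proof -
    have "x t0 $ 2 * (e * \<nu>\<^sup>2 - a * \<nu> + \<Omega>) = 0"
      using c(3)[OF t0] by (simp add: w3[OF t0] w v[OF t0] e[OF t0] algebra_simps power2_eq_square)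
    moreover have "x t0 $ 1 * (e * \<nu>\<^sup>2 - a * \<nu> + \<Omega>) = 0"
      using c(4)[OF t0] by (simp add: w3[OF t0] w v[OF t0] e[OF t0] algebra_simps power2_eq_square)
    moreover have "x t0 $ 1 \<noteq> 0 \<or> x t0 $ 2 \<noteq> 0"
      using r[OF t0] pos by auto
    ultimately show ?thesis
      by auto
  qed
  have C: "\<nu> * (R\<^sup>2 - e\<^sup>2) + a * e = C"
    using pos by (simp add: \<nu>_def)
  note circ = latitude_circle_solution[OF R eR \<nu>]
  have "\<exists>\<phi>\<^sub>0. \<forall>t\<in>I. x t = rot_curve (\<lambda>_. sqrt (R\<^sup>2 - e\<^sup>2)) (\<lambda>t. \<phi>\<^sub>0 + \<nu> * t) (\<lambda>_. e) t"
    by (rule rot_curve_match[OF x(1) con a R, where p = 0 and t\<^sub>0 = t0])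
      (use circ(1,4)[unfolded C] circ(2) t0 e v3 in
        \<open>simp_all add: cross3_def unit3_def flip: latitude_circle_eq_rot_curve\<close>)
  then show ?thesis
    using eR \<nu> unfolding latitude_circle_eq_rot_curve by blast
qed

lemma constant_latitude_iff:
  assumes a: "a > 0" and R: "R > 0" and I: "open_interval I"
  shows "nonpolar_solution a \<Omega> R I x \<and> constant_latitude I x \<longleftrightarrow>
    (\<exists>e \<phi>\<^sub>0 \<nu>. - R < e \<and> e < R \<and> e * \<nu>\<^sup>2 - a * \<nu> + \<Omega> = 0 \<and> (\<forall>\<xi>\<in>I. x \<xi> = latitude_circle R e \<phi>\<^sub>0 \<nu> \<xi>))"
proof
  assume "\<exists>e \<phi>\<^sub>0 \<nu>. - R < e \<and> e < R \<and> e * \<nu>\<^sup>2 - a * \<nu> + \<Omega> = 0 \<and> (\<forall>\<xi>\<in>I. x \<xi> = latitude_circle R e \<phi>\<^sub>0 \<nu> \<xi>)"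
  then obtain e \<phi>\<^sub>0 \<nu> where e: "- R < e" "e < R" and \<nu>: "e * \<nu>\<^sup>2 - a * \<nu> + \<Omega> = 0"
    and x: "\<forall>\<xi>\<in>I. x \<xi> = latitude_circle R e \<phi>\<^sub>0 \<nu> \<xi>"
    by blast
  have "is_solution a \<Omega> R I (latitude_circle R e \<phi>\<^sub>0 \<nu>)"
    using is_solution_subset[OF latitude_circle_solution(1)[OF R e \<nu>] I] by simp
  then have "is_solution a \<Omega> R I x"
    by (rule is_solution_cong[rotated]) (simp add: x)
  then show "nonpolar_solution a \<Omega> R I x \<and> constant_latitude I x"
    using x e by (auto simp: nonpolar_solution_def constant_latitude_def constant_on_def latitude_circle_def)
qed (use constant_latitude_solution[OF a R] in blast)

lemma latitude_circle_properties:
  assumes \<Omega>: "\<Omega> > 0" and R: "R > 0" and I: "open_interval I" and e: "- R < e" "e < R"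
    and \<nu>: "e * \<nu>\<^sup>2 - a * \<nu> + \<Omega> = 0" and x: "\<forall>\<xi>\<in>I. x \<xi> = latitude_circle R e \<phi>\<^sub>0 \<nu> \<xi>"
  shows "conserved a \<Omega> I x C E \<Longrightarrow> \<nu> = (C - a * e) / (R\<^sup>2 - e\<^sup>2)"
    and "range (latitude_circle R e \<phi>\<^sub>0 \<nu>) = {y. norm y = R \<and> y $ 3 = e}"
    and "\<forall>\<xi>\<in>I. vel x \<xi> = \<nu> *\<^sub>R (unit3 \<times> x \<xi>)"
proof -
  let ?c = "latitude_circle R e \<phi>\<^sub>0 \<nu>" and ?r = "sqrt (R\<^sup>2 - e\<^sup>2)"
  note circ = latitude_circle_solution[OF R e \<nu>]
  have pos: "R\<^sup>2 - e\<^sup>2 > 0"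
    using square_less_square_real[OF e] by simp
  have op: "open I" "I \<noteq> {}"
    using I by (auto simp: open_interval_def)
  have vel: "vel x t = vel ?c t" if "t \<in> I" for t
    by (rule vel_cong[OF op(1) that]) (simp add: x)
  then show "\<forall>\<xi>\<in>I. vel x \<xi> = \<nu> *\<^sub>R (unit3 \<times> x \<xi>)"
    using x by (simp add: circ(2))
  show "\<nu> = (C - a * e) / (R\<^sup>2 - e\<^sup>2)" if con: "conserved a \<Omega> I x C E"
  proof -
    obtain t where t: "t \<in> I"
      using op(2) by blast
    obtain E' where E': "conserved a \<Omega> UNIV ?c (\<nu> * (R\<^sup>2 - e\<^sup>2) + a * e) E'"
      using circ(4) by blast
    have "C = ?c t $ 1 * vel ?c t $ 2 - ?c t $ 2 * vel ?c t $ 1 + a * ?c t $ 3"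
      using con t x vel[OF t] by (simp add: conserved_def)
    also have "\<dots> = \<nu> * (R\<^sup>2 - e\<^sup>2) + a * e"
      using E' by (simp add: conserved_def)
    finally show ?thesis
      using pos by simp
  qed
  \<comment> \<open>A vanishing \<open>\<nu>\<close> would leave \<open>\<Omega> = 0\<close> in the
    quadratic condition. Nonzero rotation is what makes the curve cover the whole circle.\<close>
  have "\<nu> \<noteq> 0"
    using \<nu> \<Omega> by auto
  show "range ?c = {y. norm y = R \<and> y $ 3 = e}"
  proof (intro equalityI subsetI)
    fix y assume "y \<in> range ?c"
    then show "y \<in> {y. norm y = R \<and> y $ 3 = e}"
      using circ(1)[of \<phi>\<^sub>0] by (auto simp: is_solution_def latitude_circle_def)
  next
    fix y :: "real^3" assume "y \<in> {y. norm y = R \<and> y $ 3 = e}"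
    then have y: "(y $ 1)\<^sup>2 + (y $ 2)\<^sup>2 = R\<^sup>2 - e\<^sup>2" "y $ 3 = e"
      using norm_eq_iff_vec3[OF R, of y] by auto
    then have "(y $ 1 / ?r)\<^sup>2 + (y $ 2 / ?r)\<^sup>2 = 1"
      using pos by (simp add: power_divide flip: add_divide_distrib)
    then obtain \<theta> where "y $ 1 / ?r = cos \<theta>" "y $ 2 / ?r = sin \<theta>"
      using sincos_total_2pi by metis
    then have "y = ?c ((\<theta> - \<phi>\<^sub>0) / \<nu>)"
      using y(2) pos \<open>\<nu> \<noteq> 0\<close> by (simp add: vec_eq_iff forall_3 latitude_circle_def field_simps)
    then show "y \<in> range ?c"
      by blast
  qed
qed

text \<open>The cubic is positive at a latitude \<open>y\<close> passed with nonzero vertical speed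
  and nonpositive at both poles, so it has roots on both sides of \<open>y\<close>. The cases differ
  in whether a pole is itself a root. A pole that bounds the oscillation as a simple root would be
  crossed by a continuation, which the hypothesis on \<open>x\<close> excludes.\<close>

lemma never_polar_trichotomy:
  assumes a: "a > 0" and \<Omega>: "\<Omega> > 0" and R: "R > 0" and x: "never_polar_solution a \<Omega> R I x"
    and con: "conserved a \<Omega> I x C E" and nc: "\<not> constant_latitude I x"
  shows "(\<exists>e1 e2 e3. periodic_roots R (cubic a \<Omega> R C E) e1 e2 e3) \<or>
    (\<exists>e1. soliton_roots R (cubic a \<Omega> R C E) e1)"
proof -
  let ?P = "cubic a \<Omega> R C E" and ?c = "2 * \<Omega> / R\<^sup>2"
  have np: "nonpolar_solution a \<Omega> R I x"
    using x unfolding never_polar_solution_def by blast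
  then have xs: "is_solution a \<Omega> R I x"
    by (simp add: nonpolar_solution_def)
  obtain t0 where t0: "t0 \<in> I" "vel x t0 $ 3 \<noteq> 0"
    using not_constant_latitude_obtains[OF xs nc] .
  define y where "y = x t0 $ 3"
  have y: "- R < y" "y < R"
    using np t0(1) by (auto simp: nonpolar_solution_def y_def abs_less_iff)
  have Py: "poly ?P y > 0"
    using solution_latitude_square[OF xs con a R t0(1)] t0(2) by (metis y_def zero_less_power2)
  have c: "?c > 0"
    using \<Omega> R by simp
  have PR: "poly ?P R \<le> 0" "poly ?P (- R) \<le> 0"
    using cubic_poles_nonpos[OF a R, of \<Omega> C E] R by (smt (verit) mult_pos_pos zero_le_power2 zero_less_power)+
  have north_pole: "C = a * R" if "poly ?P R = 0"
    using cubic_poles_nonpos(1)[OF a R, of \<Omega> C E] that by simp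
  have south_pole: "C = - a * R" if "poly ?P (- R) = 0"
    using cubic_poles_nonpos(2)[OF a R, of \<Omega> C E] that by simp
  \<comment> \<open>Both poles cannot be roots: \<open>C\<close> would equal both
    \<open>a * R\<close> and \<open>- a * R\<close>.\<close>
  have south: "poly ?P (- R) < 0" if "poly ?P R = 0"
    using PR(2) north_pole[OF that] south_pole a R by (cases "poly ?P (- R) = 0") auto
  have sign: "0 < (s - e1) * (s - e2) * (s - e3) \<longleftrightarrow> 0 < poly ?P s"
    "(s - e1) * (s - e2) * (s - e3) < 0 \<longleftrightarrow> poly ?P s < 0"
    if "\<forall>s. poly ?P s = ?c * ((s - e1) * (s - e2) * (s - e3))" for s e1 e2 e3
    using mult_less_cancel_left_pos[OF c, of 0] mult_less_cancel_left_pos[OF c, of _ 0]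
    by (simp_all only: that mult_zero_right)
  consider "poly ?P R = 0" | "poly ?P R < 0" "poly ?P (- R) = 0" | "poly ?P R < 0" "poly ?P (- R) < 0"
    using PR by linarith
  then show ?thesis
  proof cases
    case 1
    then obtain e1 where e1: "- R < e1" "e1 < y" "poly ?P e1 = 0"
      using poly_IVT_pos[OF y(1) south Py] by blast
    obtain e3 where e3: "\<forall>s. poly ?P s = ?c * ((s - e1) * (s - R) * (s - e3))"
      using cubic_third_root[OF \<Omega> R e1(3) 1] e1 y by auto
    have "0 < (y - e1) * (y - R) * (y - e3)"
      using sign(1)[OF e3] Py by blast
    then have "y < e3"
      using e1 y by (auto simp: zero_less_mult_iff mult_less_0_iff)
    consider "e3 < R" | "e3 = R" | "R < e3"
      by linarith
    then show ?thesis
    proof cases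
      case 1
      \<comment> \<open>The third root separates \<open>y\<close> from the pole, so the oscillation
        runs between \<open>e1\<close> and \<open>e3\<close>, and \<open>R\<close> itself takes the
        place of the largest root.\<close>
      then have "periodic_roots R ?P e1 e3 R"
        using e3 e1 \<open>y < e3\<close> by (simp add: periodic_roots_def)
      then show ?thesis
        by blast
    next
      case 2
      then have "soliton_roots R ?P e1"
        using e3 e1 y by (intro soliton_rootsI[OF \<Omega> R]) auto
      then show ?thesis
        by blast
    next
      case 3
      interpret elliptic_profile \<Omega> R e1 R e3 "sqrt (\<Omega> / (2 * R\<^sup>2) * (e3 - e1))" "(R - e1) / (e3 - e1)" a C E
        by unfold_locales (use \<Omega> R e1 y 3 a e3 in simp_all)
      show ?thesis
        using not_never_polar_north[OF np con nc e1(1) refl north_pole] \<open>poly ?P R = 0\<close> x by blast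
    qed
  next
    case 2
    obtain e2 where e2: "y < e2" "e2 < R" "poly ?P e2 = 0"
      using poly_IVT_neg[OF y(2) Py 2(1)] by blast
    obtain e3 where e3: "\<forall>s. poly ?P s = ?c * ((s - - R) * (s - e2) * (s - e3))"
      using cubic_third_root[OF \<Omega> R 2(2) e2(3)] e2 y by auto
    have "(R - - R) * (R - e2) * (R - e3) < 0"
      using sign(2)[OF e3] 2(1) by blast
    then have "R < e3"
      using e2 R by (auto simp: zero_less_mult_iff mult_less_0_iff)
    interpret elliptic_profile \<Omega> R "- R" e2 e3 "sqrt (\<Omega> / (2 * R\<^sup>2) * (e3 - - R))" "(e2 - - R) / (e3 - - R)" a C E
      by unfold_locales (use \<Omega> R e2 y \<open>R < e3\<close> a e3 in simp_all)
    show ?thesis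
      using not_never_polar_south[OF np con nc \<open>R < e3\<close> refl e2(2) south_pole] 2(2) x by blast
  next
    case 3
    obtain e1 where e1: "- R < e1" "e1 < y" "poly ?P e1 = 0"
      using poly_IVT_pos[OF y(1) 3(2) Py] by blast
    obtain e2 where e2: "y < e2" "e2 < R" "poly ?P e2 = 0"
      using poly_IVT_neg[OF y(2) Py 3(1)] by blast
    obtain e3 where e3: "\<forall>s. poly ?P s = ?c * ((s - e1) * (s - e2) * (s - e3))"
      using cubic_third_root[OF \<Omega> R e1(3) e2(3)] e1 e2 by auto
    have "(R - e1) * (R - e2) * (R - e3) < 0"
      using sign(2)[OF e3] 3(1) by blast
    then have "R < e3"
      using e1 e2 y by (auto simp: zero_less_mult_iff mult_less_0_iff)
    then have "periodic_roots R ?P e1 e2 e3"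
      using e1 e2 e3 by (simp add: periodic_roots_def)
    then show ?thesis
      by blast
  qed
qed

section \<open>Cases (b) and (c) in the form of the theorem\<close>

context elliptic_nonpolar
begin

lemma elliptic_solutions:
  assumes x: "nonpolar_solution a \<Omega> R I x" "conserved a \<Omega> I x C E"
  shows "(let T = 2 * ellip_K k / \<omega>;
             z = (\<lambda>\<xi>\<^sub>0 \<xi>. 1 / R * (e1 + (e2 - e1) * (jacobi_sn (\<omega> * (\<xi> - \<xi>\<^sub>0)) k)\<^sup>2));
             \<phi> = (\<lambda>\<xi>\<^sub>0 \<phi>\<^sub>0 \<xi>. \<phi>\<^sub>0
                    + (C - a * R) / (2 * R * (R - e1) * \<omega>)
                        * ellip_Pi_inc (\<omega> * (\<xi> - \<xi>\<^sub>0)) ((e2 - e1) / (R - e1)) k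
                    + (C + a * R) / (2 * R * (R + e1) * \<omega>)
                        * ellip_Pi_inc (\<omega> * (\<xi> - \<xi>\<^sub>0)) (- ((e2 - e1) / (R + e1))) k);
             X = (\<lambda>\<xi>\<^sub>0 \<phi>\<^sub>0. sphere_curve R (z \<xi>\<^sub>0) (\<phi> \<xi>\<^sub>0 \<phi>\<^sub>0));
             closing = (\<lambda>p q :: int. q \<ge> 1 \<and> gcd p q = 1 \<and>
                  (C - a * R) / (R * (R - e1)) * ellip_Pi ((e2 - e1) / (R - e1)) k
                    + (C + a * R) / (R * (R + e1)) * ellip_Pi (- ((e2 - e1) / (R + e1))) k
                  = 2 * pi * \<omega> * (of_int p / of_int q))
         in 0 < k \<and> k < 1 \<and>
            (\<not> constant_latitude I x \<longrightarrow> (\<exists>\<xi>\<^sub>0 \<phi>\<^sub>0. \<forall>\<xi>\<in>I. x \<xi> = X \<xi>\<^sub>0 \<phi>\<^sub>0 \<xi>)) \<and>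
            (\<forall>\<xi>\<^sub>0 \<phi>\<^sub>0.
               is_solution a \<Omega> R UNIV (X \<xi>\<^sub>0 \<phi>\<^sub>0) \<and>
               minimal_period (z \<xi>\<^sub>0) T \<and>
               minimal_period (\<lambda>\<xi>. X \<xi>\<^sub>0 \<phi>\<^sub>0 \<xi> $ 3) T \<and>
               (periodic (X \<xi>\<^sub>0 \<phi>\<^sub>0) \<longleftrightarrow> (\<exists>p q. closing p q)) \<and>
               (\<forall>p q. closing p q \<longrightarrow> minimal_period (X \<xi>\<^sub>0 \<phi>\<^sub>0) (of_int q * T)) \<and>
               (\<not> (\<exists>p q. closing p q) \<longrightarrow>
                  periodic_fun_simple (\<lambda>\<xi>. X \<xi>\<^sub>0 \<phi>\<^sub>0 \<xi> $ 3) T \<and>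
                  (\<forall>\<xi>. (\<phi> \<xi>\<^sub>0 \<phi>\<^sub>0 (\<xi> + T) - \<phi> \<xi>\<^sub>0 \<phi>\<^sub>0 \<xi>) / (2 * pi) \<notin> \<rat>) \<and>
                  \<not> periodic (X \<xi>\<^sub>0 \<phi>\<^sub>0))))"
proof -
  have z: "(\<lambda>\<xi>\<^sub>0 \<xi>. 1 / R * (e1 + (e2 - e1) * (jacobi_sn (\<omega> * (\<xi> - \<xi>\<^sub>0)) k)\<^sup>2)) = height"
    by (simp add: fun_eq_iff height_def)
  have \<phi>: "(\<lambda>\<xi>\<^sub>0 \<phi>\<^sub>0 \<xi>. \<phi>\<^sub>0
      + (C - a * R) / (2 * R * (R - e1) * \<omega>)
          * ellip_Pi_inc (\<omega> * (\<xi> - \<xi>\<^sub>0)) ((e2 - e1) / (R - e1)) k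
      + (C + a * R) / (2 * R * (R + e1) * \<omega>)
          * ellip_Pi_inc (\<omega> * (\<xi> - \<xi>\<^sub>0)) (- ((e2 - e1) / (R + e1))) k)
    = (\<lambda>\<xi>\<^sub>0 \<phi>\<^sub>0 \<xi>. \<phi>\<^sub>0 + phase \<xi>\<^sub>0 \<xi>)"
    by (simp only: fun_eq_iff phase_def A1_def A2_def n1_def n2_def add.assoc simp_thms)
  have closing: "(\<lambda>p q :: int. q \<ge> 1 \<and> gcd p q = 1 \<and>
      (C - a * R) / (R * (R - e1)) * ellip_Pi ((e2 - e1) / (R - e1)) k
        + (C + a * R) / (R * (R + e1)) * ellip_Pi (- ((e2 - e1) / (R + e1))) k
      = 2 * pi * \<omega> * (of_int p / of_int q)) = closing"
    by (simp only: fun_eq_iff closing_iff n1_def n2_def simp_thms)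
  have irr: "(phase \<xi> (t + T) - phase \<xi> t) / (2 * pi) \<notin> \<rat>" if "\<nexists>p q. closing p q" for \<xi> t
    using that by (simp add: phase_plus_T closing_exists_iff)
  show ?thesis
    unfolding z \<phi> closing
    unfolding Let_def T_def[symmetric] X_def[symmetric]
    using elliptic_modulus solution_eq_X[OF x] X_solution(1) height_minimal_period minimal_period_nth_3
      periodic_iff_closing closing_minimal_period irr
    by (auto simp: minimal_period_def)
qed

end

context soliton_profile
begin

lemma soliton_solutions:
  assumes x: "nonpolar_solution a \<Omega> R I x" "conserved a \<Omega> I x C E"
  shows "(let z = (\<lambda>\<xi>\<^sub>0 \<xi>. 1 / R * (e1 + (R - e1) * (tanh (\<omega> * (\<xi> - \<xi>\<^sub>0)))\<^sup>2));
             \<phi> = (\<lambda>\<xi>\<^sub>0 \<phi>\<^sub>0 \<xi>. \<phi>\<^sub>0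
                    + a / (2 * R) * (\<xi> - \<xi>\<^sub>0 + \<delta> / \<omega> * arctan (\<delta> * tanh (\<omega> * (\<xi> - \<xi>\<^sub>0)))));
             X = (\<lambda>\<xi>\<^sub>0 \<phi>\<^sub>0. sphere_curve R (z \<xi>\<^sub>0) (\<phi> \<xi>\<^sub>0 \<phi>\<^sub>0))
         in (\<not> constant_latitude I x \<longrightarrow> (\<exists>\<xi>\<^sub>0 \<phi>\<^sub>0. \<forall>\<xi>\<in>I. x \<xi> = X \<xi>\<^sub>0 \<phi>\<^sub>0 \<xi>)) \<and>
            (\<forall>\<xi>\<^sub>0 \<phi>\<^sub>0.
               is_solution a \<Omega> R UNIV (X \<xi>\<^sub>0 \<phi>\<^sub>0) \<and>
               (z \<xi>\<^sub>0 \<longlongrightarrow> 1) at_infinity \<and>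
               (X \<xi>\<^sub>0 \<phi>\<^sub>0 \<longlongrightarrow> vector [0, 0, R]) at_infinity \<and>
               \<not> periodic (X \<xi>\<^sub>0 \<phi>\<^sub>0)))"
proof -
  have z: "(\<lambda>\<xi>\<^sub>0 \<xi>. 1 / R * (e1 + (R - e1) * (tanh (\<omega> * (\<xi> - \<xi>\<^sub>0)))\<^sup>2)) = height"
    by (simp add: fun_eq_iff height_def)
  have \<phi>: "(\<lambda>\<xi>\<^sub>0 \<phi>\<^sub>0 \<xi>. \<phi>\<^sub>0
      + a / (2 * R) * (\<xi> - \<xi>\<^sub>0 + \<delta> / \<omega> * arctan (\<delta> * tanh (\<omega> * (\<xi> - \<xi>\<^sub>0)))))
    = (\<lambda>\<xi>\<^sub>0 \<phi>\<^sub>0 \<xi>. \<phi>\<^sub>0 + phase \<xi>\<^sub>0 \<xi>)"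
    by (simp only: fun_eq_iff phase_def simp_thms)
  show ?thesis
    unfolding z \<phi>
    unfolding Let_def X_def[symmetric]
    using solution_eq_X[OF x] X_solution(1) height_tendsto X_tendsto X_not_periodic
    by auto
qed

end

theorem theorem2p1:
  fixes a \<Omega> R :: real
  assumes "a > 0" and "\<Omega> > 0" and "R > 0"
  shows
    \<comment> \<open>every solution with \<open>\<bar>x\<^sub>3\<bar> < R\<close> falls under (a), (b) or (c)\<close>
    "(\<forall>I x. never_polar_solution a \<Omega> R I x \<longrightarrow>
        (\<exists>C E. conserved a \<Omega> I x C E \<and>
           (constant_latitude I x \<or>
            (\<exists>e1 e2 e3. periodic_roots R (cubic a \<Omega> R C E) e1 e2 e3) \<or>
            (\<exists>e1. soliton_roots R (cubic a \<Omega> R C E) e1))))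
     \<and>
     \<comment> \<open>(a)\<close>
     (\<forall>I x. open_interval I \<longrightarrow>
        (nonpolar_solution a \<Omega> R I x \<and> constant_latitude I x \<longleftrightarrow>
         (\<exists>e \<phi>\<^sub>0 \<nu>. - R < e \<and> e < R \<and> e * \<nu>\<^sup>2 - a * \<nu> + \<Omega> = 0 \<and>
            (\<forall>\<xi>\<in>I. x \<xi> = latitude_circle R e \<phi>\<^sub>0 \<nu> \<xi>))))
     \<and>
     (\<forall>I x e \<phi>\<^sub>0 \<nu>. open_interval I \<and>
        - R < e \<and> e < R \<and> e * \<nu>\<^sup>2 - a * \<nu> + \<Omega> = 0 \<and>
        (\<forall>\<xi>\<in>I. x \<xi> = latitude_circle R e \<phi>\<^sub>0 \<nu> \<xi>) \<longrightarrow>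
          (\<forall>C E. conserved a \<Omega> I x C E \<longrightarrow> \<nu> = (C - a * e) / (R\<^sup>2 - e\<^sup>2)) \<and>
          range (latitude_circle R e \<phi>\<^sub>0 \<nu>) = {y. norm y = R \<and> y $ 3 = e} \<and>
          (\<forall>\<xi>\<in>I. vel x \<xi> = \<nu> *\<^sub>R (unit3 \<times> x \<xi>)))
     \<and>
     \<comment> \<open>(b)\<close>
     (\<forall>I x C E e1 e2 e3.
        nonpolar_solution a \<Omega> R I x \<and> conserved a \<Omega> I x C E \<and>
        periodic_roots R (cubic a \<Omega> R C E) e1 e2 e3 \<longrightarrow>
        (let \<omega> = sqrt (\<Omega> / (2 * R\<^sup>2) * (e3 - e1));
             k = (e2 - e1) / (e3 - e1);
             T = 2 * ellip_K k / \<omega>;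
             z = (\<lambda>\<xi>\<^sub>0 \<xi>. 1 / R * (e1 + (e2 - e1) * (jacobi_sn (\<omega> * (\<xi> - \<xi>\<^sub>0)) k)\<^sup>2));
             \<phi> = (\<lambda>\<xi>\<^sub>0 \<phi>\<^sub>0 \<xi>. \<phi>\<^sub>0
                    + (C - a * R) / (2 * R * (R - e1) * \<omega>)
                        * ellip_Pi_inc (\<omega> * (\<xi> - \<xi>\<^sub>0)) ((e2 - e1) / (R - e1)) k
                    + (C + a * R) / (2 * R * (R + e1) * \<omega>)
                        * ellip_Pi_inc (\<omega> * (\<xi> - \<xi>\<^sub>0)) (- ((e2 - e1) / (R + e1))) k);
             X = (\<lambda>\<xi>\<^sub>0 \<phi>\<^sub>0. sphere_curve R (z \<xi>\<^sub>0) (\<phi> \<xi>\<^sub>0 \<phi>\<^sub>0));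
             closing = (\<lambda>p q :: int. q \<ge> 1 \<and> gcd p q = 1 \<and>
                  (C - a * R) / (R * (R - e1)) * ellip_Pi ((e2 - e1) / (R - e1)) k
                    + (C + a * R) / (R * (R + e1)) * ellip_Pi (- ((e2 - e1) / (R + e1))) k
                  = 2 * pi * \<omega> * (of_int p / of_int q))
         in 0 < k \<and> k < 1 \<and>
            (\<not> constant_latitude I x \<longrightarrow> (\<exists>\<xi>\<^sub>0 \<phi>\<^sub>0. \<forall>\<xi>\<in>I. x \<xi> = X \<xi>\<^sub>0 \<phi>\<^sub>0 \<xi>)) \<and>
            (\<forall>\<xi>\<^sub>0 \<phi>\<^sub>0.
               is_solution a \<Omega> R UNIV (X \<xi>\<^sub>0 \<phi>\<^sub>0) \<and>
               minimal_period (z \<xi>\<^sub>0) T \<and>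
               minimal_period (\<lambda>\<xi>. X \<xi>\<^sub>0 \<phi>\<^sub>0 \<xi> $ 3) T \<and>
               \<comment> \<open>(b)(i)\<close>
               (periodic (X \<xi>\<^sub>0 \<phi>\<^sub>0) \<longleftrightarrow> (\<exists>p q. closing p q)) \<and>
               (\<forall>p q. closing p q \<longrightarrow> minimal_period (X \<xi>\<^sub>0 \<phi>\<^sub>0) (of_int q * T)) \<and>
               \<comment> \<open>(b)(ii)\<close>
               (\<not> (\<exists>p q. closing p q) \<longrightarrow>
                  periodic_fun_simple (\<lambda>\<xi>. X \<xi>\<^sub>0 \<phi>\<^sub>0 \<xi> $ 3) T \<and>
                  (\<forall>\<xi>. (\<phi> \<xi>\<^sub>0 \<phi>\<^sub>0 (\<xi> + T) - \<phi> \<xi>\<^sub>0 \<phi>\<^sub>0 \<xi>) / (2 * pi) \<notin> \<rat>) \<and>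
                  \<not> periodic (X \<xi>\<^sub>0 \<phi>\<^sub>0)))))
     \<and>
     \<comment> \<open>(c)\<close>
     (\<forall>I x C E e1.
        nonpolar_solution a \<Omega> R I x \<and> conserved a \<Omega> I x C E \<and>
        soliton_roots R (cubic a \<Omega> R C E) e1 \<longrightarrow>
        C = a * R \<and>
        (let \<omega> = sqrt (\<Omega> / (2 * R\<^sup>2) * (R - e1));
             \<delta> = sqrt ((R - e1) / (R + e1));
             z = (\<lambda>\<xi>\<^sub>0 \<xi>. 1 / R * (e1 + (R - e1) * (tanh (\<omega> * (\<xi> - \<xi>\<^sub>0)))\<^sup>2));
             \<phi> = (\<lambda>\<xi>\<^sub>0 \<phi>\<^sub>0 \<xi>. \<phi>\<^sub>0
                    + a / (2 * R) * (\<xi> - \<xi>\<^sub>0 + \<delta> / \<omega> * arctan (\<delta> * tanh (\<omega> * (\<xi> - \<xi>\<^sub>0)))));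
             X = (\<lambda>\<xi>\<^sub>0 \<phi>\<^sub>0. sphere_curve R (z \<xi>\<^sub>0) (\<phi> \<xi>\<^sub>0 \<phi>\<^sub>0))
         in (\<not> constant_latitude I x \<longrightarrow> (\<exists>\<xi>\<^sub>0 \<phi>\<^sub>0. \<forall>\<xi>\<in>I. x \<xi> = X \<xi>\<^sub>0 \<phi>\<^sub>0 \<xi>)) \<and>
            (\<forall>\<xi>\<^sub>0 \<phi>\<^sub>0.
               is_solution a \<Omega> R UNIV (X \<xi>\<^sub>0 \<phi>\<^sub>0) \<and>
               (z \<xi>\<^sub>0 \<longlongrightarrow> 1) at_infinity \<and>
               (X \<xi>\<^sub>0 \<phi>\<^sub>0 \<longlongrightarrow> vector [0, 0, R]) at_infinity \<and>
               \<not> periodic (X \<xi>\<^sub>0 \<phi>\<^sub>0))))"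
proof (intro conjI allI impI, goal_cases)
  case (1 I x)
  then have "is_solution a \<Omega> R I x"
    by (simp add: never_polar_solution_def)
  then obtain C E where "conserved a \<Omega> I x C E"
    using conserved_exists assms(3) by blast
  then show ?case
    using never_polar_trichotomy[OF assms 1] by blast
next
  case (2 I x)
  then show ?case
    by (rule constant_latitude_iff[OF assms(1,3)])
next
  case (3 I x e \<phi>\<^sub>0 \<nu> C E)
  then show ?case
    using latitude_circle_properties(1)[OF assms(2,3)] by blast
next
  case (4 I x e \<phi>\<^sub>0 \<nu>)
  then show ?case
    using latitude_circle_properties(2)[OF assms(2,3)] by blast
next
  case (5 I x e \<phi>\<^sub>0 \<nu>)
  then show ?case
    using latitude_circle_properties(3)[OF assms(2,3)] by blast
next
  case (6 I x C E e1 e2 e3)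
  then interpret elliptic_nonpolar \<Omega> R e1 e2 e3 "sqrt (\<Omega> / (2 * R\<^sup>2) * (e3 - e1))"
      "(e2 - e1) / (e3 - e1)" a C E
    by unfold_locales (use assms in \<open>simp_all add: periodic_roots_def\<close>)
  have "nonpolar_solution a \<Omega> R I x" "conserved a \<Omega> I x C E"
    using 6 by blast+
  from elliptic_solutions[OF this] show ?case
    unfolding Let_def .
next
  case (7 I x C E e1)
  then show ?case
    using soliton_roots_factor(1)[OF assms] by blast
next
  case (8 I x C E e1)
  then have s: "soliton_roots R (cubic a \<Omega> R C E) e1"
    by blast
  interpret soliton_profile a \<Omega> R C E e1 "sqrt (\<Omega> / (2 * R\<^sup>2) * (R - e1))" "sqrt ((R - e1) / (R + e1))"
    by unfold_locales
      (use assms s soliton_roots_factor[OF assms s] in \<open>simp_all add: soliton_roots_def\<close>)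
  have "nonpolar_solution a \<Omega> R I x" "conserved a \<Omega> I x C E"
    using 8 by blast+
  from soliton_solutions[OF this] show ?case
    unfolding Let_def .
qed

end
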